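(* For all $p,q\in\Bbbk^\times$, the algebra $H_{p,q}$ may be presented as an iterated skew polynomial ring over $\Bbbk$, and hence is a prime, noetherian domain.
   Context: $\Bbbk$ is an uncountable, algebraically closed field of characteristic zero. For $p,q\in\Bbbk^\times$, $H_{p,q}=\Bbbk\langle x,y,z\mid zx-p^{-1}xz,\ zy-pyz,\ yx-qxy-z\rangle$. Given a ring $R$ and $\sigma\in\mathrm{Aut}(R)$, a $\Bbbk$-linear map $\delta:R\to R$ is a $\sigma$-derivation if $\delta(r_1r_2)=\sigma(r_1)\delta(r_2)+\delta(r_1)r_2$ for all $r_1,r_2\in R$. The skew polynomial ring $R[x;\sigma,\delta]$ is the overring of $R$ (free as a left $R$-module on the powers of $x$) with commutation $xr=\sigma(r)x+\delta(r)$ for all $r\in R$. An iterated skew polynomial ring over $\Bbbk$ is one obtained from $\Bbbk$ by finitely many such extensions. *)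

theory Defs
  imports "HOL-Algebra.Algebra" "HOL-Library.Countable_Set"
begin

text \<open>The library's \<^locale>\<open>algebra\<close>, \<^locale>\<open>domain\<close> and \<^locale>\<open>primeideal\<close> are restricted to
  commutative rings, and \<^locale>\<open>noetherian_ring\<close> only concerns two-sided ideals. The
  noncommutative versions are introduced here.\<close>

locale assoc_algebra = module K A + A: ring A for K (structure) and A (structure) +
  assumes smult_mult_left:
      "\<lbrakk>c \<in> carrier K; a \<in> carrier A; b \<in> carrier A\<rbrakk>
        \<Longrightarrow> c \<odot>\<^bsub>A\<^esub> (a \<otimes>\<^bsub>A\<^esub> b) = (c \<odot>\<^bsub>A\<^esub> a) \<otimes>\<^bsub>A\<^esub> b"
    and smult_mult_right:
      "\<lbrakk>c \<in> carrier K; a \<in> carrier A; b \<in> carrier A\<rbrakk>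
        \<Longrightarrow> c \<odot>\<^bsub>A\<^esub> (a \<otimes>\<^bsub>A\<^esub> b) = a \<otimes>\<^bsub>A\<^esub> (c \<odot>\<^bsub>A\<^esub> b)"

definition char_zero :: "('k, 'm) ring_scheme \<Rightarrow> bool" where
  "char_zero K \<longleftrightarrow> (\<forall>n::nat. n > 0 \<longrightarrow> [n] \<cdot>\<^bsub>K\<^esub> \<one>\<^bsub>K\<^esub> \<noteq> \<zero>\<^bsub>K\<^esub>)"


section \<open>Ring-theoretic properties\<close>

definition nc_domain :: "('a, 'm) ring_scheme \<Rightarrow> bool" where
  "nc_domain R \<longleftrightarrow> ring R \<and> \<one>\<^bsub>R\<^esub> \<noteq> \<zero>\<^bsub>R\<^esub> \<and>
     (\<forall>a \<in> carrier R. \<forall>b \<in> carrier R. a \<otimes>\<^bsub>R\<^esub> b = \<zero>\<^bsub>R\<^esub> \<longrightarrow> a = \<zero>\<^bsub>R\<^esub> \<or> b = \<zero>\<^bsub>R\<^esub>)"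

definition prime_ring :: "('a, 'm) ring_scheme \<Rightarrow> bool" where
  "prime_ring R \<longleftrightarrow> ring R \<and> \<one>\<^bsub>R\<^esub> \<noteq> \<zero>\<^bsub>R\<^esub> \<and>
     (\<forall>I J. ideal I R \<and> ideal J R \<and> I \<cdot>\<^bsub>R\<^esub> J = {\<zero>\<^bsub>R\<^esub>} \<longrightarrow> I = {\<zero>\<^bsub>R\<^esub>} \<or> J = {\<zero>\<^bsub>R\<^esub>})"

definition left_ideal :: "'a set \<Rightarrow> ('a, 'm) ring_scheme \<Rightarrow> bool" where
  "left_ideal I R \<longleftrightarrow> additive_subgroup I R \<and>
     (\<forall>r \<in> carrier R. \<forall>a \<in> I. r \<otimes>\<^bsub>R\<^esub> a \<in> I)"

definition right_ideal :: "'a set \<Rightarrow> ('a, 'm) ring_scheme \<Rightarrow> bool" where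
  "right_ideal I R \<longleftrightarrow> additive_subgroup I R \<and>
     (\<forall>r \<in> carrier R. \<forall>a \<in> I. a \<otimes>\<^bsub>R\<^esub> r \<in> I)"

definition left_noetherian :: "('a, 'm) ring_scheme \<Rightarrow> bool" where
  "left_noetherian R \<longleftrightarrow> ring R \<and>
     (\<forall>I :: nat \<Rightarrow> 'a set. (\<forall>n. left_ideal (I n) R \<and> I n \<subseteq> I (Suc n))
        \<longrightarrow> (\<exists>N. \<forall>n \<ge> N. I n = I N))"

definition right_noetherian :: "('a, 'm) ring_scheme \<Rightarrow> bool" where
  "right_noetherian R \<longleftrightarrow> ring R \<and>
     (\<forall>I :: nat \<Rightarrow> 'a set. (\<forall>n. right_ideal (I n) R \<and> I n \<subseteq> I (Suc n))
        \<longrightarrow> (\<exists>N. \<forall>n \<ge> N. I n = I N))"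

definition noetherian :: "('a, 'm) ring_scheme \<Rightarrow> bool" where
  "noetherian R \<longleftrightarrow> left_noetherian R \<and> right_noetherian R"


section \<open>Skew polynomial rings\<close>

definition sigma_derivation ::
  "('k, 'm) ring_scheme \<Rightarrow> ('k, 'a, 'n) module_scheme \<Rightarrow> 'a set \<Rightarrow> ('a \<Rightarrow> 'a) \<Rightarrow> ('a \<Rightarrow> 'a) \<Rightarrow> bool"
  where
  "sigma_derivation K A R \<sigma> \<delta> \<longleftrightarrow>
     \<delta> \<in> R \<rightarrow> R \<and>
     (\<forall>r \<in> R. \<forall>s \<in> R. \<delta> (r \<oplus>\<^bsub>A\<^esub> s) = \<delta> r \<oplus>\<^bsub>A\<^esub> \<delta> s) \<and>
     (\<forall>c \<in> carrier K. \<forall>r \<in> R. \<delta> (c \<odot>\<^bsub>A\<^esub> r) = c \<odot>\<^bsub>A\<^esub> \<delta> r) \<and>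
     (\<forall>r \<in> R. \<forall>s \<in> R. \<delta> (r \<otimes>\<^bsub>A\<^esub> s) = \<sigma> r \<otimes>\<^bsub>A\<^esub> \<delta> s \<oplus>\<^bsub>A\<^esub> \<delta> r \<otimes>\<^bsub>A\<^esub> s)"

text \<open>\<open>skew_poly_ext K A R \<sigma> \<delta> x S\<close> says that \<open>S = R[x; \<sigma>, \<delta>]\<close>, where both rings are realised
  as subrings of the ambient \<open>K\<close>-algebra \<open>A\<close>. The last conjunct is freeness of \<open>S\<close> as a left
  \<open>R\<close>-module on the powers of \<open>x\<close>. Linearity of \<open>\<sigma>\<close> over \<open>K\<close> need not be demanded: it follows
  from linearity of \<open>\<delta>\<close>, because scalars are central in \<open>A\<close>.\<close>

definition skew_poly_ext ::
  "('k, 'm) ring_scheme \<Rightarrow> ('k, 'a, 'n) module_scheme \<Rightarrow> 'a set \<Rightarrow> ('a \<Rightarrow> 'a) \<Rightarrow> ('a \<Rightarrow> 'a)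
    \<Rightarrow> 'a \<Rightarrow> 'a set \<Rightarrow> bool" where
  "skew_poly_ext K A R \<sigma> \<delta> x S \<longleftrightarrow>
     subring R A \<and> subring S A \<and> R \<subseteq> S \<and> x \<in> S \<and>
     \<sigma> \<in> ring_iso (A\<lparr>carrier := R\<rparr>) (A\<lparr>carrier := R\<rparr>) \<and>
     sigma_derivation K A R \<sigma> \<delta> \<and>
     (\<forall>r \<in> R. x \<otimes>\<^bsub>A\<^esub> r = \<sigma> r \<otimes>\<^bsub>A\<^esub> x \<oplus>\<^bsub>A\<^esub> \<delta> r) \<and>
     (\<forall>s \<in> S. \<exists>!f :: nat \<Rightarrow> 'a. range f \<subseteq> R \<and> finite {i. f i \<noteq> \<zero>\<^bsub>A\<^esub>} \<and>
        s = (\<Oplus>\<^bsub>A\<^esub>i \<in> {i. f i \<noteq> \<zero>\<^bsub>A\<^esub>}. f i \<otimes>\<^bsub>A\<^esub> (x [^]\<^bsub>A\<^esub> i)))"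

text \<open>The injectivity premise in the base case makes the starting ring \<open>K \<cdot> 1\<close> a copy of \<open>K\<close>,
  which only excludes the zero ring.\<close>

inductive iterated_skew_sub ::
  "('k, 'm) ring_scheme \<Rightarrow> ('k, 'a, 'n) module_scheme \<Rightarrow> 'a set \<Rightarrow> bool" for K A where
  base: "inj_on (\<lambda>c. c \<odot>\<^bsub>A\<^esub> \<one>\<^bsub>A\<^esub>) (carrier K) \<Longrightarrow>
    iterated_skew_sub K A ((\<lambda>c. c \<odot>\<^bsub>A\<^esub> \<one>\<^bsub>A\<^esub>) ` carrier K)"
| step: "\<lbrakk>iterated_skew_sub K A R; skew_poly_ext K A R \<sigma> \<delta> x S\<rbrakk> \<Longrightarrow> iterated_skew_sub K A S"

definition iterated_skew_polynomial_ring ::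
  "('k, 'm) ring_scheme \<Rightarrow> ('k, 'a, 'n) module_scheme \<Rightarrow> bool" where
  "iterated_skew_polynomial_ring K A \<longleftrightarrow>
     assoc_algebra K A \<and> iterated_skew_sub K A (carrier A)"


section \<open>Free algebras, quotients, and the algebras \<open>H\<^sub>p\<^sub>,\<^sub>q\<close>\<close>

text \<open>Elements of the free algebra are finitely supported coefficient functions on words; the
  coefficient of a product at \<open>w\<close> runs over all splittings of \<open>w\<close> into a prefix and a suffix.\<close>

definition free_algebra :: "('k, 'm) ring_scheme \<Rightarrow> ('k, 'g list \<Rightarrow> 'k) module" where
  "free_algebra K =
     \<lparr>carrier = {f. range f \<subseteq> carrier K \<and> finite {w. f w \<noteq> \<zero>\<^bsub>K\<^esub>}},
      monoid.mult = (\<lambda>f g w. \<Oplus>\<^bsub>K\<^esub>i \<in> {..length w}. f (take i w) \<otimes>\<^bsub>K\<^esub> g (drop i w)),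
      one = (\<lambda>w. if w = [] then \<one>\<^bsub>K\<^esub> else \<zero>\<^bsub>K\<^esub>),
      ring.zero = (\<lambda>w. \<zero>\<^bsub>K\<^esub>),
      add = (\<lambda>f g w. f w \<oplus>\<^bsub>K\<^esub> g w),
      smult = (\<lambda>c f w. c \<otimes>\<^bsub>K\<^esub> f w)\<rparr>"

definition free_gen :: "('k, 'm) ring_scheme \<Rightarrow> 'g \<Rightarrow> 'g list \<Rightarrow> 'k" where
  "free_gen K g = (\<lambda>w. if w = [g] then \<one>\<^bsub>K\<^esub> else \<zero>\<^bsub>K\<^esub>)"

text \<open>The scalar action on cosets is \<open>c \<odot> (I + a) = I + c \<odot> a\<close>, written independently of the
  representative as in \<^const>\<open>rcoset_mult\<close>.\<close>

definition quot_algebra :: "('k, 'a, 'n) module_scheme \<Rightarrow> 'a set \<Rightarrow> ('k, 'a set) module" where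
  "quot_algebra A I =
     ring.extend (A Quot I) (module.fields (\<lambda>c C. \<Union>a \<in> C. I +>\<^bsub>A\<^esub> (c \<odot>\<^bsub>A\<^esub> a)))"

datatype gen = GenX | GenY | GenZ

definition H_relations :: "('k, 'm) ring_scheme \<Rightarrow> 'k \<Rightarrow> 'k \<Rightarrow> (gen list \<Rightarrow> 'k) set" where
  "H_relations K p q =
     (let F = free_algebra K; x = free_gen K GenX; y = free_gen K GenY; z = free_gen K GenZ
      in {z \<otimes>\<^bsub>F\<^esub> x \<ominus>\<^bsub>F\<^esub> (inv\<^bsub>K\<^esub> p) \<odot>\<^bsub>F\<^esub> (x \<otimes>\<^bsub>F\<^esub> z),
          z \<otimes>\<^bsub>F\<^esub> y \<ominus>\<^bsub>F\<^esub> p \<odot>\<^bsub>F\<^esub> (y \<otimes>\<^bsub>F\<^esub> z),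
          y \<otimes>\<^bsub>F\<^esub> x \<ominus>\<^bsub>F\<^esub> q \<odot>\<^bsub>F\<^esub> (x \<otimes>\<^bsub>F\<^esub> y) \<ominus>\<^bsub>F\<^esub> z})"

definition H_alg :: "('k, 'm) ring_scheme \<Rightarrow> 'k \<Rightarrow> 'k \<Rightarrow> ('k, (gen list \<Rightarrow> 'k) set) module" where
  "H_alg K p q = quot_algebra (free_algebra K) (Idl\<^bsub>free_algebra K\<^esub> (H_relations K p q))"

end

theory Submission
  imports Defs
begin

text \<open>
  The algebra is built up as \<open>K \<subseteq> K[x] \<subseteq> K[x][z; \<beta>] \<subseteq> K[x][z; \<beta>][y; \<gamma>, \<delta>]\<close>, where
  \<open>\<beta>(x) = p\<^sup>-\<^sup>1x\<close>, \<open>\<gamma>(x) = qx\<close>, \<open>\<gamma>(z) = p\<^sup>-\<^sup>1z\<close>, \<open>\<delta>(x) = z\<close> and \<open>\<delta>(z) = 0\<close>; the three defining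
  relations are exactly the commutation rules of this tower. All rings involved are subrings of
  \<open>H\<close>, so two things have to be shown about \<open>H\<close> itself.

  \<^item> The twisting maps exist and are bijective. The relations are homogeneous for the grading in which
    \<open>x\<close> and \<open>y\<close> have independent degrees and \<open>z\<close> has their sum, so a two-dimensional torus acts on \<open>H\<close>
    (lemma \<open>torus_automorphism\<close>), and \<open>\<beta>\<close> and \<open>\<gamma>\<close> are restrictions of torus elements. The
    derivation is then forced to be \<open>\<delta>(r) = yr - \<gamma>(r)y\<close>: this formula satisfies the twisted Leibniz
    rule identically, so it only remains to see that it maps the subring into itself, which can be
    tested on generators (lemma \<open>skew_poly_ext_generate_ring\<close>).

  \<^item> The powers of each new variable are left independent over the smaller ring. The algebra \<open>H\<close> acts
    on functions on \<open>\<nat>\<^sup>3\<close>, the basis vector at \<open>(i, j, k)\<close> playing the part of the monomial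
    \<open>x\<^sup>iz\<^sup>jy\<^sup>k\<close>; this is what left multiplication in \<open>H\<close> has to be. Elements of the smaller ring commute
    with the operators that cut out a slice of \<open>\<nat>\<^sup>3\<close> in the direction of the new variable, while powers
    of the new variable move the vacuum \<open>(0, 0, 0)\<close> to different slices. Hence the coefficients of a
    left polynomial in the new variable can be read off from its value at the vacuum, provided that
    elements of the smaller ring are determined by theirs. This proviso is carried along the tower
    (lemma \<open>ore_step\<close>).

  For any iterated skew polynomial ring over a field the remaining properties follow by induction on
  the tower (lemma \<open>iterated_skew_sub_properties\<close>). Leading coefficients multiply up to the injective
  twist, so being a domain is inherited. Chain conditions are inherited by Hilbert's basis theorem;
  it is proved for extensions with \<open>xR + R = Rx + R\<close>, a condition that is symmetric under passing to
  the opposite ring, so that the left-handed statement yields the right-handed one.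
\<close>

section \<open>Hilbert's basis theorem for almost normalizing extensions\<close>

text \<open>The left polynomials of degree below \<open>n\<close> in \<open>x\<close>. The recursion on the leading term only mentions
  the ring operations, so the set is the same in every subring that contains \<open>R\<close> and \<open>x\<close>, and it makes
  induction on the degree immediate.\<close>

primrec bounded_left_polys :: "('a, 'm) ring_scheme \<Rightarrow> 'a set \<Rightarrow> 'a \<Rightarrow> nat \<Rightarrow> 'a set" where
  "bounded_left_polys A R x 0 = {\<zero>\<^bsub>A\<^esub>}"
| "bounded_left_polys A R x (Suc n) =
     {t \<oplus>\<^bsub>A\<^esub> r \<otimes>\<^bsub>A\<^esub> x [^]\<^bsub>A\<^esub> n | t r. t \<in> bounded_left_polys A R x n \<and> r \<in> R}"

text \<open>The two swap conditions together say \<open>xR + R = Rx + R\<close>. Every skew polynomial ring satisfies them,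
  the second one because the twist is surjective.\<close>

locale almost_normalizing = ring A for A (structure) +
  fixes R :: "'a set" and x :: 'a
  assumes subring: "subring R A"
    and x_closed [simp]: "x \<in> carrier A"
    and left_swap: "r \<in> R \<Longrightarrow> \<exists>r' \<in> R. \<exists>r'' \<in> R. x \<otimes> r = r' \<otimes> x \<oplus> r''"
    and right_swap: "r \<in> R \<Longrightarrow> \<exists>r' \<in> R. \<exists>r'' \<in> R. r \<otimes> x = x \<otimes> r' \<oplus> r''"
begin

abbreviation P :: "nat \<Rightarrow> 'a set" where "P \<equiv> bounded_left_polys A R x"

lemmas R_closed = subringE[OF subring]

lemma R_carr [simp]: "r \<in> R \<Longrightarrow> r \<in> carrier A"
  using R_closed(1) by blast

lemma P_carr [simp]: "t \<in> P n \<Longrightarrow> t \<in> carrier A"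
  by (induction n arbitrary: t) auto

lemma P_zero [simp]: "\<zero> \<in> P n"
proof (induction n)
  case (Suc n)
  have "\<zero> = \<zero> \<oplus> \<zero> \<otimes> x [^] n" by simp
  then show ?case using Suc R_closed(2) unfolding bounded_left_polys.simps by blast
qed simp

lemma P_SucI: "\<lbrakk>t \<in> P n; r \<in> R; s = t \<oplus> r \<otimes> x [^] n\<rbrakk> \<Longrightarrow> s \<in> P (Suc n)"
  by auto

lemma P_SucE:
  assumes "s \<in> P (Suc n)"
  obtains t r where "t \<in> P n" "r \<in> R" "s = t \<oplus> r \<otimes> x [^] n"
  using assms by auto

lemma P_Suc_mono: "t \<in> P n \<Longrightarrow> t \<in> P (Suc n)"
  using P_SucI[of t n \<zero>] R_closed(2) by simp

lemma P_mono: "t \<in> P n \<Longrightarrow> n \<le> m \<Longrightarrow> t \<in> P m"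
  by (induction m) (auto simp: le_Suc_eq P_Suc_mono simp del: bounded_left_polys.simps)

lemma P_monom: "r \<in> R \<Longrightarrow> r \<otimes> x [^] n \<in> P (Suc n)"
  by (rule P_SucI[of \<zero> n r]) auto

lemma P_add: "\<lbrakk>s \<in> P n; t \<in> P n\<rbrakk> \<Longrightarrow> s \<oplus> t \<in> P n"
proof (induction n arbitrary: s t)
  case (Suc n)
  obtain s' r where s: "s' \<in> P n" "r \<in> R" "s = s' \<oplus> r \<otimes> x [^] n" using Suc.prems(1) by (rule P_SucE)
  obtain t' u where t: "t' \<in> P n" "u \<in> R" "t = t' \<oplus> u \<otimes> x [^] n" using Suc.prems(2) by (rule P_SucE)
  have "s \<oplus> t = (s' \<oplus> t') \<oplus> (r \<oplus> u) \<otimes> x [^] n"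
    using s t P_carr R_carr by (simp add: l_distr a_ac)
  then show ?case using P_SucI[OF Suc.IH[OF s(1) t(1)] R_closed(7)[OF s(2) t(2)]] by blast
qed simp

lemma P_lmult: "\<lbrakk>r \<in> R; t \<in> P n\<rbrakk> \<Longrightarrow> r \<otimes> t \<in> P n"
proof (induction n arbitrary: t)
  case (Suc n)
  obtain t' u where t: "t' \<in> P n" "u \<in> R" "t = t' \<oplus> u \<otimes> x [^] n" using Suc.prems(2) by (rule P_SucE)
  have "r \<otimes> t = r \<otimes> t' \<oplus> (r \<otimes> u) \<otimes> x [^] n"
    using t Suc.prems(1) P_carr R_carr by (simp add: r_distr m_assoc)
  then show ?case
    using P_SucI[OF Suc.IH[OF Suc.prems(1) t(1)] R_closed(6)[OF Suc.prems(1) t(2)]] by blast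
qed simp

lemma P_minus: "t \<in> P n \<Longrightarrow> \<ominus> t \<in> P n"
  using P_lmult[of "\<ominus> \<one>" t n] R_closed(3,5) by (simp add: l_minus)

lemma P_diff: "\<lbrakk>s \<in> P n; t \<in> P n\<rbrakk> \<Longrightarrow> s \<ominus> t \<in> P n"
  by (simp add: a_minus_def P_add P_minus)

lemma P_mult_x: "t \<in> P n \<Longrightarrow> t \<otimes> x \<in> P (Suc n)"
proof (induction n arbitrary: t)
  case (Suc n)
  obtain t' u where t: "t' \<in> P n" "u \<in> R" "t = t' \<oplus> u \<otimes> x [^] n" using Suc.prems by (rule P_SucE)
  have "t \<otimes> x = t' \<otimes> x \<oplus> u \<otimes> x [^] Suc n"
    using t P_carr R_carr by (simp add: l_distr m_assoc)
  then show ?case using P_SucI[OF Suc.IH[OF t(1)] t(2)] by blast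
qed (simp add: P_zero del: bounded_left_polys.simps(2))

lemma x_mult_P: "t \<in> P n \<Longrightarrow> x \<otimes> t \<in> P (Suc n)"
proof (induction n arbitrary: t)
  case (Suc n)
  obtain t' u where t: "t' \<in> P n" "u \<in> R" "t = t' \<oplus> u \<otimes> x [^] n" using Suc.prems by (rule P_SucE)
  obtain u' u'' where u: "u' \<in> R" "u'' \<in> R" "x \<otimes> u = u' \<otimes> x \<oplus> u''" using left_swap[OF t(2)] by blast
  have "x \<otimes> t = x \<otimes> t' \<oplus> (x \<otimes> u) \<otimes> x [^] n"
    using t P_carr R_carr by (simp add: r_distr m_assoc)
  also have "\<dots> = (x \<otimes> t' \<oplus> u'' \<otimes> x [^] n) \<oplus> u' \<otimes> x [^] Suc n"
    unfolding nat_pow_Suc2[OF x_closed] using t(1) u by (simp add: l_distr m_assoc a_ac)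
  finally show ?case
    using P_SucI[OF P_add[OF Suc.IH[OF t(1)] P_monom[OF u(2)]] u(1)] by blast
qed (simp add: P_zero del: bounded_left_polys.simps(2))

lemma mult_xpow_P: "t \<in> P m \<Longrightarrow> t \<otimes> x [^] n \<in> P (n + m)"
proof (induction n arbitrary: t)
  case (Suc n)
  have "t \<otimes> x [^] Suc n = (t \<otimes> x [^] n) \<otimes> x" using Suc.prems by (simp add: m_assoc)
  then show ?case using P_mult_x[OF Suc.IH[OF Suc.prems]] by simp
qed simp

lemma xpow_mult_P: "t \<in> P m \<Longrightarrow> x [^] n \<otimes> t \<in> P (n + m)"
proof (induction n arbitrary: t)
  case (Suc n)
  have "x [^] Suc n \<otimes> t = x \<otimes> (x [^] n \<otimes> t)"
    unfolding nat_pow_Suc2[OF x_closed] using Suc.prems by (simp add: m_assoc)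
  then show ?case using x_mult_P[OF Suc.IH[OF Suc.prems]] by simp
qed simp

lemma xpow_left_swap: "r \<in> R \<Longrightarrow> \<exists>r' \<in> R. \<exists>u \<in> P n. x [^] n \<otimes> r = r' \<otimes> x [^] n \<oplus> u"
proof (induction n)
  case (Suc n)
  then obtain r' u where r: "r' \<in> R" "u \<in> P n" "x [^] n \<otimes> r = r' \<otimes> x [^] n \<oplus> u" by blast
  obtain s s' where s: "s \<in> R" "s' \<in> R" "x \<otimes> r' = s \<otimes> x \<oplus> s'" using left_swap[OF r(1)] by blast
  have "x [^] Suc n \<otimes> r = x \<otimes> (x [^] n \<otimes> r)"
    unfolding nat_pow_Suc2[OF x_closed] using Suc.prems by (simp add: m_assoc)
  also have "\<dots> = (x \<otimes> r') \<otimes> x [^] n \<oplus> x \<otimes> u" using r by (simp add: r_distr m_assoc)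
  also have "\<dots> = s \<otimes> x [^] Suc n \<oplus> (s' \<otimes> x [^] n \<oplus> x \<otimes> u)" 
    unfolding nat_pow_Suc2[OF x_closed] using s r(1,2) by (simp add: l_distr m_assoc a_ac)
  finally show ?case using P_add[OF P_monom[OF s(2)] x_mult_P[OF r(2)]] s(1) by blast
qed (intro bexI[of _ r] bexI[of _ \<zero>], auto)

lemma xpow_mult_R: "r \<in> R \<Longrightarrow> x [^] n \<otimes> r \<in> P (Suc n)"
  using xpow_left_swap[of r n] P_add P_monom P_Suc_mono by metis

lemma xpow_right_swap: "r \<in> R \<Longrightarrow> \<exists>r' \<in> R. \<exists>u \<in> P n. r \<otimes> x [^] n = x [^] n \<otimes> r' \<oplus> u"
proof (induction n)
  case (Suc n)
  then obtain r' u where r: "r' \<in> R" "u \<in> P n" "r \<otimes> x [^] n = x [^] n \<otimes> r' \<oplus> u" by blast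
  obtain s s' where s: "s \<in> R" "s' \<in> R" "r' \<otimes> x = x \<otimes> s \<oplus> s'" using right_swap[OF r(1)] by blast
  have "r \<otimes> x [^] Suc n = (r \<otimes> x [^] n) \<otimes> x" using Suc.prems by (simp add: m_assoc)
  also have "\<dots> = x [^] n \<otimes> (r' \<otimes> x) \<oplus> u \<otimes> x" using r by (simp add: l_distr m_assoc)
  also have "\<dots> = x [^] Suc n \<otimes> s \<oplus> (x [^] n \<otimes> s' \<oplus> u \<otimes> x)"
    using s r(1,2) by (simp add: r_distr m_assoc a_ac)
  finally show ?case using P_add[OF xpow_mult_R[OF s(2)] P_mult_x[OF r(2)]] s(1) by blast
qed (intro bexI[of _ r] bexI[of _ \<zero>], auto)

text \<open>Coefficients may equally be written on the right of the power of \<open>x\<close>, at the cost of lower terms.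
  This makes the filtration by degree independent of the side.\<close>

lemma P_Suc_right:
  "P (Suc n) = {t \<oplus> x [^] n \<otimes> r | t r. t \<in> P n \<and> r \<in> R}"
proof (intro equalityI subsetI)
  fix s assume "s \<in> P (Suc n)"
  then obtain t r where t: "t \<in> P n" "r \<in> R" "s = t \<oplus> r \<otimes> x [^] n" by (rule P_SucE)
  obtain r' u where r: "r' \<in> R" "u \<in> P n" "r \<otimes> x [^] n = x [^] n \<otimes> r' \<oplus> u"
    using xpow_right_swap[OF t(2)] by blast
  have "s = (t \<oplus> u) \<oplus> x [^] n \<otimes> r'" using t(1,2) r(1,2) by (simp add: t(3) r(3) a_ac)
  then show "s \<in> {t \<oplus> x [^] n \<otimes> r | t r. t \<in> P n \<and> r \<in> R}" using P_add[OF t(1) r(2)] r(1) by blast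
next
  fix s assume "s \<in> {t \<oplus> x [^] n \<otimes> r | t r. t \<in> P n \<and> r \<in> R}"
  then show "s \<in> P (Suc n)" by (auto intro: P_add P_Suc_mono xpow_mult_R simp del: bounded_left_polys.simps)
qed

lemma P_mult_R: "\<lbrakk>t \<in> P n; r \<in> R\<rbrakk> \<Longrightarrow> t \<otimes> r \<in> P n"
proof (induction n arbitrary: t)
  case (Suc n)
  obtain t' u where t: "t' \<in> P n" "u \<in> R" "t = t' \<oplus> u \<otimes> x [^] n" using Suc.prems(1) by (rule P_SucE)
  have "t \<otimes> r = t' \<otimes> r \<oplus> u \<otimes> (x [^] n \<otimes> r)"
    using t Suc.prems by (simp add: l_distr m_assoc)
  then show ?case
    using P_add[OF P_Suc_mono[OF Suc.IH[OF t(1) Suc.prems(2)]] P_lmult[OF t(2) xpow_mult_R[OF Suc.prems(2)]]]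
    by simp
qed simp

text \<open>Degrees are subadditive under multiplication; the bounds are strict, which is why one of the factors
  is taken from a successor level.\<close>

lemma P_mult_P: "\<lbrakk>s \<in> P n; t \<in> P (Suc m)\<rbrakk> \<Longrightarrow> s \<otimes> t \<in> P (n + m)"
proof (induction n arbitrary: s)
  case (Suc n)
  obtain s' r where s: "s' \<in> P n" "r \<in> R" "s = s' \<oplus> r \<otimes> x [^] n" using Suc.prems(1) by (rule P_SucE)
  have tc: "t \<in> carrier A" using Suc.prems(2) by (rule P_carr)
  have "s \<otimes> t = s' \<otimes> t \<oplus> r \<otimes> (x [^] n \<otimes> t)"
    using s tc by (simp add: l_distr m_assoc)
  then show ?case
    using P_add[OF P_Suc_mono[OF Suc.IH[OF s(1) Suc.prems(2)]]] P_lmult[OF s(2) xpow_mult_P[OF Suc.prems(2), of n]]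
    by simp
qed (simp add: P_carr del: bounded_left_polys.simps(2))

text \<open>The leading coefficients of elements of degree \<open>n\<close>, written to the right of \<open>x\<^sup>n\<close>. On this side no
  twist enters when a left ideal is multiplied by \<open>x\<close> from the left, so the sets increase with \<open>n\<close>.\<close>

definition lead_coeffs :: "nat \<Rightarrow> 'a set \<Rightarrow> 'a set" where
  "lead_coeffs n I = {r \<in> R. \<exists>u \<in> P n. x [^] n \<otimes> r \<oplus> u \<in> I}"

text \<open>To multiply a leading coefficient \<open>r\<close> by \<open>r'\<close> on the left, move \<open>r'\<close> to the other side of \<open>x\<^sup>n\<close>:
  if \<open>x\<^sup>nr' = r''x\<^sup>n + v\<close> with \<open>v\<close> of lower degree, then multiplication by \<open>r''\<close> turns
  \<open>x\<^sup>nr + \<dots>\<close> into \<open>x\<^sup>n(r'r) + \<dots>\<close>.\<close>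

lemma lead_coeffs_left_ideal:
  assumes I: "left_ideal I A"
  shows "left_ideal (lead_coeffs n I) (A\<lparr>carrier := R\<rparr>)"
proof -
  have sub: "additive_subgroup I A" and lm: "\<And>r a. r \<in> carrier A \<Longrightarrow> a \<in> I \<Longrightarrow> r \<otimes> a \<in> I"
    using I by (auto simp: left_ideal_def)
  interpret I: additive_subgroup I A by (rule sub)
  interpret R: ring "A\<lparr>carrier := R\<rparr>" by (rule subring_is_ring[OF subring])
  have add: "r \<oplus> s \<in> lead_coeffs n I" if "r \<in> lead_coeffs n I" "s \<in> lead_coeffs n I" for r s
  proof -
    from that obtain u v where *: "r \<in> R" "s \<in> R" "u \<in> P n" "v \<in> P n"
      "x [^] n \<otimes> r \<oplus> u \<in> I" "x [^] n \<otimes> s \<oplus> v \<in> I" by (auto simp: lead_coeffs_def)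
    have "x [^] n \<otimes> (r \<oplus> s) \<oplus> (u \<oplus> v) = (x [^] n \<otimes> r \<oplus> u) \<oplus> (x [^] n \<otimes> s \<oplus> v)"
      using * by (simp add: r_distr a_ac)
    then show ?thesis
      unfolding lead_coeffs_def using I.a_closed[OF *(5,6)] P_add[OF *(3,4)] R_closed(7)[OF *(1,2)]
      by (auto intro!: bexI[of _ "u \<oplus> v"])
  qed
  have mult: "r' \<otimes> r \<in> lead_coeffs n I" if r': "r' \<in> R" and "r \<in> lead_coeffs n I" for r r'
  proof -
    from that obtain u where *: "r \<in> R" "u \<in> P n" "x [^] n \<otimes> r \<oplus> u \<in> I"
      by (auto simp: lead_coeffs_def)
    obtain r'' v where v: "r'' \<in> R" "v \<in> P n" "x [^] n \<otimes> r' = r'' \<otimes> x [^] n \<oplus> v"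
      using xpow_left_swap[OF r'] by blast
    have [simp]: "v \<in> carrier A" "u \<in> carrier A" using v(2) *(2) by (auto intro: P_carr)
    have "x [^] n \<otimes> (r' \<otimes> r) \<oplus> (r'' \<otimes> u \<ominus> v \<otimes> r) = (x [^] n \<otimes> r') \<otimes> r \<oplus> (r'' \<otimes> u \<ominus> v \<otimes> r)"
      using r' * by (simp add: m_assoc)
    also have "\<dots> = (r'' \<otimes> x [^] n \<oplus> v) \<otimes> r \<oplus> (r'' \<otimes> u \<ominus> v \<otimes> r)" by (simp add: v(3))
    also have "\<dots> = r'' \<otimes> x [^] n \<otimes> r \<oplus> r'' \<otimes> u" 
      using v(1) *(1) R_carr nat_pow_closed[OF x_closed, of n] \<open>v \<in> carrier A\<close> \<open>u \<in> carrier A\<close> by algebra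
    also have "\<dots> = r'' \<otimes> (x [^] n \<otimes> r \<oplus> u)"
      using v(1) * by (simp add: r_distr m_assoc)
    finally have "x [^] n \<otimes> (r' \<otimes> r) \<oplus> (r'' \<otimes> u \<ominus> v \<otimes> r) \<in> I"
      using lm[OF R_carr[OF v(1)] *(3)] by simp
    then show ?thesis
      unfolding lead_coeffs_def
      using R_closed(6)[OF r' *(1)] P_diff[OF P_lmult[OF v(1) *(2)] P_mult_R[OF v(2) *(1)]] by blast
  qed
  have zero: "\<zero> \<in> lead_coeffs n I"
    unfolding lead_coeffs_def using R_closed(2) by (auto intro!: bexI[of _ "\<zero>"])
  have "additive_subgroup (lead_coeffs n I) (A\<lparr>carrier := R\<rparr>)"
  proof (intro additive_subgroupI R.add.subgroupI)
    fix a assume a: "a \<in> lead_coeffs n I"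
    then have aR: "a \<in> R" by (auto simp: lead_coeffs_def)
    have "(\<ominus> \<one>) \<otimes> a \<in> lead_coeffs n I" using mult[OF _ a] R_closed(3,5) by blast
    moreover have "\<ominus>\<^bsub>A\<lparr>carrier := R\<rparr>\<^esub> a = (\<ominus> \<one>) \<otimes> a"
    proof (rule R.minus_equality)
      show "(\<ominus> \<one>) \<otimes> a \<oplus>\<^bsub>A\<lparr>carrier := R\<rparr>\<^esub> a = \<zero>\<^bsub>A\<lparr>carrier := R\<rparr>\<^esub>"
        using aR by (simp add: l_minus l_neg)
      show "(\<ominus> \<one>) \<otimes> a \<in> carrier (A\<lparr>carrier := R\<rparr>)" using aR R_closed(3,5,6) by simp
    qed (use aR in simp)
    ultimately show "\<ominus>\<^bsub>A\<lparr>carrier := R\<rparr>\<^esub> a \<in> lead_coeffs n I" by simp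
  next
    show "lead_coeffs n I \<subseteq> carrier (A\<lparr>carrier := R\<rparr>)" by (auto simp: lead_coeffs_def)
  qed (use add zero in auto)
  then show ?thesis using mult by (simp add: left_ideal_def)
qed

lemma lead_coeffs_Suc:
  assumes I: "left_ideal I A"
  shows "lead_coeffs n I \<subseteq> lead_coeffs (Suc n) I"
proof
  fix r assume "r \<in> lead_coeffs n I"
  then obtain u where *: "r \<in> R" "u \<in> P n" "x [^] n \<otimes> r \<oplus> u \<in> I" by (auto simp: lead_coeffs_def)
  have "x \<otimes> (x [^] n \<otimes> r \<oplus> u) \<in> I" using I *(3) by (auto simp: left_ideal_def)
  also have "x \<otimes> (x [^] n \<otimes> r \<oplus> u) = x [^] Suc n \<otimes> r \<oplus> x \<otimes> u"
    unfolding nat_pow_Suc2[OF x_closed] using * by (simp add: r_distr m_assoc)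
  finally show "r \<in> lead_coeffs (Suc n) I"
    unfolding lead_coeffs_def using *(1) x_mult_P[OF *(2)] by blast
qed

lemma lead_coeffs_mono: "I \<subseteq> J \<Longrightarrow> lead_coeffs n I \<subseteq> lead_coeffs n J"
  by (auto simp: lead_coeffs_def)

text \<open>Subtracting an element of the smaller ideal with the same leading coefficient lowers the degree.\<close>

lemma left_ideal_eqI_lead_coeffs:
  assumes I: "left_ideal I A" and J: "left_ideal J A" and IJ: "I \<subseteq> J"
    and lead: "\<And>n. lead_coeffs n J \<subseteq> lead_coeffs n I"
    and exhaust: "carrier A = (\<Union>n. P n)"
  shows "I = J"
proof -
  interpret I: additive_subgroup I A using I by (simp add: left_ideal_def)
  interpret J: additive_subgroup J A using J by (simp add: left_ideal_def)
  have "s \<in> I" if "s \<in> J" "s \<in> P n" for s n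
    using that
  proof (induction n arbitrary: s)
    case (Suc n)
    obtain t r where t: "t \<in> P n" "r \<in> R" "s = t \<oplus> x [^] n \<otimes> r"
      using Suc.prems(2) unfolding P_Suc_right by blast
    then have "s = x [^] n \<otimes> r \<oplus> t" by (simp add: a_comm)
    then have "r \<in> lead_coeffs n J" using t Suc.prems(1) by (auto simp: lead_coeffs_def)
    then obtain u where u: "u \<in> P n" "x [^] n \<otimes> r \<oplus> u \<in> I" using lead by (auto simp: lead_coeffs_def)
    have sc: "s \<in> carrier A" "t \<in> carrier A" "u \<in> carrier A" "r \<in> carrier A"
      using Suc.prems(1) J.a_Hcarr t u by (auto intro: P_carr)
    have "s \<ominus> (x [^] n \<otimes> r \<oplus> u) = t \<ominus> u"
      using sc nat_pow_closed[OF x_closed, of n] unfolding t(3) by algebra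
    moreover have "s \<ominus> (x [^] n \<otimes> r \<oplus> u) \<in> J"
      using Suc.prems(1) u(2) IJ by (simp add: a_minus_def J.a_closed J.a_inv_closed subsetD)
    ultimately have "t \<ominus> u \<in> I" using Suc.IH[of "t \<ominus> u"] P_diff[OF t(1) u(1)] by simp
    moreover have "s = (x [^] n \<otimes> r \<oplus> u) \<oplus> (t \<ominus> u)"
      using sc nat_pow_closed[OF x_closed, of n] unfolding t(3) by algebra
    ultimately show ?case using u(2) I.a_closed by simp
  qed simp
  moreover have "\<exists>n. s \<in> P n" if "s \<in> J" for s using J.a_Hcarr[OF that] exhaust by blast
  ultimately show ?thesis using IJ by blast
qed

text \<open>The leading coefficients of the \<open>m\<close>-th ideal in degree \<open>n\<close> increase in both \<open>n\<close> and \<open>m\<close>. The diagonal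
  of this array is stationary from some \<open>N\<close> on, which settles all degrees above \<open>N\<close> at once; the
  finitely many degrees up to \<open>N\<close> are stationary individually.\<close>

lemma left_noetherian_ext:
  assumes R: "left_noetherian (A\<lparr>carrier := R\<rparr>)" and exhaust: "carrier A = (\<Union>n. P n)"
  shows "left_noetherian A"
  unfolding left_noetherian_def
proof (intro conjI allI impI)
  show "ring A" by (rule ring_axioms)
  fix I :: "nat \<Rightarrow> 'a set" assume "\<forall>n. left_ideal (I n) A \<and> I n \<subseteq> I (Suc n)"
  then have I: "\<And>n. left_ideal (I n) A" and "\<And>n. I n \<subseteq> I (Suc n)" by auto
  then have Imono: "m \<le> n \<Longrightarrow> I m \<subseteq> I n" for m n by (simp add: lift_Suc_mono_le)
  define L where "L n m = lead_coeffs n (I m)" for n m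
  have Lmono: "L n m \<subseteq> L n' m'" if "n \<le> n'" "m \<le> m'" for n m n' m'
  proof -
    have "L n m \<subseteq> L n' m" unfolding L_def
      by (rule lift_Suc_mono_le[where f = "\<lambda>n. lead_coeffs n (I m)", OF lead_coeffs_Suc[OF I] that(1)])
    then show ?thesis using lead_coeffs_mono[OF Imono[OF that(2)]] unfolding L_def by blast
  qed
  have acc: "\<exists>N. \<forall>n\<ge>N. J n = J N"
    if "\<And>n. left_ideal (J n) (A\<lparr>carrier := R\<rparr>)" "\<And>n. J n \<subseteq> J (Suc n)" for J :: "nat \<Rightarrow> 'a set"
    using R that unfolding left_noetherian_def by blast
  have "\<exists>N. \<forall>n\<ge>N. L n n = L N N"
    by (rule acc) (unfold L_def, rule lead_coeffs_left_ideal[OF I], fold L_def, rule Lmono, auto)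
  then obtain N where N: "\<And>n. n \<ge> N \<Longrightarrow> L n n = L N N" by blast
  have "\<exists>M. \<forall>m\<ge>M. L n m = L n M" for n
    by (rule acc) (unfold L_def, rule lead_coeffs_left_ideal[OF I], fold L_def, rule Lmono, auto)
  then obtain M where M: "\<And>n m. m \<ge> M n \<Longrightarrow> L n m = L n (M n)" by metis
  define B where "B = Max (insert N (M ` {..N}))"
  have B: "N \<le> B" "\<And>n. n \<le> N \<Longrightarrow> M n \<le> B" unfolding B_def by (intro Max_ge; simp)+
  have "L n m \<subseteq> L n B" if "m \<ge> B" for n m
  proof (cases "n \<le> N")
    case True
    then show ?thesis using M[of n m] M[of n B] B(2)[of n] that by auto
  next
    case False
    define k where "k = max n m"
    have "L n m \<subseteq> L k k" by (rule Lmono) (auto simp: k_def)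
    also have "L k k = L N N" using N[of k] B that by (auto simp: k_def)
    also have "\<dots> \<subseteq> L n B" using Lmono[of N n N B] False B(1) by simp
    finally show ?thesis .
  qed
  then have "I B = I m" if "m \<ge> B" for m
    using left_ideal_eqI_lead_coeffs[OF I I Imono[OF that] _ exhaust] that unfolding L_def by blast
  then show "\<exists>N. \<forall>n\<ge>N. I n = I N" by metis
qed

text \<open>The product of elements with leading terms \<open>rx\<^sup>n\<close> and \<open>r'x\<^sup>m\<close> has leading term \<open>rr''x\<^sup>n\<^sup>+\<^sup>m\<close>, where \<open>r''\<close>
  arises by moving \<open>r'\<close> across \<open>x\<^sup>n\<close> and is nonzero with \<open>r'\<close>.\<close>

lemma nc_domain_ext:
  assumes R: "nc_domain (A\<lparr>carrier := R\<rparr>)" and exhaust: "carrier A = (\<Union>n. P n)"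
    and swap: "\<And>r. r \<in> R - {\<zero>} \<Longrightarrow> \<exists>r' \<in> R - {\<zero>}. \<exists>r'' \<in> R. x \<otimes> r = r' \<otimes> x \<oplus> r''"
    and indep: "\<And>n r t. \<lbrakk>t \<in> P n; r \<in> R; t \<oplus> r \<otimes> x [^] n = \<zero>\<rbrakk> \<Longrightarrow> r = \<zero>"
  shows "nc_domain A"
proof -
  have lead: "\<exists>n t r. t \<in> P n \<and> r \<in> R - {\<zero>} \<and> s = t \<oplus> r \<otimes> x [^] n" if "s \<in> carrier A" "s \<noteq> \<zero>" for s
  proof -
    from that(1) have "s \<in> (\<Union>n. P n)" unfolding exhaust .
    then obtain N where "s \<in> P N" by (rule UN_E)
    then show ?thesis
    proof (induction N)
      case (Suc N)
      obtain t r where t: "t \<in> P N" "r \<in> R" "s = t \<oplus> r \<otimes> x [^] N" using Suc.prems by (rule P_SucE)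
      show ?case
      proof (cases "r = \<zero>")
        case True
        then have "s = t" using t by simp
        then show ?thesis using Suc.IH t by blast
      qed (use t in blast)
    qed (use that in simp)
  qed
  have pow_swap: "\<exists>r' \<in> R - {\<zero>}. \<exists>u \<in> P n. x [^] n \<otimes> r = r' \<otimes> x [^] n \<oplus> u" if "r \<in> R - {\<zero>}" for r n
    using that
  proof (induction n)
    case 0
    then show ?case by (intro bexI[of _ r] bexI[of _ \<zero>]) auto
  next
    case (Suc n)
    then obtain r' u where r: "r' \<in> R - {\<zero>}" "u \<in> P n" "x [^] n \<otimes> r = r' \<otimes> x [^] n \<oplus> u" by blast
    obtain s s' where s: "s \<in> R - {\<zero>}" "s' \<in> R" "x \<otimes> r' = s \<otimes> x \<oplus> s'" using swap[OF r(1)] by blast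
    have "x [^] Suc n \<otimes> r = x \<otimes> (x [^] n \<otimes> r)"
      unfolding nat_pow_Suc2[OF x_closed] using Suc.prems by (simp add: m_assoc)
    also have "\<dots> = (x \<otimes> r') \<otimes> x [^] n \<oplus> x \<otimes> u" using r by (simp add: r_distr m_assoc)
    also have "\<dots> = s \<otimes> x [^] Suc n \<oplus> (s' \<otimes> x [^] n \<oplus> x \<otimes> u)" 
      unfolding nat_pow_Suc2[OF x_closed] using s r(1,2) by (simp add: l_distr m_assoc a_ac)
    finally show ?case using P_add[OF P_monom[OF s(2)] x_mult_P[OF r(2)]] s(1) by blast
  qed
  have "a \<otimes> b \<noteq> \<zero>" if a: "a \<in> carrier A" "a \<noteq> \<zero>" and b: "b \<in> carrier A" "b \<noteq> \<zero>" for a b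
  proof
    assume ab: "a \<otimes> b = \<zero>"
    obtain n t r where n: "t \<in> P n" "r \<in> R - {\<zero>}" "a = t \<oplus> r \<otimes> x [^] n" using lead[OF a] by blast
    obtain m t' r' where m: "t' \<in> P m" "r' \<in> R - {\<zero>}" "b = t' \<oplus> r' \<otimes> x [^] m" using lead[OF b] by blast
    obtain r'' u where u: "r'' \<in> R - {\<zero>}" "u \<in> P n" "x [^] n \<otimes> r' = r'' \<otimes> x [^] n \<oplus> u"
      using pow_swap[OF m(2)] by blast
    define w where "w = t \<otimes> b \<oplus> (r \<otimes> (x [^] n \<otimes> t') \<oplus> r \<otimes> (u \<otimes> x [^] m))"
    have rc [simp]: "t \<in> carrier A" "t' \<in> carrier A" "u \<in> carrier A" "r \<in> carrier A"
      "r' \<in> carrier A" "r'' \<in> carrier A" using n m u by (auto intro: P_carr)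
    have bP: "b \<in> P (Suc m)" using P_SucI[OF m(1) _ m(3)] m(2) by blast
    have "t \<otimes> b \<in> P (n + m)" by (rule P_mult_P[OF n(1) bP])
    moreover have "r \<otimes> (x [^] n \<otimes> t') \<in> P (n + m)"
      using n(2) by (intro P_lmult xpow_mult_P[OF m(1)]) auto
    moreover have "r \<otimes> (u \<otimes> x [^] m) \<in> P (n + m)"
      using P_lmult[OF _ mult_xpow_P[OF u(2), of m], of r] n(2) by (simp add: add.commute)
    ultimately have w: "w \<in> P (n + m)" unfolding w_def by (intro P_add)
    have "a \<otimes> b = t \<otimes> b \<oplus> (r \<otimes> (x [^] n \<otimes> t') \<oplus> r \<otimes> ((x [^] n \<otimes> r') \<otimes> x [^] m))"
    proof -
      have "a \<otimes> b = t \<otimes> b \<oplus> r \<otimes> (x [^] n \<otimes> b)" using b unfolding n(3) by (simp add: l_distr m_assoc)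
      also have "x [^] n \<otimes> b = x [^] n \<otimes> t' \<oplus> (x [^] n \<otimes> r') \<otimes> x [^] m"
        unfolding m(3) by (simp add: r_distr m_assoc)
      finally show ?thesis by (simp add: r_distr)
    qed
    also have "(x [^] n \<otimes> r') \<otimes> x [^] m = r'' \<otimes> x [^] (n + m) \<oplus> u \<otimes> x [^] m"
      unfolding u(3) by (simp add: l_distr m_assoc nat_pow_mult)
    finally have "w \<oplus> (r \<otimes> r'') \<otimes> x [^] (n + m) = \<zero>"
      using ab b(1) unfolding w_def by (simp add: r_distr m_assoc a_ac)
    then have "r \<otimes> r'' = \<zero>" using indep[OF w] R_closed(6) n(2) u(1) by blast
    then show False using R n(2) u(1) by (auto simp: nc_domain_def)
  qed
  moreover have "\<one> \<noteq> \<zero>" using R by (auto simp: nc_domain_def)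
  ultimately show ?thesis using ring_axioms by (auto simp: nc_domain_def)
qed

end

section \<open>The opposite ring\<close>

definition opposite_ring :: "('a, 'm) ring_scheme \<Rightarrow> ('a, 'm) ring_scheme" where
  "opposite_ring A = A\<lparr>monoid.mult := (\<lambda>a b. b \<otimes>\<^bsub>A\<^esub> a)\<rparr>"

lemma opposite_ring_simps [simp]:
  "carrier (opposite_ring A) = carrier A" "\<one>\<^bsub>opposite_ring A\<^esub> = \<one>\<^bsub>A\<^esub>"
  "\<zero>\<^bsub>opposite_ring A\<^esub> = \<zero>\<^bsub>A\<^esub>" "(\<oplus>\<^bsub>opposite_ring A\<^esub>) = (\<oplus>\<^bsub>A\<^esub>)"
  "a \<otimes>\<^bsub>opposite_ring A\<^esub> b = b \<otimes>\<^bsub>A\<^esub> a"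
  "add_monoid (opposite_ring A) = add_monoid A"
  "(opposite_ring A)\<lparr>carrier := R\<rparr> = opposite_ring (A\<lparr>carrier := R\<rparr>)"
  by (simp_all add: opposite_ring_def)

lemma ring_opposite_ring:
  assumes "ring A" shows "ring (opposite_ring A)"
proof -
  interpret ring A by fact
  show ?thesis
    by unfold_locales (auto simp: Units_def a_ac m_assoc l_distr r_distr intro: l_neg r_neg)
qed

lemma left_ideal_opposite_ring: "left_ideal I (opposite_ring A) = right_ideal I A"
  by (simp add: left_ideal_def right_ideal_def additive_subgroup_def)

lemma left_noetherian_opposite_ring:
  "ring A \<Longrightarrow> left_noetherian (opposite_ring A) = right_noetherian A"
  by (simp add: left_noetherian_def right_noetherian_def left_ideal_opposite_ring ring_opposite_ring)

lemma (in ring) opposite_ring_pow: "x \<in> carrier R \<Longrightarrow> x [^]\<^bsub>opposite_ring R\<^esub> (n::nat) = x [^] n"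
proof (induction n)
  case (Suc n)
  then show ?case unfolding nat_pow_Suc2[OF Suc.prems] by (simp add: nat_pow_def)
qed (simp add: nat_pow_def)

context almost_normalizing
begin

text \<open>The two swap conditions exchange their roles.\<close>

lemma opposite: "almost_normalizing (opposite_ring A) R x"
proof -
  interpret op: ring "opposite_ring A" by (rule ring_opposite_ring[OF ring_axioms])
  have "\<ominus>\<^bsub>opposite_ring A\<^esub> r = \<ominus> r" for r by (simp add: a_inv_def)
  then have "subring R (opposite_ring A)"
    by (intro op.subringI) (use R_closed in auto)
  then show ?thesis
    by (intro almost_normalizing.intro almost_normalizing_axioms.intro op.ring_axioms)
       (use left_swap right_swap in simp_all)
qed

lemma bounded_left_polys_opposite:
  "bounded_left_polys (opposite_ring A) R x n = bounded_left_polys A R x n"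
proof (induction n)
  case (Suc n)
  show ?case
    unfolding P_Suc_right unfolding bounded_left_polys.simps Suc by (simp add: opposite_ring_pow)
qed simp

lemma right_noetherian_ext:
  assumes R: "right_noetherian (A\<lparr>carrier := R\<rparr>)" and exhaust: "carrier A = (\<Union>n. P n)"
  shows "right_noetherian A"
proof -
  interpret op: almost_normalizing "opposite_ring A" R x by (rule opposite)
  have "left_noetherian (opposite_ring A)"
    by (rule op.left_noetherian_ext)
       (use R exhaust in \<open>simp_all add: left_noetherian_opposite_ring subring_is_ring[OF subring]
         bounded_left_polys_opposite\<close>)
  then show ?thesis by (simp add: left_noetherian_opposite_ring ring_axioms)
qed

end

section \<open>Properties inherited by skew polynomial rings\<close>

lemma (in ring) bounded_left_polys_eq_sums:
  assumes R: "subring S R" and x: "x \<in> carrier R"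
  shows "bounded_left_polys R S x n = {(\<Oplus>i\<in>{..<n}. f i \<otimes> x [^] i) | f. range f \<subseteq> S}"
proof (induction n)
  case 0
  have "\<exists>f :: nat \<Rightarrow> 'a. range f \<subseteq> S" using subringE(2)[OF R] by (intro exI[of _ "\<lambda>_. \<zero>"]) auto
  then show ?case by auto
next
  case (Suc n)
  note Scar = subringE(1)[OF R, THEN subsetD]
  have sum_Suc: "(\<Oplus>i\<in>{..<Suc n}. f i \<otimes> x [^] i) = (\<Oplus>i\<in>{..<n}. f i \<otimes> x [^] i) \<oplus> f n \<otimes> x [^] n"
    if f: "range f \<subseteq> S" for f
  proof -
    have fc: "f i \<in> carrier R" for i using f Scar by blast
    have "(\<Oplus>i\<in>insert n {..<n}. f i \<otimes> x [^] i) = f n \<otimes> x [^] n \<oplus> (\<Oplus>i\<in>{..<n}. f i \<otimes> x [^] i)"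
      using fc x by (intro finsum_insert) auto
    then show ?thesis using fc x by (simp add: lessThan_Suc a_comm)
  qed
  have extend: "(\<Oplus>i\<in>{..<n}. f i \<otimes> x [^] i) \<oplus> r \<otimes> x [^] n = (\<Oplus>i\<in>{..<Suc n}. (f(n := r)) i \<otimes> x [^] i)"
    if f: "range f \<subseteq> S" "r \<in> S" for f r
  proof -
    have fc: "f i \<in> carrier R" for i using f Scar by blast
    have "(\<Oplus>i\<in>{..<n}. f i \<otimes> x [^] i) = (\<Oplus>i\<in>{..<n}. (f(n := r)) i \<otimes> x [^] i)"
      using fc x by (intro finsum_cong') auto
    then show ?thesis using sum_Suc[of "f(n := r)"] f by (auto simp: image_subset_iff)
  qed
  show ?case
  proof (intro equalityI subsetI)
    fix s assume "s \<in> bounded_left_polys R S x (Suc n)"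
    then obtain f r where "range f \<subseteq> S" "r \<in> S" "s = (\<Oplus>i\<in>{..<n}. f i \<otimes> x [^] i) \<oplus> r \<otimes> x [^] n"
      unfolding bounded_left_polys.simps Suc by blast
    then show "s \<in> {(\<Oplus>i\<in>{..<Suc n}. f i \<otimes> x [^] i) | f. range f \<subseteq> S}"
      unfolding mem_Collect_eq by (intro exI[of _ "f(n := r)"]) (use extend in auto)
  next
    fix s assume "s \<in> {(\<Oplus>i\<in>{..<Suc n}. f i \<otimes> x [^] i) | f. range f \<subseteq> S}"
    then obtain f where f: "range f \<subseteq> S" "s = (\<Oplus>i\<in>{..<Suc n}. f i \<otimes> x [^] i)" by blast
    then show "s \<in> bounded_left_polys R S x (Suc n)"
      unfolding bounded_left_polys.simps Suc f(2) sum_Suc[OF f(1)] by blast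
  qed
qed

lemma (in ring) finsum_support:
  assumes "finite T" "{i. f i \<noteq> \<zero>} \<subseteq> T" "range f \<subseteq> carrier R" "range g \<subseteq> carrier R"
  shows "(\<Oplus>i\<in>{i. f i \<noteq> \<zero>}. f i \<otimes> g i) = (\<Oplus>i\<in>T. f i \<otimes> g i)"
proof (rule add.finprod_mono_neutral_cong_left[OF assms(1,2)])
  show "f i \<otimes> g i = \<zero>" if "i \<in> T - {i. f i \<noteq> \<zero>}" for i using that assms(4) by (auto simp: image_subset_iff)
  show "(\<lambda>i. f i \<otimes> g i) \<in> T \<rightarrow> carrier R" using assms(3,4) by (auto simp: image_subset_iff)
qed auto

lemma bounded_left_polys_carrier_update:
  "bounded_left_polys (A\<lparr>carrier := S\<rparr>) R x n = bounded_left_polys A R x n"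
  by (induction n) (simp_all add: nat_pow_def)

locale ore_extension = ring A for K :: "('k, 'm) ring_scheme" and A :: "('k, 'a, 'n) module_scheme" (structure) +
  fixes R S :: "'a set" and \<sigma> \<delta> :: "'a \<Rightarrow> 'a" and x :: 'a
  assumes ext: "skew_poly_ext K A R \<sigma> \<delta> x S"
begin

lemma subrings: "subring R A" "subring S A" "R \<subseteq> S" "x \<in> S"
  using ext by (auto simp: skew_poly_ext_def)

lemma carr: "S \<subseteq> carrier A" "x \<in> carrier A"
  using subringE(1)[OF subrings(2)] subrings(4) by auto

lemma commutation: "r \<in> R \<Longrightarrow> x \<otimes> r = \<sigma> r \<otimes> x \<oplus> \<delta> r"
  using ext by (auto simp: skew_poly_ext_def)

lemma \<sigma>_bij: "bij_betw \<sigma> R R"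
  using ext by (auto simp: skew_poly_ext_def ring_iso_def)

lemma \<sigma>_mem: "r \<in> R \<Longrightarrow> \<sigma> r \<in> R"
  using \<sigma>_bij by (rule bij_betw_apply)

lemma \<delta>_mem: "r \<in> R \<Longrightarrow> \<delta> r \<in> R"
  using ext by (auto simp: skew_poly_ext_def sigma_derivation_def)

lemma unique_coeffs: "s \<in> S \<Longrightarrow> \<exists>!f :: nat \<Rightarrow> 'a. range f \<subseteq> R \<and> finite {i. f i \<noteq> \<zero>} \<and>
        s = (\<Oplus>i \<in> {i. f i \<noteq> \<zero>}. f i \<otimes> (x [^] i))"
  using ext by (auto simp: skew_poly_ext_def)

lemma \<sigma>_nonzero:
  assumes r: "r \<in> R" "r \<noteq> \<zero>" shows "\<sigma> r \<noteq> \<zero>"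
proof
  assume r0: "\<sigma> r = \<zero>"
  have hom: "\<sigma> (a \<oplus> b) = \<sigma> a \<oplus> \<sigma> b" if "a \<in> R" "b \<in> R" for a b
    using ext that by (auto simp: skew_poly_ext_def ring_iso_def ring_hom_def)
  have z: "\<zero> \<in> R" using subringE(2)[OF subrings(1)] .
  have "\<sigma> \<zero> = \<sigma> \<zero> \<oplus> \<sigma> \<zero>" using hom[OF z z] by simp
  then have "\<sigma> \<zero> = \<zero>" using \<sigma>_mem[OF z] subringE(1)[OF subrings(1)]
    by (metis add.r_cancel_one' subsetD)
  then show False using r r0 z \<sigma>_bij inj_onD[of \<sigma> R r \<zero>] by (simp add: bij_betw_def)
qed

lemma almost_normalizing: "almost_normalizing (A\<lparr>carrier := S\<rparr>) R x"
proof (intro almost_normalizing.intro almost_normalizing_axioms.intro)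
  interpret S: ring "A\<lparr>carrier := S\<rparr>" by (rule subring_is_ring[OF subrings(2)])
  show "ring (A\<lparr>carrier := S\<rparr>)" by (rule S.ring_axioms)
  show "subring R (A\<lparr>carrier := S\<rparr>)"
    using S.subring_iff[of R] subrings subring_is_ring[OF subrings(1)] by simp
  show "x \<in> carrier (A\<lparr>carrier := S\<rparr>)" using subrings(4) by simp
  fix r assume r: "r \<in> R"
  show "\<exists>r'\<in>R. \<exists>r''\<in>R. x \<otimes>\<^bsub>A\<lparr>carrier := S\<rparr>\<^esub> r = r' \<otimes>\<^bsub>A\<lparr>carrier := S\<rparr>\<^esub> x \<oplus>\<^bsub>A\<lparr>carrier := S\<rparr>\<^esub> r''"
    using commutation[OF r] \<sigma>_mem[OF r] \<delta>_mem[OF r] by auto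
  \<comment> \<open>From \<open>xs = \<sigma>(s)x + \<delta>(s)\<close> with \<open>\<sigma>(s) = r\<close>.\<close>
  obtain s where s: "s \<in> R" "\<sigma> s = r" using \<sigma>_bij r by (metis bij_betwE bij_betw_imp_surj_on imageE)
  have c: "x \<in> carrier A" "r \<in> carrier A" "s \<in> carrier A" "\<delta> s \<in> carrier A"
    using carr r s(1) \<delta>_mem[OF s(1)] subrings(3) by auto
  have "r \<otimes> x = x \<otimes> s \<oplus> \<ominus> \<delta> s"
    using commutation[OF s(1)] c by (simp add: s(2) a_assoc r_neg)
  moreover have "\<ominus> \<delta> s \<in> R" using \<delta>_mem[OF s(1)] subringE(5)[OF subrings(1)] by blast
  ultimately show "\<exists>r'\<in>R. \<exists>r''\<in>R. r \<otimes>\<^bsub>A\<lparr>carrier := S\<rparr>\<^esub> x = x \<otimes>\<^bsub>A\<lparr>carrier := S\<rparr>\<^esub> r' \<oplus>\<^bsub>A\<lparr>carrier := S\<rparr>\<^esub> r''"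
    using s(1) by auto
qed

lemma exhaust: "S = (\<Union>n. bounded_left_polys A R x n)"
proof (intro equalityI subsetI)
  fix s assume s: "s \<in> S"
  from ex1_implies_ex[OF unique_coeffs[OF s]]
  obtain f :: "nat \<Rightarrow> 'a" where "range f \<subseteq> R \<and> finite {i. f i \<noteq> \<zero>} \<and> s = (\<Oplus>i \<in> {i. f i \<noteq> \<zero>}. f i \<otimes> (x [^] i))"
    ..
  then have f: "range f \<subseteq> R" "finite {i. f i \<noteq> \<zero>}" "s = (\<Oplus>i \<in> {i. f i \<noteq> \<zero>}. f i \<otimes> (x [^] i))"
    by simp_all
  obtain n where n: "{i. f i \<noteq> \<zero>} \<subseteq> {..<n}" using f(2) finite_nat_iff_bounded by blast
  have "s = (\<Oplus>i \<in> {..<n}. f i \<otimes> (x [^] i))"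
    unfolding f(3) using f(1) subrings(3) carr n by (intro finsum_support) auto
  then show "s \<in> (\<Union>n. bounded_left_polys A R x n)"
    unfolding bounded_left_polys_eq_sums[OF subrings(1) carr(2)] using f(1) by blast
next
  interpret S: almost_normalizing "A\<lparr>carrier := S\<rparr>" R x by (rule almost_normalizing)
  fix s assume "s \<in> (\<Union>n. bounded_left_polys A R x n)"
  then show "s \<in> S" using S.P_carr by (auto simp: bounded_left_polys_carrier_update)
qed

text \<open>A vanishing left polynomial and the zero polynomial both represent zero, so uniqueness of the
  representation makes its coefficients vanish.\<close>

lemma independent:
  assumes t: "t \<in> bounded_left_polys A R x n" and r: "r \<in> R" and 0: "t \<oplus> r \<otimes> x [^] n = \<zero>"
  shows "r = \<zero>"
proof -
  have "t \<oplus> r \<otimes> x [^] n \<in> bounded_left_polys A R x (Suc n)" using t r by auto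
  then obtain f where "range f \<subseteq> R" "\<zero> = (\<Oplus>i\<in>{..<n}. f i \<otimes> x [^] i) \<oplus> r \<otimes> x [^] n"
    using t 0 unfolding bounded_left_polys_eq_sums[OF subrings(1) carr(2)] by auto
  note f = this
  define g where "g i = (if i < n then f i else if i = n then r else \<zero>)" for i
  have g: "range g \<subseteq> R" using f(1) r subringE(2)[OF subrings(1)] by (auto simp: g_def)
  have gc: "range g \<subseteq> carrier A" using g subrings(3) carr(1) by blast
  then have gc': "g i \<in> carrier A" for i by auto
  have supp: "{i. g i \<noteq> \<zero>} \<subseteq> insert n {..<n}" by (auto simp: g_def)
  have "(\<Oplus>i\<in>{i. g i \<noteq> \<zero>}. g i \<otimes> x [^] i) = (\<Oplus>i\<in>insert n {..<n}. g i \<otimes> x [^] i)"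
    using supp gc carr(2) by (intro finsum_support) auto
  also have "\<dots> = g n \<otimes> x [^] n \<oplus> (\<Oplus>i\<in>{..<n}. g i \<otimes> x [^] i)"
    using gc' carr(2) by (intro finsum_insert) auto
  also have "(\<Oplus>i\<in>{..<n}. g i \<otimes> x [^] i) = (\<Oplus>i\<in>{..<n}. f i \<otimes> x [^] i)"
    by (rule finsum_cong') (use f(1) subrings(3) carr in \<open>auto simp: g_def image_subset_iff subset_iff\<close>)
  also have "g n \<otimes> x [^] n \<oplus> \<dots> = \<zero>"
    using f r subrings(3) carr finsum_closed[of "\<lambda>i. f i \<otimes> x [^] i" "{..<n}"]
    by (subst a_comm) (auto simp: g_def image_subset_iff subset_iff intro!: finsum_closed m_closed)
  finally have g0: "(\<Oplus>i\<in>{i. g i \<noteq> \<zero>}. g i \<otimes> x [^] i) = \<zero>" .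
  have uniq: "a = b" if "\<exists>!f. Q f" "Q a" "Q b" for Q :: "(nat \<Rightarrow> 'a) \<Rightarrow> bool" and a b
    using that by blast
  have "g = (\<lambda>_. \<zero>)"
  proof (rule uniq[OF unique_coeffs[OF subringE(2)[OF subrings(2)]]])
    show "range g \<subseteq> R \<and> finite {i. g i \<noteq> \<zero>} \<and> \<zero> = (\<Oplus>i\<in>{i. g i \<noteq> \<zero>}. g i \<otimes> x [^] i)"
      using g g0 finite_subset[OF supp] by simp
    show "range (\<lambda>_::nat. \<zero>) \<subseteq> R \<and> finite {i::nat. (\<lambda>_. \<zero>) i \<noteq> \<zero>} \<and>
      \<zero> = (\<Oplus>i\<in>{i::nat. (\<lambda>_. \<zero>) i \<noteq> \<zero>}. (\<lambda>_. \<zero>) i \<otimes> x [^] i)"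
      using subringE(2)[OF subrings(1)] by auto
  qed
  then have "g n = \<zero>" by simp
  then show ?thesis by (simp add: g_def)
qed

lemma transfer_properties:
  "nc_domain (A\<lparr>carrier := R\<rparr>) \<Longrightarrow> nc_domain (A\<lparr>carrier := S\<rparr>)"
  "left_noetherian (A\<lparr>carrier := R\<rparr>) \<Longrightarrow> left_noetherian (A\<lparr>carrier := S\<rparr>)"
  "right_noetherian (A\<lparr>carrier := R\<rparr>) \<Longrightarrow> right_noetherian (A\<lparr>carrier := S\<rparr>)"
proof -
  interpret S: almost_normalizing "A\<lparr>carrier := S\<rparr>" R x by (rule almost_normalizing)
  have ex: "carrier (A\<lparr>carrier := S\<rparr>) = (\<Union>n. S.P n)"
    using exhaust by (simp add: bounded_left_polys_carrier_update)
  show "left_noetherian (A\<lparr>carrier := R\<rparr>) \<Longrightarrow> left_noetherian (A\<lparr>carrier := S\<rparr>)"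
    using S.left_noetherian_ext ex by simp
  show "right_noetherian (A\<lparr>carrier := R\<rparr>) \<Longrightarrow> right_noetherian (A\<lparr>carrier := S\<rparr>)"
    using S.right_noetherian_ext ex by simp
  assume R: "nc_domain (A\<lparr>carrier := R\<rparr>)"
  show "nc_domain (A\<lparr>carrier := S\<rparr>)"
  proof (rule S.nc_domain_ext[OF _ ex])
    show "nc_domain (A\<lparr>carrier := S, carrier := R\<rparr>)" using R by simp
  next
    fix r assume "r \<in> R - {\<zero>\<^bsub>A\<lparr>carrier := S\<rparr>\<^esub>}"
    then have r: "r \<in> R" "r \<noteq> \<zero>" by auto
    show "\<exists>r'\<in>R - {\<zero>\<^bsub>A\<lparr>carrier := S\<rparr>\<^esub>}. \<exists>r''\<in>R. x \<otimes>\<^bsub>A\<lparr>carrier := S\<rparr>\<^esub> r =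
        r' \<otimes>\<^bsub>A\<lparr>carrier := S\<rparr>\<^esub> x \<oplus>\<^bsub>A\<lparr>carrier := S\<rparr>\<^esub> r''"
      using commutation[OF r(1)] \<sigma>_mem[OF r(1)] \<delta>_mem[OF r(1)] \<sigma>_nonzero[OF r] by auto
  next
    fix n r t assume "t \<in> S.P n" "r \<in> R"
      "t \<oplus>\<^bsub>A\<lparr>carrier := S\<rparr>\<^esub> r \<otimes>\<^bsub>A\<lparr>carrier := S\<rparr>\<^esub> x [^]\<^bsub>A\<lparr>carrier := S\<rparr>\<^esub> n = \<zero>\<^bsub>A\<lparr>carrier := S\<rparr>\<^esub>"
    then show "r = \<zero>\<^bsub>A\<lparr>carrier := S\<rparr>\<^esub>"
      using independent[of t n r] by (simp add: bounded_left_polys_carrier_update nat_pow_def)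
  qed
qed

end

lemma nc_domain_imp_prime_ring:
  assumes "nc_domain R"
  shows "prime_ring R"
proof -
  interpret ring R using assms by (simp add: nc_domain_def)
  have "I = {\<zero>\<^bsub>R\<^esub>} \<or> J = {\<zero>\<^bsub>R\<^esub>}" if I: "ideal I R" and J: "ideal J R" and IJ: "I \<cdot>\<^bsub>R\<^esub> J = {\<zero>\<^bsub>R\<^esub>}" for I J
  proof (rule ccontr)
    assume "\<not> ?thesis"
    moreover have "\<zero>\<^bsub>R\<^esub> \<in> I" "\<zero>\<^bsub>R\<^esub> \<in> J"
      using I J by (auto simp: ideal_def intro: additive_subgroup.zero_closed)
    ultimately obtain a b where ab: "a \<in> I" "a \<noteq> \<zero>\<^bsub>R\<^esub>" "b \<in> J" "b \<noteq> \<zero>\<^bsub>R\<^esub>" by blast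
    then have "a \<otimes>\<^bsub>R\<^esub> b = \<zero>\<^bsub>R\<^esub>" using ideal_prod.prod[of a I b J R] IJ by blast
    then show False using assms ab ideal.Icarr[OF I] ideal.Icarr[OF J] by (auto simp: nc_domain_def)
  qed
  then show ?thesis using assms by (auto simp: prime_ring_def nc_domain_def)
qed

context assoc_algebra
begin

abbreviation scalars :: "'c set" where "scalars \<equiv> (\<lambda>c. c \<odot>\<^bsub>A\<^esub> \<one>\<^bsub>A\<^esub>) ` carrier K"

lemma smult_as_mult:
  assumes "c \<in> carrier K" "a \<in> carrier A"
  shows "c \<odot>\<^bsub>A\<^esub> a = (c \<odot>\<^bsub>A\<^esub> \<one>\<^bsub>A\<^esub>) \<otimes>\<^bsub>A\<^esub> a" "c \<odot>\<^bsub>A\<^esub> a = a \<otimes>\<^bsub>A\<^esub> (c \<odot>\<^bsub>A\<^esub> \<one>\<^bsub>A\<^esub>)"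
  using smult_mult_left[of c "\<one>\<^bsub>A\<^esub>" a] smult_mult_right[of c a "\<one>\<^bsub>A\<^esub>"] assms by simp_all

lemma scalars_mult:
  assumes "c \<in> carrier K" "d \<in> carrier K"
  shows "(c \<odot>\<^bsub>A\<^esub> \<one>\<^bsub>A\<^esub>) \<otimes>\<^bsub>A\<^esub> (d \<odot>\<^bsub>A\<^esub> \<one>\<^bsub>A\<^esub>) = (c \<otimes>\<^bsub>K\<^esub> d) \<odot>\<^bsub>A\<^esub> \<one>\<^bsub>A\<^esub>"
  using assms smult_as_mult(1)[of c "d \<odot>\<^bsub>A\<^esub> \<one>\<^bsub>A\<^esub>"] by (simp add: smult_assoc1)

lemma subring_scalars: "subring scalars A"
proof (rule A.subringI)
  show "\<one>\<^bsub>A\<^esub> \<in> scalars" by (rule image_eqI[of _ _ "\<one>\<^bsub>K\<^esub>"]) auto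
  fix a assume "a \<in> scalars"
  then obtain c where c: "c \<in> carrier K" "a = c \<odot>\<^bsub>A\<^esub> \<one>\<^bsub>A\<^esub>" by blast
  then have "\<ominus>\<^bsub>A\<^esub> a = (\<ominus>\<^bsub>K\<^esub> c) \<odot>\<^bsub>A\<^esub> \<one>\<^bsub>A\<^esub>" by (simp add: smult_l_minus)
  then show "\<ominus>\<^bsub>A\<^esub> a \<in> scalars" using c by blast
  fix b assume "b \<in> scalars"
  then obtain d where d: "d \<in> carrier K" "b = d \<odot>\<^bsub>A\<^esub> \<one>\<^bsub>A\<^esub>" by blast
  show "a \<otimes>\<^bsub>A\<^esub> b \<in> scalars" unfolding c(2) d(2) scalars_mult[OF c(1) d(1)] using c(1) d(1) by blast
  have "a \<oplus>\<^bsub>A\<^esub> b = (c \<oplus>\<^bsub>K\<^esub> d) \<odot>\<^bsub>A\<^esub> \<one>\<^bsub>A\<^esub>"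
    unfolding c(2) d(2) using c(1) d(1) by (simp add: smult_l_distr)
  then show "a \<oplus>\<^bsub>A\<^esub> b \<in> scalars" using c(1) d(1) by blast
qed auto

text \<open>Any nonzero scalar is invertible, so a left ideal is trivial or everything.\<close>

lemma scalars_left_noetherian:
  assumes "field K"
  shows "left_noetherian (A\<lparr>carrier := scalars\<rparr>)"
  unfolding left_noetherian_def
proof (intro conjI allI impI)
  interpret K: field K by fact
  show "ring (A\<lparr>carrier := scalars\<rparr>)" by (rule A.subring_is_ring[OF subring_scalars])
  fix I :: "nat \<Rightarrow> 'c set"
  assume I: "\<forall>n. left_ideal (I n) (A\<lparr>carrier := scalars\<rparr>) \<and> I n \<subseteq> I (Suc n)"
  have zero: "\<zero>\<^bsub>A\<^esub> \<in> I n" and sub: "I n \<subseteq> scalars"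
    and mult: "r \<in> scalars \<Longrightarrow> a \<in> I n \<Longrightarrow> r \<otimes>\<^bsub>A\<^esub> a \<in> I n" for n r a
    using I additive_subgroup.zero_closed[of "I n" "A\<lparr>carrier := scalars\<rparr>"]
      additive_subgroup.a_subset[of "I n" "A\<lparr>carrier := scalars\<rparr>"]
    by (auto simp: left_ideal_def)
  have mono: "I m \<subseteq> I n" if "m \<le> n" for m n using I that by (simp add: lift_Suc_mono_le)
  have all: "I n = scalars" if a: "a \<in> I n" "a \<noteq> \<zero>\<^bsub>A\<^esub>" for n a
  proof
    obtain c where c: "c \<in> carrier K" "a = c \<odot>\<^bsub>A\<^esub> \<one>\<^bsub>A\<^esub>" using sub a(1) by blast
    then have c0: "c \<in> Units K" using a(2) by (auto simp: K.field_Units)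
    show "scalars \<subseteq> I n"
    proof
      fix b assume "b \<in> scalars"
      then obtain d where d: "d \<in> carrier K" "b = d \<odot>\<^bsub>A\<^esub> \<one>\<^bsub>A\<^esub>" by blast
      define e where "e = d \<otimes>\<^bsub>K\<^esub> inv\<^bsub>K\<^esub> c"
      have e: "e \<in> carrier K" "e \<otimes>\<^bsub>K\<^esub> c = d" using c0 d(1) c(1) by (auto simp: e_def R.m_assoc)
      then have "(e \<odot>\<^bsub>A\<^esub> \<one>\<^bsub>A\<^esub>) \<otimes>\<^bsub>A\<^esub> a = b" unfolding c(2) scalars_mult[OF e(1) c(1)] d(2) by simp
      then show "b \<in> I n" using mult[of "e \<odot>\<^bsub>A\<^esub> \<one>\<^bsub>A\<^esub>" a n] e(1) a(1) by blast
    qed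
  qed (rule sub)
  show "\<exists>N. \<forall>n\<ge>N. I n = I N"
  proof (cases "\<exists>N. I N \<noteq> {\<zero>\<^bsub>A\<^esub>}")
    case True
    then obtain N a where a: "a \<in> I N" "a \<noteq> \<zero>\<^bsub>A\<^esub>" using zero by blast
    then have "I n = I N" if "n \<ge> N" for n using all[of a n] all[of a N] mono[OF that] by blast
    then show ?thesis by blast
  qed blast
qed

lemma scalars_comm: "a \<in> scalars \<Longrightarrow> b \<in> scalars \<Longrightarrow> a \<otimes>\<^bsub>A\<^esub> b = b \<otimes>\<^bsub>A\<^esub> a"
  by (elim imageE) (simp add: scalars_mult R.m_comm)

lemma scalars_right_noetherian:
  assumes "field K"
  shows "right_noetherian (A\<lparr>carrier := scalars\<rparr>)"
proof -
  have "right_ideal I (A\<lparr>carrier := scalars\<rparr>) = left_ideal I (A\<lparr>carrier := scalars\<rparr>)" for I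
  proof (cases "additive_subgroup I (A\<lparr>carrier := scalars\<rparr>)")
    case True
    then have "I \<subseteq> scalars" using additive_subgroup.a_subset by fastforce
    then have "r \<otimes>\<^bsub>A\<^esub> a = a \<otimes>\<^bsub>A\<^esub> r" if "a \<in> I" "r \<in> scalars" for a r
      using that by (intro scalars_comm) auto
    then show ?thesis by (simp add: left_ideal_def right_ideal_def cong: ball_cong)
  qed (simp add: left_ideal_def right_ideal_def)
  then show ?thesis
    using scalars_left_noetherian[OF assms] by (simp add: left_noetherian_def right_noetherian_def)
qed

lemma scalars_nc_domain:
  assumes "field K" and inj: "inj_on (\<lambda>c. c \<odot>\<^bsub>A\<^esub> \<one>\<^bsub>A\<^esub>) (carrier K)"
  shows "nc_domain (A\<lparr>carrier := scalars\<rparr>)"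
proof -
  interpret K: field K by fact
  have 0: "c = \<zero>\<^bsub>K\<^esub>" if "c \<in> carrier K" "c \<odot>\<^bsub>A\<^esub> \<one>\<^bsub>A\<^esub> = \<zero>\<^bsub>A\<^esub>" for c
    using inj_onD[OF inj, of c "\<zero>\<^bsub>K\<^esub>"] that by simp
  have "\<one>\<^bsub>A\<^esub> \<noteq> \<zero>\<^bsub>A\<^esub>" using 0[of "\<one>\<^bsub>K\<^esub>"] by auto
  moreover have "a = \<zero>\<^bsub>A\<^esub> \<or> b = \<zero>\<^bsub>A\<^esub>" if ab: "a \<in> scalars" "b \<in> scalars" "a \<otimes>\<^bsub>A\<^esub> b = \<zero>\<^bsub>A\<^esub>" for a b
  proof -
    obtain c d where c: "c \<in> carrier K" "d \<in> carrier K" "a = c \<odot>\<^bsub>A\<^esub> \<one>\<^bsub>A\<^esub>" "b = d \<odot>\<^bsub>A\<^esub> \<one>\<^bsub>A\<^esub>"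
      using ab by blast
    then have "c \<otimes>\<^bsub>K\<^esub> d = \<zero>\<^bsub>K\<^esub>" using ab(3) by (intro 0) (auto simp: scalars_mult)
    then show ?thesis using c K.integral[OF _ c(1,2)] by auto
  qed
  ultimately show ?thesis
    using A.subring_is_ring[OF subring_scalars] by (auto simp: nc_domain_def)
qed

lemma iterated_skew_sub_properties:
  assumes K: "field K" and "iterated_skew_sub K A R"
  shows "nc_domain (A\<lparr>carrier := R\<rparr>) \<and> left_noetherian (A\<lparr>carrier := R\<rparr>) \<and>
    right_noetherian (A\<lparr>carrier := R\<rparr>)"
  using assms(2)
proof induction
  case base
  then show ?case
    using scalars_nc_domain[OF K] scalars_left_noetherian[OF K] scalars_right_noetherian[OF K] by blast
next
  case (step R \<sigma> \<delta> x S)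
  interpret ore_extension K A R S \<sigma> \<delta> x
    using step by (intro ore_extension.intro ore_extension_axioms.intro A.ring_axioms)
  show ?case using step transfer_properties by blast
qed

section \<open>Recognising skew polynomial rings inside an algebra\<close>

text \<open>When the twist extends to an automorphism \<open>\<alpha>\<close> of the whole algebra, the derivation is the twisted
  commutator \<open>r \<mapsto> xr - \<alpha>(r)x\<close>. It obeys the twisted Leibniz rule on all of \<open>A\<close>, so the elements of \<open>R\<close>
  whose twisted commutator lies in \<open>R\<close> form a subring, and it suffices to look at generators.
  In the independence hypothesis only vanishing polynomials are considered; uniqueness of
  representations follows by subtraction.\<close>

lemma skew_poly_ext_generate_ring:
  assumes G: "G \<subseteq> carrier A" and x: "x \<in> carrier A"
    and iso: "\<alpha> \<in> ring_iso A A"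
    and linear: "\<And>c a. \<lbrakk>c \<in> carrier K; a \<in> carrier A\<rbrakk> \<Longrightarrow> \<alpha> (c \<odot>\<^bsub>A\<^esub> a) = c \<odot>\<^bsub>A\<^esub> \<alpha> a"
    and R: "R = generate_ring A G"
    and stable: "\<alpha> ` R = R"
    and comm: "\<And>g. g \<in> G \<Longrightarrow> x \<otimes>\<^bsub>A\<^esub> g \<ominus>\<^bsub>A\<^esub> \<alpha> g \<otimes>\<^bsub>A\<^esub> x \<in> R"
    and indep: "\<And>(f :: nat \<Rightarrow> 'c) n i. \<lbrakk>range f \<subseteq> R; (\<Oplus>\<^bsub>A\<^esub>i\<in>{..<n}. f i \<otimes>\<^bsub>A\<^esub> x [^]\<^bsub>A\<^esub> i) = \<zero>\<^bsub>A\<^esub>; i < n\<rbrakk> \<Longrightarrow> f i = \<zero>\<^bsub>A\<^esub>"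
  shows "skew_poly_ext K A R \<alpha> (\<lambda>r. x \<otimes>\<^bsub>A\<^esub> r \<ominus>\<^bsub>A\<^esub> \<alpha> r \<otimes>\<^bsub>A\<^esub> x) x (generate_ring A (insert x G))"
proof -
  define S where "S = generate_ring A (insert x G)"
  define \<delta> where "\<delta> r = x \<otimes>\<^bsub>A\<^esub> r \<ominus>\<^bsub>A\<^esub> \<alpha> r \<otimes>\<^bsub>A\<^esub> x" for r
  interpret \<alpha>: ring_hom_ring A A \<alpha>
    using iso by (intro ring_hom_ringI2 A.ring_axioms) (simp add: ring_iso_def)
  have subR: "subring R A" unfolding R by (rule A.generate_ring_is_subring[OF G])
  have subS: "subring S A" unfolding S_def by (rule A.generate_ring_is_subring) (use G x in simp)
  note Rc = subringE(1)[OF subR, THEN subsetD] and Sc = subringE(1)[OF subS, THEN subsetD]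
  have RS: "R \<subseteq> S" unfolding R S_def by (rule A.mono_generate_ring) (use G x in auto)
  have xS: "x \<in> S" unfolding S_def by (rule generate_ring.incl) simp
  have \<alpha>R: "\<alpha> r \<in> R" if "r \<in> R" for r using stable that by blast
  have \<alpha>c: "\<alpha> r \<in> carrier A" if "r \<in> carrier A" for r using that by simp
  have \<delta>_add: "\<delta> (r \<oplus>\<^bsub>A\<^esub> s) = \<delta> r \<oplus>\<^bsub>A\<^esub> \<delta> s" if "r \<in> carrier A" "s \<in> carrier A" for r s
  proof -
    have "\<delta> (r \<oplus>\<^bsub>A\<^esub> s) = x \<otimes>\<^bsub>A\<^esub> (r \<oplus>\<^bsub>A\<^esub> s) \<ominus>\<^bsub>A\<^esub> (\<alpha> r \<oplus>\<^bsub>A\<^esub> \<alpha> s) \<otimes>\<^bsub>A\<^esub> x"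
      using that by (simp add: \<delta>_def)
    then show ?thesis unfolding \<delta>_def using that x \<alpha>c[OF that(1)] \<alpha>c[OF that(2)] by algebra
  qed
  have \<delta>_mult: "\<delta> (r \<otimes>\<^bsub>A\<^esub> s) = \<alpha> r \<otimes>\<^bsub>A\<^esub> \<delta> s \<oplus>\<^bsub>A\<^esub> \<delta> r \<otimes>\<^bsub>A\<^esub> s" if "r \<in> carrier A" "s \<in> carrier A" for r s
  proof -
    have "\<delta> (r \<otimes>\<^bsub>A\<^esub> s) = x \<otimes>\<^bsub>A\<^esub> (r \<otimes>\<^bsub>A\<^esub> s) \<ominus>\<^bsub>A\<^esub> (\<alpha> r \<otimes>\<^bsub>A\<^esub> \<alpha> s) \<otimes>\<^bsub>A\<^esub> x"
      using that by (simp add: \<delta>_def)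
    then show ?thesis unfolding \<delta>_def using that x \<alpha>c[OF that(1)] \<alpha>c[OF that(2)] by algebra
  qed
  have \<delta>R: "\<delta> r \<in> R" if "r \<in> R" for r
    using that unfolding R
  proof induction
    case one
    then show ?case using x subringE(2)[OF subR] by (simp add: \<delta>_def M.r_neg M.minus_eq R)
  next
    case (incl h)
    then show ?case using comm unfolding \<delta>_def R by blast
  next
    case (a_inv h)
    have hc: "h \<in> carrier A" using a_inv(1) Rc unfolding R by blast
    have "\<delta> (\<ominus>\<^bsub>A\<^esub> h) = x \<otimes>\<^bsub>A\<^esub> (\<ominus>\<^bsub>A\<^esub> h) \<ominus>\<^bsub>A\<^esub> (\<ominus>\<^bsub>A\<^esub> \<alpha> h) \<otimes>\<^bsub>A\<^esub> x" using hc by (simp add: \<delta>_def)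
    also have "\<dots> = \<ominus>\<^bsub>A\<^esub> \<delta> h" unfolding \<delta>_def using hc x \<alpha>c[OF hc] by algebra
    finally show ?case using generate_ring.a_inv[OF a_inv.IH] by simp
  next
    case (eng_add h1 h2)
    then show ?case using \<delta>_add[of h1 h2] Rc generate_ring.eng_add[OF eng_add.IH] unfolding R by simp
  next
    case (eng_mult h1 h2)
    have "\<alpha> h1 \<otimes>\<^bsub>A\<^esub> \<delta> h2 \<in> R" "\<delta> h1 \<otimes>\<^bsub>A\<^esub> h2 \<in> R"
      using eng_mult \<alpha>R subringE(6)[OF subR] unfolding R by blast+
    then show ?case
      using \<delta>_mult[of h1 h2] eng_mult(1,2) Rc subringE(7)[OF subR] unfolding R by simp
  qed
  have commutation: "x \<otimes>\<^bsub>A\<^esub> r = \<alpha> r \<otimes>\<^bsub>A\<^esub> x \<oplus>\<^bsub>A\<^esub> \<delta> r" if "r \<in> R" for r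
    unfolding \<delta>_def using Rc[OF that] \<alpha>c[OF Rc[OF that]] x by algebra
  interpret AN: almost_normalizing A R x
  proof (intro almost_normalizing.intro almost_normalizing_axioms.intro A.ring_axioms subR x)
    fix r assume r: "r \<in> R"
    show "\<exists>r'\<in>R. \<exists>r''\<in>R. x \<otimes>\<^bsub>A\<^esub> r = r' \<otimes>\<^bsub>A\<^esub> x \<oplus>\<^bsub>A\<^esub> r''" using commutation \<alpha>R \<delta>R r by blast
    obtain s where s: "s \<in> R" "r = \<alpha> s" using stable r by blast
    have "r \<otimes>\<^bsub>A\<^esub> x = x \<otimes>\<^bsub>A\<^esub> s \<oplus>\<^bsub>A\<^esub> \<ominus>\<^bsub>A\<^esub> \<delta> s"
      unfolding s(2) \<delta>_def using Rc[OF s(1)] \<alpha>c[OF Rc[OF s(1)]] x by algebra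
    then show "\<exists>r'\<in>R. \<exists>r''\<in>R. r \<otimes>\<^bsub>A\<^esub> x = x \<otimes>\<^bsub>A\<^esub> r' \<oplus>\<^bsub>A\<^esub> r''"
      using s(1) subringE(5)[OF subR \<delta>R[OF s(1)]] by blast
  qed
  \<comment> \<open>The left polynomials are stable under left multiplication by generators of \<open>S\<close>, hence by \<open>S\<close>;
      since they contain \<open>1\<close>, they exhaust \<open>S\<close>.\<close>
  have absorb: "\<exists>n. s \<otimes>\<^bsub>A\<^esub> t \<in> AN.P n" if "s \<in> S" "t \<in> AN.P m" for s t m
    using that unfolding S_def
  proof (induction arbitrary: t m)
    case one
    then show ?case using AN.P_carr[OF one] by auto
  next
    case (incl h)
    show ?case
    proof (cases "h = x")
      case True
      then show ?thesis using AN.x_mult_P[OF incl(2)] by blast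
    next
      case False
      then have "h \<in> R" using incl(1) unfolding R by (auto intro: generate_ring.incl)
      then show ?thesis using AN.P_lmult[OF _ incl(2)] by blast
    qed
  next
    case (a_inv h)
    obtain n where n: "h \<otimes>\<^bsub>A\<^esub> t \<in> AN.P n" using a_inv by blast
    have "(\<ominus>\<^bsub>A\<^esub> h) \<otimes>\<^bsub>A\<^esub> t = \<ominus>\<^bsub>A\<^esub> (h \<otimes>\<^bsub>A\<^esub> t)"
      using a_inv(1) Sc AN.P_carr[OF a_inv.prems] unfolding S_def by (simp add: A.l_minus)
    then show ?case using AN.P_minus[OF n] by auto
  next
    case (eng_add h1 h2)
    obtain n1 n2 where n: "h1 \<otimes>\<^bsub>A\<^esub> t \<in> AN.P n1" "h2 \<otimes>\<^bsub>A\<^esub> t \<in> AN.P n2" using eng_add by blast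
    have "(h1 \<oplus>\<^bsub>A\<^esub> h2) \<otimes>\<^bsub>A\<^esub> t = h1 \<otimes>\<^bsub>A\<^esub> t \<oplus>\<^bsub>A\<^esub> h2 \<otimes>\<^bsub>A\<^esub> t"
      using eng_add(1,2) Sc AN.P_carr[OF eng_add.prems] unfolding S_def by (simp add: A.l_distr)
    moreover have "h1 \<otimes>\<^bsub>A\<^esub> t \<oplus>\<^bsub>A\<^esub> h2 \<otimes>\<^bsub>A\<^esub> t \<in> AN.P (max n1 n2)"
      using n by (intro AN.P_add) (auto elim!: AN.P_mono)
    ultimately show ?case by auto
  next
    case (eng_mult h1 h2)
    obtain n2 where "h2 \<otimes>\<^bsub>A\<^esub> t \<in> AN.P n2" using eng_mult by blast
    then obtain n1 where "h1 \<otimes>\<^bsub>A\<^esub> (h2 \<otimes>\<^bsub>A\<^esub> t) \<in> AN.P n1" using eng_mult.IH(1) by blast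
    moreover have "(h1 \<otimes>\<^bsub>A\<^esub> h2) \<otimes>\<^bsub>A\<^esub> t = h1 \<otimes>\<^bsub>A\<^esub> (h2 \<otimes>\<^bsub>A\<^esub> t)"
      using eng_mult(1,2) Sc AN.P_carr[OF eng_mult.prems] unfolding S_def by (simp add: A.m_assoc)
    ultimately show ?case by auto
  qed
  have exhaust: "\<exists>n. s \<in> AN.P n" if "s \<in> S" for s
  proof -
    have "\<one>\<^bsub>A\<^esub> \<in> AN.P (Suc 0)" using AN.P_monom[OF subringE(3)[OF subR], of 0] by simp
    from absorb[OF that this] show ?thesis using Sc[OF that] by simp
  qed
  have unique: "\<exists>!f :: nat \<Rightarrow> 'c. range f \<subseteq> R \<and> finite {i. f i \<noteq> \<zero>\<^bsub>A\<^esub>} \<and>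
        s = (\<Oplus>\<^bsub>A\<^esub>i \<in> {i. f i \<noteq> \<zero>\<^bsub>A\<^esub>}. f i \<otimes>\<^bsub>A\<^esub> (x [^]\<^bsub>A\<^esub> i))" if s: "s \<in> S" for s
  proof -
    obtain n where "s \<in> AN.P n" using exhaust[OF s] by blast
    then obtain f where f: "range f \<subseteq> R" "s = (\<Oplus>\<^bsub>A\<^esub>i \<in> {..<n}. f i \<otimes>\<^bsub>A\<^esub> (x [^]\<^bsub>A\<^esub> i))"
      unfolding A.bounded_left_polys_eq_sums[OF subR x] by blast
    define g where "g i = (if i < n then f i else \<zero>\<^bsub>A\<^esub>)" for i
    have g: "range g \<subseteq> R" using f(1) subringE(2)[OF subR] by (auto simp: g_def)
    have supp: "{i. g i \<noteq> \<zero>\<^bsub>A\<^esub>} \<subseteq> {..<n}" by (auto simp: g_def)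
    have xp: "range (\<lambda>i::nat. x [^]\<^bsub>A\<^esub> i) \<subseteq> carrier A" using x by auto
    have toR: "range h \<subseteq> carrier A" if "range h \<subseteq> R" for h :: "nat \<Rightarrow> 'c" using that Rc by blast
    have fc: "f i \<in> carrier A" for i using f(1) Rc by blast
    have sg: "s = (\<Oplus>\<^bsub>A\<^esub>i \<in> {i. g i \<noteq> \<zero>\<^bsub>A\<^esub>}. g i \<otimes>\<^bsub>A\<^esub> (x [^]\<^bsub>A\<^esub> i))"
      unfolding f(2) A.finsum_support[OF finite_lessThan supp toR[OF g] xp]
      by (rule M.finsum_cong') (use fc x in \<open>auto simp: g_def\<close>)
    have "h = g" if h: "range h \<subseteq> R" "finite {i. h i \<noteq> \<zero>\<^bsub>A\<^esub>}"
      "s = (\<Oplus>\<^bsub>A\<^esub>i \<in> {i. h i \<noteq> \<zero>\<^bsub>A\<^esub>}. h i \<otimes>\<^bsub>A\<^esub> (x [^]\<^bsub>A\<^esub> i))" for h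
    proof
      fix i
      obtain m' where m': "{i. h i \<noteq> \<zero>\<^bsub>A\<^esub>} \<subseteq> {..<m'}" using h(2) finite_nat_iff_bounded by blast
      define m where "m = Suc (max i (max n m'))"
      have sub: "{i. h i \<noteq> \<zero>\<^bsub>A\<^esub>} \<subseteq> {..<m}" "{i. g i \<noteq> \<zero>\<^bsub>A\<^esub>} \<subseteq> {..<m}"
        using m' supp by (force simp: m_def)+
      define d where "d j = h j \<ominus>\<^bsub>A\<^esub> g j" for j
      have dR: "range d \<subseteq> R"
        using h(1) g subringE(5,7)[OF subR] by (auto simp: d_def a_minus_def image_subset_iff)
      have gc: "g j \<in> carrier A" and hc: "h j \<in> carrier A" and dc: "d j \<in> carrier A" for j
        using g h(1) dR Rc by blast+
      have sm: "s = (\<Oplus>\<^bsub>A\<^esub>j \<in> {..<m}. g j \<otimes>\<^bsub>A\<^esub> (x [^]\<^bsub>A\<^esub> j))"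
        using sg unfolding A.finsum_support[OF finite_lessThan sub(2) toR[OF g] xp] .
      have "s = (\<Oplus>\<^bsub>A\<^esub>j \<in> {..<m}. h j \<otimes>\<^bsub>A\<^esub> (x [^]\<^bsub>A\<^esub> j))"
        using h(3) unfolding A.finsum_support[OF finite_lessThan sub(1) toR[OF h(1)] xp] .
      also have "\<dots> = (\<Oplus>\<^bsub>A\<^esub>j \<in> {..<m}. g j \<otimes>\<^bsub>A\<^esub> (x [^]\<^bsub>A\<^esub> j) \<oplus>\<^bsub>A\<^esub> d j \<otimes>\<^bsub>A\<^esub> (x [^]\<^bsub>A\<^esub> j))"
      proof (rule M.finsum_cong')
        fix j
        show "h j \<otimes>\<^bsub>A\<^esub> x [^]\<^bsub>A\<^esub> j = g j \<otimes>\<^bsub>A\<^esub> x [^]\<^bsub>A\<^esub> j \<oplus>\<^bsub>A\<^esub> d j \<otimes>\<^bsub>A\<^esub> x [^]\<^bsub>A\<^esub> j"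
          unfolding d_def using gc[of j] hc[of j] A.nat_pow_closed[OF x, of j] by algebra
      qed (use gc dc x in auto)
      also have "\<dots> = s \<oplus>\<^bsub>A\<^esub> (\<Oplus>\<^bsub>A\<^esub>j \<in> {..<m}. d j \<otimes>\<^bsub>A\<^esub> (x [^]\<^bsub>A\<^esub> j))"
        unfolding sm using gc dc x by (intro M.finsum_addf) auto
      finally have "s = s \<oplus>\<^bsub>A\<^esub> (\<Oplus>\<^bsub>A\<^esub>j \<in> {..<m}. d j \<otimes>\<^bsub>A\<^esub> (x [^]\<^bsub>A\<^esub> j))" .
      then have "(\<Oplus>\<^bsub>A\<^esub>j \<in> {..<m}. d j \<otimes>\<^bsub>A\<^esub> (x [^]\<^bsub>A\<^esub> j)) = \<zero>\<^bsub>A\<^esub>"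
        using M.add.l_cancel_one'[OF Sc[OF s] M.finsum_closed, of "\<lambda>j. d j \<otimes>\<^bsub>A\<^esub> (x [^]\<^bsub>A\<^esub> j)" "{..<m}"] dc x
        by auto
      then have "d i = \<zero>\<^bsub>A\<^esub>" using indep[OF dR] by (simp add: m_def)
      then show "h i = g i" using gc[of i] hc[of i] by (simp add: d_def)
    qed
    then show ?thesis using g sg finite_subset[OF supp] by (intro ex1I[of _ g]) auto
  qed
  have "\<alpha> \<in> ring_iso (A\<lparr>carrier := R\<rparr>) (A\<lparr>carrier := R\<rparr>)"
  proof (rule ring_iso_memI)
    show "bij_betw \<alpha> (carrier (A\<lparr>carrier := R\<rparr>)) (carrier (A\<lparr>carrier := R\<rparr>))"
      using iso stable subringE(1)[OF subR] by (auto simp: ring_iso_def bij_betw_def intro: inj_on_subset)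
  qed (use \<alpha>R Rc in auto)
  moreover have "sigma_derivation K A R \<alpha> \<delta>"
  proof -
    have "\<delta> (c \<odot>\<^bsub>A\<^esub> r) = c \<odot>\<^bsub>A\<^esub> \<delta> r" if "c \<in> carrier K" "r \<in> R" for c r
      unfolding \<delta>_def a_minus_def using that Rc[OF that(2)] x
      by (simp add: linear smult_r_distr smult_r_minus smult_mult_right[symmetric] smult_mult_left[symmetric])
    then show ?thesis unfolding sigma_derivation_def using \<delta>R \<delta>_add \<delta>_mult Rc by auto
  qed
  ultimately show ?thesis
    unfolding skew_poly_ext_def S_def[symmetric] \<delta>_def[symmetric]
    using subR subS RS xS commutation unique by (auto simp: \<delta>_def[abs_def])
qed

end

section \<open>The free algebra\<close>

lemma free_algebra_simps:
  "carrier (free_algebra K) = {f. range f \<subseteq> carrier K \<and> finite {w. f w \<noteq> \<zero>\<^bsub>K\<^esub>}}"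
  "f \<otimes>\<^bsub>free_algebra K\<^esub> g = (\<lambda>w. \<Oplus>\<^bsub>K\<^esub>i \<in> {..length w}. f (take i w) \<otimes>\<^bsub>K\<^esub> g (drop i w))"
  "\<one>\<^bsub>free_algebra K\<^esub> = (\<lambda>w. if w = [] then \<one>\<^bsub>K\<^esub> else \<zero>\<^bsub>K\<^esub>)"
  "\<zero>\<^bsub>free_algebra K\<^esub> = (\<lambda>w. \<zero>\<^bsub>K\<^esub>)"
  "f \<oplus>\<^bsub>free_algebra K\<^esub> g = (\<lambda>w. f w \<oplus>\<^bsub>K\<^esub> g w)"
  "c \<odot>\<^bsub>free_algebra K\<^esub> f = (\<lambda>w. c \<otimes>\<^bsub>K\<^esub> f w)"
  by (simp_all add: free_algebra_def)

context cring
begin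

context
  notes free_algebra_simps [simp]
begin

text \<open>The multiplication of the free algebra. Write \<open>f'\<close> for the tail \<open>u \<mapsto> f (a # u)\<close>. The tail of a product
  is a sum of products, \<open>(fg)' = f [] g' + f'g\<close>, which is the recursion \<open>word_conv_Cons\<close>. It turns all ring laws,
  associativity included, into inductions over the word in which no double sum has to be reindexed.\<close>

definition word_conv :: "('g list \<Rightarrow> 'a) \<Rightarrow> ('g list \<Rightarrow> 'a) \<Rightarrow> 'g list \<Rightarrow> 'a" where
  "word_conv f g w = (\<Oplus>i \<in> {..length w}. f (take i w) \<otimes> g (drop i w))"

lemma word_conv_Nil [simp]:
  "\<lbrakk>f \<in> UNIV \<rightarrow> carrier R; g \<in> UNIV \<rightarrow> carrier R\<rbrakk> \<Longrightarrow> word_conv f g [] = f [] \<otimes> g []"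
  by (simp add: word_conv_def Pi_iff)

lemma word_conv_closed [simp]:
  "\<lbrakk>f \<in> UNIV \<rightarrow> carrier R; g \<in> UNIV \<rightarrow> carrier R\<rbrakk> \<Longrightarrow> word_conv f g w \<in> carrier R"
  unfolding word_conv_def by (rule finsum_closed) (simp add: Pi_iff)

lemma word_conv_Cons [simp]:
  assumes "f \<in> UNIV \<rightarrow> carrier R" "g \<in> UNIV \<rightarrow> carrier R"
  shows "word_conv f g (a # w) = f [] \<otimes> g (a # w) \<oplus> word_conv (\<lambda>u. f (a # u)) g w"
proof -
  have "(\<Oplus>i \<in> {..Suc (length w)}. f (take i (a # w)) \<otimes> g (drop i (a # w)))
      = (\<Oplus>i \<in> {..length w}. f (take (Suc i) (a # w)) \<otimes> g (drop (Suc i) (a # w))) \<oplus>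
        f (take 0 (a # w)) \<otimes> g (drop 0 (a # w))"
    using assms by (intro finsum_Suc2) (simp add: Pi_iff)
  then show ?thesis
    using assms word_conv_closed[of "\<lambda>u. f (a # u)" g w] by (simp add: word_conv_def Pi_iff a_comm)
qed

lemma tail_funcset [simp]: "f \<in> UNIV \<rightarrow> carrier R \<Longrightarrow> (\<lambda>u. f (a # u)) \<in> UNIV \<rightarrow> carrier R"
  by (simp add: Pi_iff)

lemma word_conv_add_left:
  "\<lbrakk>f \<in> UNIV \<rightarrow> carrier R; g \<in> UNIV \<rightarrow> carrier R; h \<in> UNIV \<rightarrow> carrier R\<rbrakk>
    \<Longrightarrow> word_conv (\<lambda>w. f w \<oplus> g w) h w = word_conv f h w \<oplus> word_conv g h w"
  by (induction w arbitrary: f g) (simp_all add: Pi_iff l_distr a_ac)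

lemma word_conv_add_right:
  "\<lbrakk>f \<in> UNIV \<rightarrow> carrier R; g \<in> UNIV \<rightarrow> carrier R; h \<in> UNIV \<rightarrow> carrier R\<rbrakk>
    \<Longrightarrow> word_conv f (\<lambda>w. g w \<oplus> h w) w = word_conv f g w \<oplus> word_conv f h w"
  by (induction w arbitrary: f) (simp_all add: Pi_iff r_distr a_ac)

lemma word_conv_smult_left:
  "\<lbrakk>c \<in> carrier R; f \<in> UNIV \<rightarrow> carrier R; g \<in> UNIV \<rightarrow> carrier R\<rbrakk>
    \<Longrightarrow> word_conv (\<lambda>w. c \<otimes> f w) g w = c \<otimes> word_conv f g w"
  by (induction w arbitrary: f) (simp_all add: Pi_iff r_distr m_assoc)

lemma word_conv_smult_right:
  "\<lbrakk>c \<in> carrier R; f \<in> UNIV \<rightarrow> carrier R; g \<in> UNIV \<rightarrow> carrier R\<rbrakk>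
    \<Longrightarrow> word_conv f (\<lambda>w. c \<otimes> g w) w = c \<otimes> word_conv f g w"
  by (induction w arbitrary: f) (simp_all add: Pi_iff r_distr m_lcomm)

lemma word_conv_zero_left: "g \<in> UNIV \<rightarrow> carrier R \<Longrightarrow> word_conv (\<lambda>_. \<zero>) g w = \<zero>"
  by (induction w) (simp_all add: Pi_iff)

lemma word_conv_one_left:
  "g \<in> UNIV \<rightarrow> carrier R \<Longrightarrow> word_conv (\<lambda>w. if w = [] then \<one> else \<zero>) g w = g w"
  by (cases w) (simp_all add: Pi_iff word_conv_zero_left)

lemma word_conv_one_right:
  "f \<in> UNIV \<rightarrow> carrier R \<Longrightarrow> word_conv f (\<lambda>w. if w = [] then \<one> else \<zero>) w = f w"
  by (induction w arbitrary: f) (simp_all add: Pi_iff)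

lemma word_conv_gen_left:
  assumes f: "f \<in> UNIV \<rightarrow> carrier R"
  shows "word_conv (free_gen R g) f w = (case w of [] \<Rightarrow> \<zero> | a # u \<Rightarrow> if a = g then f u else \<zero>)"
proof (cases w)
  case (Cons a u)
  have [simp]: "free_gen R g \<in> UNIV \<rightarrow> carrier R" by (simp add: free_gen_def Pi_iff)
  have "(\<lambda>u. free_gen R g (a # u)) = (if a = g then (\<lambda>w. if w = [] then \<one> else \<zero>) else (\<lambda>_. \<zero>))"
    by (auto simp: free_gen_def)
  then show ?thesis using f Cons
    by (simp add: word_conv_one_left word_conv_zero_left) (simp add: free_gen_def Pi_iff)
qed (use f in \<open>simp add: free_gen_def Pi_iff\<close>)

lemma word_conv_assoc:
  "\<lbrakk>f \<in> UNIV \<rightarrow> carrier R; g \<in> UNIV \<rightarrow> carrier R; h \<in> UNIV \<rightarrow> carrier R\<rbrakk>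
    \<Longrightarrow> word_conv (word_conv f g) h w = word_conv f (word_conv g h) w"
proof (induction w arbitrary: f)
  case Nil
  then have "word_conv f g \<in> UNIV \<rightarrow> carrier R" "word_conv g h \<in> UNIV \<rightarrow> carrier R" by auto
  with Nil show ?case by (simp add: m_assoc Pi_iff)
next
  case (Cons a w)
  note [simp] = Cons.prems
  let ?f = "\<lambda>u. f (a # u)" and ?g = "\<lambda>u. g (a # u)"
  have [simp]: "f [] \<in> carrier R" "\<And>w. h w \<in> carrier R" "\<And>w. g w \<in> carrier R"
    using Cons.prems[THEN funcset_mem] by blast+
  have cl [simp]: "word_conv f g \<in> UNIV \<rightarrow> carrier R" "word_conv g h \<in> UNIV \<rightarrow> carrier R"
    "word_conv ?f g \<in> UNIV \<rightarrow> carrier R" "(\<lambda>u. f [] \<otimes> g (a # u)) \<in> UNIV \<rightarrow> carrier R"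
    by (auto intro!: word_conv_closed)
  have "word_conv (word_conv f g) h (a # w) =
      f [] \<otimes> g [] \<otimes> h (a # w) \<oplus> word_conv (\<lambda>u. f [] \<otimes> g (a # u) \<oplus> word_conv ?f g u) h w"
    by simp
  also have "word_conv (\<lambda>u. f [] \<otimes> g (a # u) \<oplus> word_conv ?f g u) h w =
      f [] \<otimes> word_conv ?g h w \<oplus> word_conv ?f (word_conv g h) w"
    using Cons.IH[of ?f] by (simp add: word_conv_add_left word_conv_smult_left)
  also have "f [] \<otimes> g [] \<otimes> h (a # w) \<oplus> (f [] \<otimes> word_conv ?g h w \<oplus> word_conv ?f (word_conv g h) w) =
      word_conv f (word_conv g h) (a # w)"
    by (simp add: r_distr m_assoc a_assoc)
  finally show ?case .
qed

lemma word_conv_support: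
  assumes f: "f \<in> UNIV \<rightarrow> carrier R" and g: "g \<in> UNIV \<rightarrow> carrier R"
  shows "{w. word_conv f g w \<noteq> \<zero>} \<subseteq> (\<lambda>(u, v). u @ v) ` ({u. f u \<noteq> \<zero>} \<times> {v. g v \<noteq> \<zero>})"
proof
  fix w assume "w \<in> {w. word_conv f g w \<noteq> \<zero>}"
  moreover have "word_conv f g w = \<zero>" if "\<And>i. f (take i w) \<otimes> g (drop i w) = \<zero>"
    unfolding word_conv_def by (rule add.finprod_one_eqI) (rule that)
  ultimately have "\<exists>i. f (take i w) \<otimes> g (drop i w) \<noteq> \<zero>" by auto
  then obtain i where i: "f (take i w) \<otimes> g (drop i w) \<noteq> \<zero>" by blast
  have "f (take i w) \<in> carrier R" "g (drop i w) \<in> carrier R" using f g by auto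
  then have "f (take i w) \<noteq> \<zero>" "g (drop i w) \<noteq> \<zero>" using i by auto
  then show "w \<in> (\<lambda>(u, v). u @ v) ` ({u. f u \<noteq> \<zero>} \<times> {v. g v \<noteq> \<zero>})"
    by (intro image_eqI[of _ _ "(take i w, drop i w)"]) auto
qed

lemma free_algebra_mult: "f \<otimes>\<^bsub>free_algebra R\<^esub> g = word_conv f g"
  by (simp add: word_conv_def[abs_def])

lemma free_algebra_carrier:
  "f \<in> carrier (free_algebra R) \<longleftrightarrow> f \<in> UNIV \<rightarrow> carrier R \<and> finite {w. f w \<noteq> \<zero>}"
  by auto

lemma free_algebra_carrierD:
  assumes "f \<in> carrier (free_algebra R)"
  shows "f w \<in> carrier R" "f \<in> UNIV \<rightarrow> carrier R" "finite {w. f w \<noteq> \<zero>}"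
  using assms by auto

lemma free_algebra_carrierI:
  assumes "\<And>w. f w \<in> carrier R" "finite W" "\<And>w. w \<notin> W \<Longrightarrow> f w = \<zero>"
  shows "f \<in> carrier (free_algebra R)"
proof -
  have "{w. f w \<noteq> \<zero>} \<subseteq> W" using assms(3) by blast
  then show ?thesis using assms(1) finite_subset[OF _ assms(2)] by auto
qed

lemma free_gen_closed [simp]: "free_gen R g \<in> carrier (free_algebra R)"
  by (rule free_algebra_carrierI[of _ "{[g]}"]) (auto simp: free_gen_def)

lemma abelian_group_free_algebra: "abelian_group (free_algebra R)"
proof (rule abelian_groupI)
  fix f g h :: "'g list \<Rightarrow> 'a"
  assume f: "f \<in> carrier (free_algebra R)" 
  note f' = free_algebra_carrierD[OF f]
  show "\<zero>\<^bsub>free_algebra R\<^esub> \<oplus>\<^bsub>free_algebra R\<^esub> f = f" using f'(1) by simp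
  have "(\<lambda>w. \<ominus> f w) \<in> carrier (free_algebra R)"
    using f' by (intro free_algebra_carrierI[of _ "{w. f w \<noteq> \<zero>}"]) auto
  moreover have "(\<lambda>w. \<ominus> f w) \<oplus>\<^bsub>free_algebra R\<^esub> f = \<zero>\<^bsub>free_algebra R\<^esub>" using f'(1) by (simp add: l_neg)
  ultimately show "\<exists>y\<in>carrier (free_algebra R). y \<oplus>\<^bsub>free_algebra R\<^esub> f = \<zero>\<^bsub>free_algebra R\<^esub>" by blast
  assume g: "g \<in> carrier (free_algebra R)"
  note g' = free_algebra_carrierD[OF g]
  have "(\<lambda>w. f w \<oplus> g w) \<in> carrier (free_algebra R)"
    using f' g' by (intro free_algebra_carrierI[of _ "{w. f w \<noteq> \<zero>} \<union> {w. g w \<noteq> \<zero>}"]) auto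
  then show "f \<oplus>\<^bsub>free_algebra R\<^esub> g \<in> carrier (free_algebra R)" by (simp only: free_algebra_simps)
  show "f \<oplus>\<^bsub>free_algebra R\<^esub> g = g \<oplus>\<^bsub>free_algebra R\<^esub> f" using f'(1) g'(1) by (simp add: a_comm)
  assume h: "h \<in> carrier (free_algebra R)"
  show "f \<oplus>\<^bsub>free_algebra R\<^esub> g \<oplus>\<^bsub>free_algebra R\<^esub> h = f \<oplus>\<^bsub>free_algebra R\<^esub> (g \<oplus>\<^bsub>free_algebra R\<^esub> h)"
    using f'(1) g'(1) free_algebra_carrierD(1)[OF h] by (simp add: a_assoc)
qed simp

lemma ring_free_algebra: "ring (free_algebra R)"
proof (rule ringI[OF abelian_group_free_algebra])
  show "monoid (free_algebra R)"
  proof (rule monoidI)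
    fix f g h :: "'g list \<Rightarrow> 'a"
    assume f: "f \<in> carrier (free_algebra R)" and g: "g \<in> carrier (free_algebra R)"
    note f' = free_algebra_carrierD[OF f] and g' = free_algebra_carrierD[OF g]
    have "finite {w. word_conv f g w \<noteq> \<zero>}"
      by (rule finite_subset[OF word_conv_support[OF f'(2) g'(2)]]) (use f'(3) g'(3) in simp)
    then show "f \<otimes>\<^bsub>free_algebra R\<^esub> g \<in> carrier (free_algebra R)"
      unfolding free_algebra_mult free_algebra_carrier using f' g' by auto
    assume h: "h \<in> carrier (free_algebra R)"
    show "f \<otimes>\<^bsub>free_algebra R\<^esub> g \<otimes>\<^bsub>free_algebra R\<^esub> h = f \<otimes>\<^bsub>free_algebra R\<^esub> (g \<otimes>\<^bsub>free_algebra R\<^esub> h)"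
      unfolding free_algebra_mult
      using word_conv_assoc[OF f'(2) g'(2) free_algebra_carrierD(2)[OF h]] by blast
  next
    show "\<one>\<^bsub>free_algebra R\<^esub> \<in> carrier (free_algebra R)"
      unfolding free_algebra_simps(3) by (rule free_algebra_carrierI[of _ "{[]}"]) auto
  next
    fix f :: "'g list \<Rightarrow> 'a"
    assume f: "f \<in> carrier (free_algebra R)"
    note f' = free_algebra_carrierD[OF f]
    show "\<one>\<^bsub>free_algebra R\<^esub> \<otimes>\<^bsub>free_algebra R\<^esub> f = f"
      unfolding free_algebra_mult free_algebra_simps(3) using word_conv_one_left[OF f'(2)] by blast
    show "f \<otimes>\<^bsub>free_algebra R\<^esub> \<one>\<^bsub>free_algebra R\<^esub> = f"
      unfolding free_algebra_mult free_algebra_simps(3) using word_conv_one_right[OF f'(2)] by blast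
  qed
next
  fix f g h :: "'g list \<Rightarrow> 'a"
  assume "f \<in> carrier (free_algebra R)" "g \<in> carrier (free_algebra R)" "h \<in> carrier (free_algebra R)"
  note * = this[THEN free_algebra_carrierD(2)]
  show "(f \<oplus>\<^bsub>free_algebra R\<^esub> g) \<otimes>\<^bsub>free_algebra R\<^esub> h =
      f \<otimes>\<^bsub>free_algebra R\<^esub> h \<oplus>\<^bsub>free_algebra R\<^esub> g \<otimes>\<^bsub>free_algebra R\<^esub> h"
    unfolding free_algebra_mult free_algebra_simps(5) using word_conv_add_left[OF *] by blast
  show "h \<otimes>\<^bsub>free_algebra R\<^esub> (f \<oplus>\<^bsub>free_algebra R\<^esub> g) =
      h \<otimes>\<^bsub>free_algebra R\<^esub> f \<oplus>\<^bsub>free_algebra R\<^esub> h \<otimes>\<^bsub>free_algebra R\<^esub> g"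
    unfolding free_algebra_mult free_algebra_simps(5) using word_conv_add_right[OF *(3,1,2)] by blast
qed

lemma assoc_algebra_free_algebra: "assoc_algebra R (free_algebra R)"
proof (intro assoc_algebra.intro moduleI assoc_algebra_axioms.intro ring_free_algebra is_cring
    abelian_group_free_algebra)
  fix c d and f g :: "'g list \<Rightarrow> 'a"
  assume c: "c \<in> carrier R" and f: "f \<in> carrier (free_algebra R)"
  note f' = free_algebra_carrierD[OF f]
  have "(\<lambda>w. c \<otimes> f w) \<in> carrier (free_algebra R)"
    using c f' by (intro free_algebra_carrierI[of _ "{w. f w \<noteq> \<zero>}"]) auto
  then show "c \<odot>\<^bsub>free_algebra R\<^esub> f \<in> carrier (free_algebra R)" by (simp only: free_algebra_simps)
  {
    assume d: "d \<in> carrier R"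
    show "(c \<oplus> d) \<odot>\<^bsub>free_algebra R\<^esub> f = c \<odot>\<^bsub>free_algebra R\<^esub> f \<oplus>\<^bsub>free_algebra R\<^esub> d \<odot>\<^bsub>free_algebra R\<^esub> f"
      using c d f'(1) by (simp add: l_distr)
    show "c \<otimes> d \<odot>\<^bsub>free_algebra R\<^esub> f = c \<odot>\<^bsub>free_algebra R\<^esub> (d \<odot>\<^bsub>free_algebra R\<^esub> f)"
      using c d f'(1) by (simp add: m_assoc)
  }
  assume g: "g \<in> carrier (free_algebra R)"
  note g' = free_algebra_carrierD[OF g]
  show "c \<odot>\<^bsub>free_algebra R\<^esub> (f \<oplus>\<^bsub>free_algebra R\<^esub> g) =
      c \<odot>\<^bsub>free_algebra R\<^esub> f \<oplus>\<^bsub>free_algebra R\<^esub> c \<odot>\<^bsub>free_algebra R\<^esub> g"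
    using c f'(1) g'(1) by (simp add: r_distr)
  show "c \<odot>\<^bsub>free_algebra R\<^esub> (f \<otimes>\<^bsub>free_algebra R\<^esub> g) = c \<odot>\<^bsub>free_algebra R\<^esub> f \<otimes>\<^bsub>free_algebra R\<^esub> g"
    unfolding free_algebra_mult free_algebra_simps(6) word_conv_smult_left[OF c f'(2) g'(2)] ..
  show "c \<odot>\<^bsub>free_algebra R\<^esub> (f \<otimes>\<^bsub>free_algebra R\<^esub> g) = f \<otimes>\<^bsub>free_algebra R\<^esub> (c \<odot>\<^bsub>free_algebra R\<^esub> g)"
    unfolding free_algebra_mult free_algebra_simps(6) word_conv_smult_right[OF c f'(2) g'(2)] ..
next
  fix f :: "'g list \<Rightarrow> 'a" assume f: "f \<in> carrier (free_algebra R)"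
  show "\<one> \<odot>\<^bsub>free_algebra R\<^esub> f = f" using free_algebra_carrierD(1)[OF f] by simp
qed

text \<open>The free algebra is generated as an algebra by its generators, in the form in which left multiplication
  by a single generator suffices.\<close>

lemma free_algebra_induct [consumes 1, case_names one add smult gen]:
  fixes f :: "'g list \<Rightarrow> 'a"
  assumes f: "f \<in> carrier (free_algebra R)"
    and one: "Q \<one>\<^bsub>free_algebra R\<^esub>"
    and add: "\<And>f g. \<lbrakk>f \<in> carrier (free_algebra R); g \<in> carrier (free_algebra R); Q f; Q g\<rbrakk>
      \<Longrightarrow> Q (f \<oplus>\<^bsub>free_algebra R\<^esub> g)"
    and smult: "\<And>c f. \<lbrakk>c \<in> carrier R; f \<in> carrier (free_algebra R); Q f\<rbrakk> \<Longrightarrow> Q (c \<odot>\<^bsub>free_algebra R\<^esub> f)"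
    and gen: "\<And>g f. \<lbrakk>f \<in> carrier (free_algebra R); Q f\<rbrakk> \<Longrightarrow> Q (free_gen R g \<otimes>\<^bsub>free_algebra R\<^esub> f)"
  shows "Q f"
proof -
  define word :: "'g list \<Rightarrow> 'g list \<Rightarrow> 'a" where "word w = (\<lambda>u. if u = w then \<one> else \<zero>)" for w
  have word_closed: "word w \<in> carrier (free_algebra R)" for w
    by (rule free_algebra_carrierI[of _ "{w}"]) (auto simp: word_def)
  have Q_word: "Q (word w)" for w
  proof (induction w)
    case Nil
    then show ?case using one by (simp add: word_def)
  next
    case (Cons a w)
    have "free_gen R a \<otimes>\<^bsub>free_algebra R\<^esub> word w = word (a # w)"
      unfolding free_algebra_mult word_conv_gen_left[OF free_algebra_carrierD(2)[OF word_closed], abs_def]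
      by (auto simp: word_def split: list.split)
    then show ?case using gen[OF word_closed Cons] by metis
  qed
  have "Q f" if "finite W" "f \<in> carrier (free_algebra R)" "\<And>w. w \<notin> W \<Longrightarrow> f w = \<zero>" for W f
    using that
  proof (induction W arbitrary: f)
    case empty
    then have "f = \<zero> \<odot>\<^bsub>free_algebra R\<^esub> \<one>\<^bsub>free_algebra R\<^esub>" by auto
    then show ?case using smult[OF zero_closed _ one]
      monoid.one_closed[OF ring.is_monoid[OF ring_free_algebra]] by metis
  next
    case (insert w W)
    note f' = free_algebra_carrierD[OF insert.prems(1)]
    define g where "g = f(w := \<zero>)"
    have g: "g \<in> carrier (free_algebra R)"
      by (rule free_algebra_carrierI[of _ "{w. f w \<noteq> \<zero>}"]) (use f' in \<open>auto simp: g_def\<close>)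
    have "f = f w \<odot>\<^bsub>free_algebra R\<^esub> word w \<oplus>\<^bsub>free_algebra R\<^esub> g"
      using f'(1) by (auto simp: g_def word_def)
    moreover have "Q g" by (rule insert.IH[OF g]) (use insert.prems(2) in \<open>auto simp: g_def\<close>)
    moreover have "f w \<odot>\<^bsub>free_algebra R\<^esub> word w \<in> carrier (free_algebra R)"
      using assoc_algebra_free_algebra f'(1) word_closed
      by (meson assoc_algebra.axioms(1) module.smult_closed)
    ultimately show ?case using add[OF _ g smult[OF f'(1)[of w] word_closed Q_word]] by metis
  qed
  from this[OF free_algebra_carrierD(3)[OF f] f] show ?thesis by blast
qed

end

end

section \<open>Quotient algebras and their automorphisms\<close>

lemma quot_algebra_simps:
  "carrier (quot_algebra A I) = carrier (A Quot I)"
  "C \<otimes>\<^bsub>quot_algebra A I\<^esub> D = C \<otimes>\<^bsub>A Quot I\<^esub> D"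
  "\<one>\<^bsub>quot_algebra A I\<^esub> = \<one>\<^bsub>A Quot I\<^esub>"
  "\<zero>\<^bsub>quot_algebra A I\<^esub> = \<zero>\<^bsub>A Quot I\<^esub>"
  "C \<oplus>\<^bsub>quot_algebra A I\<^esub> D = C \<oplus>\<^bsub>A Quot I\<^esub> D"
  "c \<odot>\<^bsub>quot_algebra A I\<^esub> C = (\<Union>a \<in> C. I +>\<^bsub>A\<^esub> (c \<odot>\<^bsub>A\<^esub> a))"
  by (simp_all add: quot_algebra_def ring.extend_def module.fields_def)

locale quotient_algebra = assoc_algebra K A + I: ideal I A
  for K :: "('k, 'm) ring_scheme" (structure) and A :: "('k, 'a, 'n) module_scheme" (structure) and I
begin

abbreviation Q :: "('k, 'a set) module" where "Q \<equiv> quot_algebra A I"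

abbreviation proj :: "'a \<Rightarrow> 'a set" where "proj a \<equiv> I +>\<^bsub>A\<^esub> a"

lemma ring_quot: "ring Q"
proof -
  have "ring (Q\<lparr>zero := id \<zero>\<^bsub>A Quot I\<^esub>\<rparr>)"
    by (rule ring.ring_iso_imp_img_ring[OF I.quotient_is_ring])
       (auto intro!: ring_iso_memI simp: quot_algebra_simps bij_betw_def)
  moreover have "Q\<lparr>zero := id \<zero>\<^bsub>A Quot I\<^esub>\<rparr> = Q" by (simp add: quot_algebra_simps(4)[symmetric])
  ultimately show ?thesis by simp
qed

lemma proj_hom: "proj \<in> ring_hom A Q"
  using I.rcos_ring_hom by (simp add: ring_hom_def quot_algebra_simps Pi_iff)

lemma proj_closed [simp]: "a \<in> carrier A \<Longrightarrow> proj a \<in> carrier Q"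
  and proj_add: "\<lbrakk>a \<in> carrier A; b \<in> carrier A\<rbrakk> \<Longrightarrow> proj (a \<oplus>\<^bsub>A\<^esub> b) = proj a \<oplus>\<^bsub>Q\<^esub> proj b"
  and proj_mult: "\<lbrakk>a \<in> carrier A; b \<in> carrier A\<rbrakk> \<Longrightarrow> proj (a \<otimes>\<^bsub>A\<^esub> b) = proj a \<otimes>\<^bsub>Q\<^esub> proj b"
  and proj_one: "proj \<one>\<^bsub>A\<^esub> = \<one>\<^bsub>Q\<^esub>"
  using proj_hom by (auto simp: ring_hom_def)

lemma quot_cases: "C \<in> carrier Q \<Longrightarrow> (\<And>a. \<lbrakk>a \<in> carrier A; C = proj a\<rbrakk> \<Longrightarrow> thesis) \<Longrightarrow> thesis"
  by (auto simp: quot_algebra_simps FactRing_simps)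

text \<open>A scalar multiple is a product with a scalar multiple of the identity, so two-sided ideals are
  submodules.\<close>

lemma smult_ideal: "\<lbrakk>c \<in> carrier K; i \<in> I\<rbrakk> \<Longrightarrow> c \<odot>\<^bsub>A\<^esub> i \<in> I"
  using smult_as_mult(1)[of c i] I.I_l_closed[of i "c \<odot>\<^bsub>A\<^esub> \<one>\<^bsub>A\<^esub>"] by simp

lemma proj_smult:
  assumes c: "c \<in> carrier K" and a: "a \<in> carrier A"
  shows "c \<odot>\<^bsub>Q\<^esub> proj a = proj (c \<odot>\<^bsub>A\<^esub> a)"
proof -
  have "proj (c \<odot>\<^bsub>A\<^esub> b) = proj (c \<odot>\<^bsub>A\<^esub> a)" if b: "b \<in> proj a" for b
  proof -
    obtain i where i: "i \<in> I" "b = i \<oplus>\<^bsub>A\<^esub> a" using b by (auto simp: a_r_coset_def r_coset_def)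
    then have "c \<odot>\<^bsub>A\<^esub> b = c \<odot>\<^bsub>A\<^esub> i \<oplus>\<^bsub>A\<^esub> c \<odot>\<^bsub>A\<^esub> a" using c a by (simp add: smult_r_distr)
    then have "c \<odot>\<^bsub>A\<^esub> b \<in> proj (c \<odot>\<^bsub>A\<^esub> a)"
      using smult_ideal[OF c i(1)] by (auto simp: a_r_coset_def r_coset_def)
    then show ?thesis using c a by (intro I.a_repr_independence'[symmetric]) auto
  qed
  then have "c \<odot>\<^bsub>Q\<^esub> proj a = (\<Union>b \<in> proj a. proj (c \<odot>\<^bsub>A\<^esub> a))"
    unfolding quot_algebra_simps(6) by (intro SUP_cong refl)
  also have "\<dots> = proj (c \<odot>\<^bsub>A\<^esub> a)" using I.a_rcos_self[OF a] by auto
  finally show ?thesis .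
qed

lemma assoc_algebra_quot: "assoc_algebra K Q"
proof -
  interpret Q: ring Q by (rule ring_quot)
  note simps = proj_smult proj_add[symmetric] proj_mult[symmetric]
  show ?thesis
  proof (intro assoc_algebra.intro moduleI assoc_algebra_axioms.intro ring_quot R.is_cring
      Q.abelian_group_axioms)
    fix c d C D assume c: "c \<in> carrier K" and C: "C \<in> carrier Q"
    obtain a where a: "a \<in> carrier A" "C = proj a" using C by (rule quot_cases)
    show "c \<odot>\<^bsub>Q\<^esub> C \<in> carrier Q" using a c by (simp add: simps)
    {
      assume d: "d \<in> carrier K"
      show "(c \<oplus>\<^bsub>K\<^esub> d) \<odot>\<^bsub>Q\<^esub> C = c \<odot>\<^bsub>Q\<^esub> C \<oplus>\<^bsub>Q\<^esub> d \<odot>\<^bsub>Q\<^esub> C"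
        using a c d by (simp add: simps smult_l_distr)
      show "(c \<otimes>\<^bsub>K\<^esub> d) \<odot>\<^bsub>Q\<^esub> C = c \<odot>\<^bsub>Q\<^esub> (d \<odot>\<^bsub>Q\<^esub> C)" using a c d by (simp add: simps smult_assoc1)
    }
    assume D: "D \<in> carrier Q"
    obtain b where b: "b \<in> carrier A" "D = proj b" using D by (rule quot_cases)
    show "c \<odot>\<^bsub>Q\<^esub> (C \<oplus>\<^bsub>Q\<^esub> D) = c \<odot>\<^bsub>Q\<^esub> C \<oplus>\<^bsub>Q\<^esub> c \<odot>\<^bsub>Q\<^esub> D"
      using a b c by (simp add: simps smult_r_distr)
    show "c \<odot>\<^bsub>Q\<^esub> (C \<otimes>\<^bsub>Q\<^esub> D) = c \<odot>\<^bsub>Q\<^esub> C \<otimes>\<^bsub>Q\<^esub> D"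
      using a b c by (simp add: simps smult_mult_left)
    show "c \<odot>\<^bsub>Q\<^esub> (C \<otimes>\<^bsub>Q\<^esub> D) = C \<otimes>\<^bsub>Q\<^esub> (c \<odot>\<^bsub>Q\<^esub> D)"
      using a b c by (simp add: simps smult_mult_right)
  next
    fix C assume "C \<in> carrier Q"
    then show "\<one>\<^bsub>K\<^esub> \<odot>\<^bsub>Q\<^esub> C = C" by (rule quot_cases) (simp add: simps)
  qed
qed

text \<open>An automorphism that maps the ideal onto itself acts on cosets by taking images.\<close>

lemma automorphism_quot:
  assumes iso: "\<alpha> \<in> ring_iso A A" and stable: "\<alpha> ` I = I"
    and linear: "\<And>c a. \<lbrakk>c \<in> carrier K; a \<in> carrier A\<rbrakk> \<Longrightarrow> \<alpha> (c \<odot>\<^bsub>A\<^esub> a) = c \<odot>\<^bsub>A\<^esub> \<alpha> a"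
  shows "image \<alpha> \<in> ring_iso Q Q"
    and "\<And>a. a \<in> carrier A \<Longrightarrow> \<alpha> ` proj a = proj (\<alpha> a)"
    and "\<And>c C. \<lbrakk>c \<in> carrier K; C \<in> carrier Q\<rbrakk> \<Longrightarrow> \<alpha> ` (c \<odot>\<^bsub>Q\<^esub> C) = c \<odot>\<^bsub>Q\<^esub> (\<alpha> ` C)"
proof -
  have hom: "\<alpha> \<in> ring_hom A A" and bij: "bij_betw \<alpha> (carrier A) (carrier A)"
    using iso by (auto simp: ring_iso_def)
  note \<alpha> = ring_hom_closed[OF hom] ring_hom_add[OF hom] ring_hom_mult[OF hom] ring_hom_one[OF hom]
  show proj: "\<alpha> ` proj a = proj (\<alpha> a)" if a: "a \<in> carrier A" for a
  proof -
    have "\<alpha> ` proj a = (\<lambda>i. \<alpha> i \<oplus>\<^bsub>A\<^esub> \<alpha> a) ` I"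
      using a by (force simp: a_r_coset_def r_coset_def \<alpha>(2) image_iff)
    also have "\<dots> = (\<lambda>i. i \<oplus>\<^bsub>A\<^esub> \<alpha> a) ` (\<alpha> ` I)" by (simp add: image_image)
    also have "\<dots> = proj (\<alpha> a)" unfolding stable by (auto simp: a_r_coset_def r_coset_def)
    finally show ?thesis .
  qed
  show "\<alpha> ` (c \<odot>\<^bsub>Q\<^esub> C) = c \<odot>\<^bsub>Q\<^esub> (\<alpha> ` C)" if c: "c \<in> carrier K" and C: "C \<in> carrier Q" for c C
    using C by (rule quot_cases) (simp add: c proj proj_smult linear \<alpha>)
  show "image \<alpha> \<in> ring_iso Q Q"
  proof (rule ring_iso_memI)
    fix C D assume C: "C \<in> carrier Q" and D: "D \<in> carrier Q"
    obtain a where a: "a \<in> carrier A" "C = proj a" using C by (rule quot_cases)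
    obtain b where b: "b \<in> carrier A" "D = proj b" using D by (rule quot_cases)
    show "\<alpha> ` C \<in> carrier Q" using a by (simp add: proj \<alpha>)
    show "\<alpha> ` (C \<otimes>\<^bsub>Q\<^esub> D) = \<alpha> ` C \<otimes>\<^bsub>Q\<^esub> \<alpha> ` D" using a b by (simp add: proj \<alpha> proj_mult[symmetric])
    show "\<alpha> ` (C \<oplus>\<^bsub>Q\<^esub> D) = \<alpha> ` C \<oplus>\<^bsub>Q\<^esub> \<alpha> ` D" using a b by (simp add: proj \<alpha> proj_add[symmetric])
  next
    show "\<alpha> ` \<one>\<^bsub>Q\<^esub> = \<one>\<^bsub>Q\<^esub>" by (simp add: proj_one[symmetric] proj \<alpha>)
    show "bij_betw (image \<alpha>) (carrier Q) (carrier Q)"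
      unfolding bij_betw_def
    proof
      have "C \<subseteq> carrier A" if "C \<in> carrier Q" for C
        using that by (rule quot_cases) (use I.a_elemrcos_carrier in blast)
      then show "inj_on (image \<alpha>) (carrier Q)"
        using bij by (intro inj_onI) (metis bij_betw_def inj_on_image_eq_iff)
      show "image \<alpha> ` carrier Q = carrier Q"
      proof (intro equalityI subsetI)
        fix C assume "C \<in> image \<alpha> ` carrier Q"
        then show "C \<in> carrier Q" by (auto elim!: quot_cases simp: proj \<alpha>)
      next
        fix C assume "C \<in> carrier Q"
        then obtain a where a: "a \<in> carrier A" "C = proj a" by (rule quot_cases)
        then obtain b where "b \<in> carrier A" "a = \<alpha> b" using bij by (auto simp: bij_betw_def)
        then show "C \<in> image \<alpha> ` carrier Q" using a by (auto simp: proj[symmetric])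
      qed
    qed
  qed
qed

end

context cring
begin

text \<open>Rescaling the generators of the free algebra by units multiplies the coefficient of each word by the
  product of the factors of its letters.\<close>

definition word_weight :: "('g \<Rightarrow> 'a) \<Rightarrow> 'g list \<Rightarrow> 'a" where
  "word_weight u w = foldr (\<lambda>g c. u g \<otimes> c) w \<one>"

definition rescale :: "('g \<Rightarrow> 'a) \<Rightarrow> ('g list \<Rightarrow> 'a) \<Rightarrow> 'g list \<Rightarrow> 'a" where
  "rescale u f w = word_weight u w \<otimes> f w"

lemma word_weight_simps [simp]:
  "word_weight u [] = \<one>" "word_weight u (g # w) = u g \<otimes> word_weight u w"
  by (simp_all add: word_weight_def)

lemma word_weight_closed [simp]: "range u \<subseteq> carrier R \<Longrightarrow> word_weight u w \<in> carrier R"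
  by (induction w) auto

lemma word_weight_append:
  "range u \<subseteq> carrier R \<Longrightarrow> word_weight u (v @ w) = word_weight u v \<otimes> word_weight u w"
proof (induction v)
  case Nil
  then show ?case using word_weight_closed[OF Nil, of w] by simp
next
  case (Cons a v)
  have "u a \<in> carrier R" using Cons.prems by blast
  then show ?case
    using Cons word_weight_closed[OF Cons.prems, of v] word_weight_closed[OF Cons.prems, of w]
    by (simp add: m_assoc)
qed

lemma word_weight_inverse:
  assumes "range u \<subseteq> carrier R" "range v \<subseteq> carrier R" "\<And>g. u g \<otimes> v g = \<one>"
  shows "word_weight u w \<otimes> word_weight v w = \<one>"
proof (induction w)
  case (Cons a w)
  have "u a \<in> carrier R" "v a \<in> carrier R" using assms by blast+
  moreover from calculation(1,2) have "(u a \<otimes> word_weight u w) \<otimes> (v a \<otimes> word_weight v w) =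
      (u a \<otimes> v a) \<otimes> (word_weight u w \<otimes> word_weight v w)"
    using assms(1,2) by (simp add: m_ac)
  ultimately show ?case by (simp only: word_weight_simps Cons assms(3) l_one one_closed)
qed simp

lemma rescale_closed:
  assumes u: "range u \<subseteq> carrier R" and f: "f \<in> carrier (free_algebra R)"
  shows "rescale u f \<in> carrier (free_algebra R)"
  using free_algebra_carrierD[OF f] u
  by (intro free_algebra_carrierI[of _ "{w. f w \<noteq> \<zero>}"]) (auto simp: rescale_def)

lemma rescale_free_gen: "range u \<subseteq> carrier R \<Longrightarrow> rescale u (free_gen R g) = u g \<odot>\<^bsub>free_algebra R\<^esub> free_gen R g"
  by (rule ext) (auto simp: rescale_def free_gen_def free_algebra_simps image_subset_iff)

lemma rescale_smult:
  assumes u: "range u \<subseteq> carrier R" and c: "c \<in> carrier R" and f: "f \<in> carrier (free_algebra R)"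
  shows "rescale u (c \<odot>\<^bsub>free_algebra R\<^esub> f) = c \<odot>\<^bsub>free_algebra R\<^esub> rescale u f"
  using free_algebra_carrierD[OF f] c u by (auto simp: rescale_def free_algebra_simps m_lcomm)

lemma rescale_inverse:
  assumes "range u \<subseteq> carrier R" "range v \<subseteq> carrier R" "\<And>g. u g \<otimes> v g = \<one>"
    and f: "f \<in> carrier (free_algebra R)"
  shows "rescale u (rescale v f) = f"
  using word_weight_inverse[OF assms(1-3)] free_algebra_carrierD[OF f] assms
  by (auto simp: rescale_def m_assoc[symmetric])

lemma rescale_iso:
  fixes u v :: "'g \<Rightarrow> 'a"
  assumes u: "range u \<subseteq> carrier R" and v: "range v \<subseteq> carrier R" and uv: "\<And>g. u g \<otimes> v g = \<one>"
  shows "rescale u \<in> ring_iso (free_algebra R) (free_algebra R)"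
proof (rule ring_iso_memI)
  fix f g :: "'g list \<Rightarrow> 'a"
  assume f: "f \<in> carrier (free_algebra R)" and g: "g \<in> carrier (free_algebra R)"
  note f' = free_algebra_carrierD[OF f] and g' = free_algebra_carrierD[OF g]
  show "rescale u f \<in> carrier (free_algebra R)" by (rule rescale_closed[OF u f])
  show "rescale u (f \<oplus>\<^bsub>free_algebra R\<^esub> g) = rescale u f \<oplus>\<^bsub>free_algebra R\<^esub> rescale u g"
    using u f'(1) g'(1) by (simp add: rescale_def free_algebra_simps r_distr fun_eq_iff)
  show "rescale u (f \<otimes>\<^bsub>free_algebra R\<^esub> g) = rescale u f \<otimes>\<^bsub>free_algebra R\<^esub> rescale u g"
  proof
    fix w
    have "rescale u (f \<otimes>\<^bsub>free_algebra R\<^esub> g) w =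
        (\<Oplus>i\<in>{..length w}. word_weight u w \<otimes> (f (take i w) \<otimes> g (drop i w)))"
      unfolding rescale_def free_algebra_simps using u f'(1) g'(1) by (intro finsum_rdistr) auto
    also have "\<dots> = (\<Oplus>i\<in>{..length w}. rescale u f (take i w) \<otimes> rescale u g (drop i w))"
    proof (rule finsum_cong')
      fix i
      have "word_weight u w = word_weight u (take i w) \<otimes> word_weight u (drop i w)"
        using word_weight_append[OF u, of "take i w" "drop i w"] by simp
      then show "word_weight u w \<otimes> (f (take i w) \<otimes> g (drop i w)) =
          rescale u f (take i w) \<otimes> rescale u g (drop i w)"
        using u f'(1) g'(1) by (simp add: rescale_def m_ac)
    qed (use u f'(1) g'(1) in \<open>auto simp: rescale_def\<close>)
    finally show "rescale u (f \<otimes>\<^bsub>free_algebra R\<^esub> g) w = (rescale u f \<otimes>\<^bsub>free_algebra R\<^esub> rescale u g) w"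
      by (simp add: free_algebra_simps)
  qed
next
  show "rescale u \<one>\<^bsub>free_algebra R\<^esub> = (\<one>\<^bsub>free_algebra R\<^esub> :: 'g list \<Rightarrow> 'a)"
    using u by (auto simp: rescale_def free_algebra_simps)
  have vu: "v g \<otimes> u g = \<one>" for g using uv[of g] u v m_comm[of "v g" "u g"] by (auto simp: image_subset_iff)
  show "bij_betw (rescale u) (carrier (free_algebra R)) (carrier (free_algebra R))"
    by (rule bij_betw_byWitness[where f' = "rescale v"])
       (use rescale_inverse[OF u v uv] rescale_inverse[OF v u vu] rescale_closed u v in blast)+
qed

text \<open>The preimage of the ideal under rescaling is an ideal that contains the homogeneous generators, hence
  the ideal. Since the inverse rescaling has the same property, the ideal is mapped onto itself.\<close>

lemma rescale_genideal:
  assumes u: "range u \<subseteq> carrier R" and v: "range v \<subseteq> carrier R" and uv: "\<And>g. u g \<otimes> v g = \<one>"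
    and S: "S \<subseteq> carrier (free_algebra R)"
    and homogeneous: "\<And>s. s \<in> S \<Longrightarrow> \<exists>c \<in> carrier R. rescale u s = c \<odot>\<^bsub>free_algebra R\<^esub> s"
      "\<And>s. s \<in> S \<Longrightarrow> \<exists>c \<in> carrier R. rescale v s = c \<odot>\<^bsub>free_algebra R\<^esub> s"
  shows "rescale u ` (Idl\<^bsub>free_algebra R\<^esub> S) = Idl\<^bsub>free_algebra R\<^esub> S"
proof -
  let ?F = "free_algebra R" and ?I = "Idl\<^bsub>free_algebra R\<^esub> S"
  interpret F: assoc_algebra R ?F by (rule assoc_algebra_free_algebra)
  interpret I: ideal ?I ?F by (rule F.A.genideal_ideal[OF S])
  interpret IQ: quotient_algebra R ?F ?I by unfold_locales
  have vu: "v g \<otimes> u g = \<one>" for g using uv[of g] u v m_comm[of "v g" "u g"] by (auto simp: image_subset_iff)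
  have sub: "rescale w f \<in> ?I"
    if w: "range w \<subseteq> carrier R" "range w' \<subseteq> carrier R" "\<And>g. w g \<otimes> w' g = \<one>"
      and hw: "\<And>s. s \<in> S \<Longrightarrow> \<exists>c \<in> carrier R. rescale w s = c \<odot>\<^bsub>?F\<^esub> s"
      and f: "f \<in> ?I" for w w' f
  proof -
    interpret h: ring_hom_ring ?F ?F "rescale w"
      using rescale_iso[OF w] by (intro ring_hom_ringI2 F.A.ring_axioms) (simp add: ring_iso_def)
    have "ideal {r \<in> carrier ?F. rescale w r \<in> ?I} ?F" by (rule h.ideal_vimage[OF I.is_ideal])
    moreover have "S \<subseteq> {r \<in> carrier ?F. rescale w r \<in> ?I}"
    proof
      fix s assume s: "s \<in> S"
      obtain c where "c \<in> carrier R" "rescale w s = c \<odot>\<^bsub>?F\<^esub> s" using hw[OF s] by blast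
      moreover have "s \<in> ?I" using F.A.genideal_self[OF S] s by blast
      ultimately show "s \<in> {r \<in> carrier ?F. rescale w r \<in> ?I}" using IQ.smult_ideal S s by auto
    qed
    ultimately have "?I \<subseteq> {r \<in> carrier ?F. rescale w r \<in> ?I}" by (rule F.A.genideal_minimal)
    then show ?thesis using f by blast
  qed
  show ?thesis
  proof (intro equalityI subsetI)
    fix f assume "f \<in> rescale u ` ?I"
    then show "f \<in> ?I" using sub[OF u v uv homogeneous(1)] by blast
  next
    fix f assume f: "f \<in> ?I"
    have "f = rescale u (rescale v f)" using rescale_inverse[OF u v uv] I.Icarr[OF f] by simp
    then show "f \<in> rescale u ` ?I" using sub[OF v u vu homogeneous(2) f] by blast
  qed
qed

end

section \<open>Detecting skew polynomial rings by an action\<close>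

definition linear_endo :: "('k, 'm) ring_scheme \<Rightarrow> ('k, 'v, 'n) module_scheme \<Rightarrow> ('v \<Rightarrow> 'v) \<Rightarrow> bool" where
  "linear_endo K V \<phi> \<longleftrightarrow> \<phi> \<in> carrier V \<rightarrow> carrier V \<and>
    (\<forall>v \<in> carrier V. \<forall>w \<in> carrier V. \<phi> (v \<oplus>\<^bsub>V\<^esub> w) = \<phi> v \<oplus>\<^bsub>V\<^esub> \<phi> w) \<and>
    (\<forall>c \<in> carrier K. \<forall>v \<in> carrier V. \<phi> (c \<odot>\<^bsub>V\<^esub> v) = c \<odot>\<^bsub>V\<^esub> \<phi> v)"

lemma linear_endoD:
  assumes "linear_endo K V \<phi>"
  shows "v \<in> carrier V \<Longrightarrow> \<phi> v \<in> carrier V"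
    and "v \<in> carrier V \<Longrightarrow> w \<in> carrier V \<Longrightarrow> \<phi> (v \<oplus>\<^bsub>V\<^esub> w) = \<phi> v \<oplus>\<^bsub>V\<^esub> \<phi> w"
    and "c \<in> carrier K \<Longrightarrow> v \<in> carrier V \<Longrightarrow> \<phi> (c \<odot>\<^bsub>V\<^esub> v) = c \<odot>\<^bsub>V\<^esub> \<phi> v"
  using assms by (auto simp: linear_endo_def)

lemma (in module) linear_endo_zero:
  assumes "linear_endo R M \<phi>" shows "\<phi> \<zero>\<^bsub>M\<^esub> = \<zero>\<^bsub>M\<^esub>"
  using linear_endoD(1)[OF assms, of "\<zero>\<^bsub>M\<^esub>"] linear_endoD(3)[OF assms, of \<zero> "\<zero>\<^bsub>M\<^esub>"] by simp

lemma (in module) linear_endo_finsum: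
  assumes \<phi>: "linear_endo R M \<phi>" and f: "f \<in> W \<rightarrow> carrier M"
  shows "\<phi> (\<Oplus>\<^bsub>M\<^esub>w\<in>W. f w) = (\<Oplus>\<^bsub>M\<^esub>w\<in>W. \<phi> (f w))"
  using f
proof (induction W rule: infinite_finite_induct)
  case (insert w W)
  have "(\<lambda>w. \<phi> (f w)) \<in> W \<rightarrow> carrier M" "\<phi> (f w) \<in> carrier M"
    using insert.prems linear_endoD(1)[OF \<phi>] by auto
  then show ?case using insert linear_endoD(2)[OF \<phi>] by (simp add: Pi_iff)
qed (simp_all add: linear_endo_zero[OF \<phi>])

text \<open>A representation of \<open>A\<close> on \<open>V\<close> with a distinguished vector \<open>e\<close>, the vacuum.\<close>

locale algebra_action = assoc_algebra K A + V: module K V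
  for K :: "('k, 'm) ring_scheme" (structure) and A :: "('k, 'a, 'n) module_scheme" (structure)
    and V :: "('k, 'v, 'o) module_scheme" (structure) +
  fixes \<rho> :: "'a \<Rightarrow> 'v \<Rightarrow> 'v" and e :: 'v
  assumes linear: "a \<in> carrier A \<Longrightarrow> linear_endo K V (\<rho> a)"
    and \<rho>_add: "\<lbrakk>a \<in> carrier A; b \<in> carrier A; v \<in> carrier V\<rbrakk> \<Longrightarrow> \<rho> (a \<oplus>\<^bsub>A\<^esub> b) v = \<rho> a v \<oplus>\<^bsub>V\<^esub> \<rho> b v"
    and \<rho>_mult: "\<lbrakk>a \<in> carrier A; b \<in> carrier A; v \<in> carrier V\<rbrakk> \<Longrightarrow> \<rho> (a \<otimes>\<^bsub>A\<^esub> b) v = \<rho> a (\<rho> b v)"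
    and \<rho>_smult: "\<lbrakk>c \<in> carrier K; a \<in> carrier A; v \<in> carrier V\<rbrakk> \<Longrightarrow> \<rho> (c \<odot>\<^bsub>A\<^esub> a) v = c \<odot>\<^bsub>V\<^esub> \<rho> a v"
    and \<rho>_one: "v \<in> carrier V \<Longrightarrow> \<rho> \<one>\<^bsub>A\<^esub> v = v"
    and e_closed [simp]: "e \<in> carrier V"
begin

text \<open>Elements of \<open>R\<close> are determined by their value at the vacuum.\<close>

definition faithful_on :: "'a set \<Rightarrow> bool" where
  "faithful_on R \<longleftrightarrow> (\<forall>r \<in> R. \<rho> r e = \<zero>\<^bsub>V\<^esub> \<longrightarrow> r = \<zero>\<^bsub>A\<^esub>)"

lemma \<rho>_closed [simp]: "\<lbrakk>a \<in> carrier A; v \<in> carrier V\<rbrakk> \<Longrightarrow> \<rho> a v \<in> carrier V"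
  using linear linear_endoD(1) by metis

lemma \<rho>_zero: "v \<in> carrier V \<Longrightarrow> \<rho> \<zero>\<^bsub>A\<^esub> v = \<zero>\<^bsub>V\<^esub>"
  using \<rho>_smult[of "\<zero>\<^bsub>K\<^esub>" "\<one>\<^bsub>A\<^esub>" v] by (simp add: \<rho>_one)

lemma commutes_generate_ring:
  assumes \<phi>: "linear_endo K V \<phi>" and G: "G \<subseteq> carrier A"
    and comm: "\<And>g v. \<lbrakk>g \<in> G; v \<in> carrier V\<rbrakk> \<Longrightarrow> \<phi> (\<rho> g v) = \<rho> g (\<phi> v)"
    and r: "r \<in> generate_ring A G" and v: "v \<in> carrier V"
  shows "\<phi> (\<rho> r v) = \<rho> r (\<phi> v)"
  using r v
proof (induction arbitrary: v)
  case one
  then show ?case by (simp add: \<rho>_one linear_endoD[OF \<phi>])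
next
  case (a_inv h)
  have h: "h \<in> carrier A" using a_inv(1) A.generate_ring_in_carrier[OF G] by blast
  have neg: "\<rho> (\<ominus>\<^bsub>A\<^esub> h) w = (\<ominus>\<^bsub>K\<^esub> \<one>\<^bsub>K\<^esub>) \<odot>\<^bsub>V\<^esub> \<rho> h w" if "w \<in> carrier V" for w
    using \<rho>_smult[of "\<ominus>\<^bsub>K\<^esub> \<one>\<^bsub>K\<^esub>" h w] smult_l_minus[of "\<one>\<^bsub>K\<^esub>" h] h that by simp
  show ?case
    using a_inv h by (simp add: neg linear_endoD[OF \<phi>])
next
  case (eng_add h1 h2)
  have "h1 \<in> carrier A" "h2 \<in> carrier A"
    using eng_add(1,2) A.generate_ring_in_carrier[OF G] by blast+
  then show ?case using eng_add by (simp add: \<rho>_add linear_endoD[OF \<phi>])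
next
  case (eng_mult h1 h2)
  have "h1 \<in> carrier A" "h2 \<in> carrier A"
    using eng_mult(1,2) A.generate_ring_in_carrier[OF G] by blast+
  then show ?case using eng_mult by (simp add: \<rho>_mult linear_endoD[OF \<phi>])
qed (rule comm)

text \<open>If the operator \<open>\<pi> k\<close> commutes with the coefficients and recognises the \<open>k\<close>-th power of \<open>x\<close> at the
  vacuum, then it extracts the \<open>k\<close>-th coefficient of a left polynomial.\<close>

lemma slice_sum:
  assumes R: "R \<subseteq> carrier A" and x: "x \<in> carrier A" and f: "range f \<subseteq> R"
    and \<pi>: "\<And>k. linear_endo K V (\<pi> k)"
    and comm: "\<And>k r v. \<lbrakk>r \<in> R; v \<in> carrier V\<rbrakk> \<Longrightarrow> \<pi> k (\<rho> r v) = \<rho> r (\<pi> k v)"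
    and slice: "\<And>k n::nat. \<pi> k (\<rho> (x [^]\<^bsub>A\<^esub> n) e) = (if k = n then e else \<zero>\<^bsub>V\<^esub>)"
  shows "\<pi> k (\<rho> (\<Oplus>\<^bsub>A\<^esub>i\<in>{..<n::nat}. f i \<otimes>\<^bsub>A\<^esub> x [^]\<^bsub>A\<^esub> i) e) = (if k < n then \<rho> (f k) e else \<zero>\<^bsub>V\<^esub>)"
proof (induction n)
  case 0
  then show ?case by (simp add: \<rho>_zero V.linear_endo_zero[OF \<pi>])
next
  case (Suc n)
  have fR: "f i \<in> R" and fc: "f i \<in> carrier A" for i using f R by blast+
  let ?s = "\<Oplus>\<^bsub>A\<^esub>i\<in>{..<n}. f i \<otimes>\<^bsub>A\<^esub> x [^]\<^bsub>A\<^esub> i"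
  have s: "?s \<in> carrier A" using fc x by (intro M.finsum_closed) auto
  have "(\<Oplus>\<^bsub>A\<^esub>i\<in>{..<Suc n}. f i \<otimes>\<^bsub>A\<^esub> x [^]\<^bsub>A\<^esub> i) = f n \<otimes>\<^bsub>A\<^esub> x [^]\<^bsub>A\<^esub> n \<oplus>\<^bsub>A\<^esub> ?s"
    unfolding lessThan_Suc using fc x by (intro M.finsum_insert) auto
  then have "\<pi> k (\<rho> (\<Oplus>\<^bsub>A\<^esub>i\<in>{..<Suc n}. f i \<otimes>\<^bsub>A\<^esub> x [^]\<^bsub>A\<^esub> i) e) =
      \<rho> (f n) (if k = n then e else \<zero>\<^bsub>V\<^esub>) \<oplus>\<^bsub>V\<^esub> \<pi> k (\<rho> ?s e)"
    using fc s x by (simp add: \<rho>_add \<rho>_mult linear_endoD[OF \<pi>] comm[OF fR] slice)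
  also have "\<dots> = (if k < Suc n then \<rho> (f k) e else \<zero>\<^bsub>V\<^esub>)"
    unfolding Suc.IH using fc[of n] fc[of k] V.linear_endo_zero[OF linear[OF fc[of n]]] by (auto simp: less_Suc_eq)
  finally show ?case .
qed

text \<open>One storey of the tower. The generators are eigenvectors of the automorphism with invertible
  eigenvalues, which makes the subring stable under it and its inverse. Independence of the powers
  of \<open>x\<close> and faithfulness at the vacuum of the larger ring both result from \<open>slice_sum\<close>.\<close>

lemma ore_step:
  assumes G: "G \<subseteq> carrier A" and scal: "scalars \<subseteq> G" and x: "x \<in> carrier A"
    and iso: "\<alpha> \<in> ring_iso A A"
    and lin: "\<And>c a. \<lbrakk>c \<in> carrier K; a \<in> carrier A\<rbrakk> \<Longrightarrow> \<alpha> (c \<odot>\<^bsub>A\<^esub> a) = c \<odot>\<^bsub>A\<^esub> \<alpha> a"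
    and eigen: "\<And>g. g \<in> G \<Longrightarrow> \<exists>c \<in> Units K. \<alpha> g = c \<odot>\<^bsub>A\<^esub> g"
    and comm: "\<And>g. g \<in> G \<Longrightarrow> x \<otimes>\<^bsub>A\<^esub> g \<ominus>\<^bsub>A\<^esub> \<alpha> g \<otimes>\<^bsub>A\<^esub> x \<in> generate_ring A G"
    and \<pi>: "\<And>k. linear_endo K V (\<pi> k)"
    and \<pi>_comm: "\<And>k g v. \<lbrakk>g \<in> G; v \<in> carrier V\<rbrakk> \<Longrightarrow> \<pi> k (\<rho> g v) = \<rho> g (\<pi> k v)"
    and slice: "\<And>k n::nat. \<pi> k (\<rho> (x [^]\<^bsub>A\<^esub> n) e) = (if k = n then e else \<zero>\<^bsub>V\<^esub>)"
    and iter: "iterated_skew_sub K A (generate_ring A G)"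
    and faithful: "faithful_on (generate_ring A G)"
  shows "iterated_skew_sub K A (generate_ring A (insert x G)) \<and> faithful_on (generate_ring A (insert x G))"
proof -
  let ?R = "generate_ring A G" and ?S = "generate_ring A (insert x G)"
  have subR: "subring ?R A" by (rule A.generate_ring_is_subring[OF G])
  note Rc = subringE(1)[OF subR]
  have hom: "\<alpha> \<in> ring_hom A A" and inj: "inj_on \<alpha> (carrier A)"
    using iso by (auto simp: ring_iso_def bij_betw_def)
  interpret \<alpha>: ring_hom_ring A A \<alpha> by (rule ring_hom_ringI2[OF A.ring_axioms A.ring_axioms hom])
  have smultR: "c \<odot>\<^bsub>A\<^esub> r \<in> ?R" if "c \<in> carrier K" "r \<in> ?R" for c r
  proof -
    have "c \<odot>\<^bsub>A\<^esub> \<one>\<^bsub>A\<^esub> \<in> ?R" using scal that(1) by (auto intro: generate_ring.incl)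
    from subringE(6)[OF subR this that(2)] show ?thesis
      using smult_as_mult(1)[OF that(1) subsetD[OF Rc that(2)]] by simp
  qed
  have into: "\<alpha> r \<in> ?R" if "r \<in> ?R" for r
    using that
  proof induction
    case (incl g)
    then show ?case using eigen[OF incl] smultR[OF _ generate_ring.incl[OF incl]] by (auto simp: Units_def)
  next
    case (a_inv h)
    then show ?case using A.generate_ring_in_carrier[OF G] by (auto intro: generate_ring.a_inv)
  next
    case (eng_add h1 h2)
    then show ?case using A.generate_ring_in_carrier[OF G] by (auto intro: generate_ring.eng_add)
  next
    case (eng_mult h1 h2)
    then show ?case using A.generate_ring_in_carrier[OF G] by (auto intro: generate_ring.eng_mult)
  qed (simp add: generate_ring.one)
  have onto: "r \<in> \<alpha> ` ?R" if "r \<in> ?R" for r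
    using that
  proof induction
    case one
    show ?case by (rule image_eqI[OF _ generate_ring.one]) simp
  next
    case (incl g)
    obtain c where c: "c \<in> Units K" "\<alpha> g = c \<odot>\<^bsub>A\<^esub> g" using eigen[OF incl] by blast
    have gc: "g \<in> carrier A" using incl G by blast
    have "\<alpha> (inv\<^bsub>K\<^esub> c \<odot>\<^bsub>A\<^esub> g) = g"
      using c gc smult_assoc1[of "inv\<^bsub>K\<^esub> c" c g] by (simp add: lin R.Units_closed)
    then show ?case using smultR[OF _ generate_ring.incl[OF incl], of "inv\<^bsub>K\<^esub> c"] c(1)
      by (metis R.Units_inv_closed image_eqI)
  next
    case (a_inv h)
    then obtain k where k: "k \<in> ?R" "h = \<alpha> k" by blast
    then have "\<alpha> (\<ominus>\<^bsub>A\<^esub> k) = \<ominus>\<^bsub>A\<^esub> h" using subsetD[OF Rc k(1)] by simp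
    then show ?case using generate_ring.a_inv[OF k(1)] by (metis image_eqI)
  next
    case (eng_add h1 h2)
    then obtain k1 k2 where k: "k1 \<in> ?R" "h1 = \<alpha> k1" "k2 \<in> ?R" "h2 = \<alpha> k2" by blast
    then have "\<alpha> (k1 \<oplus>\<^bsub>A\<^esub> k2) = h1 \<oplus>\<^bsub>A\<^esub> h2"
      using subsetD[OF Rc k(1)] subsetD[OF Rc k(3)] by simp
    then show ?case using generate_ring.eng_add[OF k(1,3)] by (metis image_eqI)
  next
    case (eng_mult h1 h2)
    then obtain k1 k2 where k: "k1 \<in> ?R" "h1 = \<alpha> k1" "k2 \<in> ?R" "h2 = \<alpha> k2" by blast
    then have "\<alpha> (k1 \<otimes>\<^bsub>A\<^esub> k2) = h1 \<otimes>\<^bsub>A\<^esub> h2"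
      using subsetD[OF Rc k(1)] subsetD[OF Rc k(3)] by simp
    then show ?case using generate_ring.eng_mult[OF k(1,3)] by (metis image_eqI)
  qed
  have stable: "\<alpha> ` ?R = ?R" using into onto by blast
  have \<pi>R: "\<pi> k (\<rho> r v) = \<rho> r (\<pi> k v)" if "r \<in> ?R" "v \<in> carrier V" for k r v
    by (rule commutes_generate_ring[OF \<pi> G \<pi>_comm that])
  have indep: "f i = \<zero>\<^bsub>A\<^esub>"
    if f: "range f \<subseteq> ?R" and 0: "\<rho> (\<Oplus>\<^bsub>A\<^esub>i\<in>{..<n}. f i \<otimes>\<^bsub>A\<^esub> x [^]\<^bsub>A\<^esub> i) e = \<zero>\<^bsub>V\<^esub>" and i: "i < n"
    for f :: "nat \<Rightarrow> 'a" and n i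
  proof -
    have "\<rho> (f i) e = \<zero>\<^bsub>V\<^esub>"
      using slice_sum[OF Rc x f \<pi> \<pi>R slice, where k = i and n = n] i
      by (simp add: 0 V.linear_endo_zero[OF \<pi>])
    moreover have "f i \<in> ?R" using f by (rule subsetD) simp
    ultimately show ?thesis using faithful by (simp add: faithful_on_def)
  qed
  have ext: "skew_poly_ext K A ?R \<alpha> (\<lambda>r. x \<otimes>\<^bsub>A\<^esub> r \<ominus>\<^bsub>A\<^esub> \<alpha> r \<otimes>\<^bsub>A\<^esub> x) x ?S"
  proof (rule skew_poly_ext_generate_ring[OF G x iso lin refl stable comm])
    fix f :: "nat \<Rightarrow> 'a" and n i
    assume "range f \<subseteq> ?R" "(\<Oplus>\<^bsub>A\<^esub>i\<in>{..<n}. f i \<otimes>\<^bsub>A\<^esub> x [^]\<^bsub>A\<^esub> i) = \<zero>\<^bsub>A\<^esub>" "i < n"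
    then show "f i = \<zero>\<^bsub>A\<^esub>" using indep[of f n i] by (simp add: \<rho>_zero)
  qed
  interpret ore_extension K A ?R ?S \<alpha> "\<lambda>r. x \<otimes>\<^bsub>A\<^esub> r \<ominus>\<^bsub>A\<^esub> \<alpha> r \<otimes>\<^bsub>A\<^esub> x" x
    by (intro ore_extension.intro ore_extension_axioms.intro A.ring_axioms ext)
  have "iterated_skew_sub K A ?S" by (rule iterated_skew_sub.step[OF iter ext])
  moreover have "faithful_on ?S"
    unfolding faithful_on_def
  proof (intro ballI impI)
    fix s assume s: "s \<in> ?S" and 0: "\<rho> s e = \<zero>\<^bsub>V\<^esub>"
    have "s \<in> (\<Union>n. bounded_left_polys A ?R x n)" using s exhaust by simp
    then obtain n :: nat and f where f: "range f \<subseteq> ?R" "s = (\<Oplus>\<^bsub>A\<^esub>i\<in>{..<n}. f i \<otimes>\<^bsub>A\<^esub> x [^]\<^bsub>A\<^esub> i)"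
      unfolding A.bounded_left_polys_eq_sums[OF subR x] by blast
    from 0 have "f i = \<zero>\<^bsub>A\<^esub>" if "i < n" for i using indep[OF f(1) _ that] unfolding f(2) by simp
    then have "f i \<otimes>\<^bsub>A\<^esub> x [^]\<^bsub>A\<^esub> i = \<zero>\<^bsub>A\<^esub>" if "i \<in> {..<n}" for i
      using that x by simp
    then show "s = \<zero>\<^bsub>A\<^esub>" unfolding f(2) by (rule M.add.finprod_one_eqI)
  qed
  ultimately show ?thesis ..
qed

text \<open>The bottom of the tower: a scalar acts on the vacuum by multiplication.\<close>

lemma scalars_base:
  assumes "field K" "e \<noteq> \<zero>\<^bsub>V\<^esub>"
  shows "iterated_skew_sub K A (generate_ring A scalars)" "faithful_on (generate_ring A scalars)"
proof -
  interpret K: field K by fact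
  have sub: "scalars \<subseteq> carrier A" by auto
  have gen: "generate_ring A scalars = scalars"
    using A.generate_ring_min_subring1[OF sub subring_scalars] A.generate_ringE(2)[OF sub refl] by auto
  have 0: "c = \<zero>\<^bsub>K\<^esub>" if c: "c \<in> carrier K" "\<rho> (c \<odot>\<^bsub>A\<^esub> \<one>\<^bsub>A\<^esub>) e = \<zero>\<^bsub>V\<^esub>" for c
  proof (rule ccontr)
    assume "c \<noteq> \<zero>\<^bsub>K\<^esub>"
    then have u: "c \<in> Units K" using c(1) by (simp add: K.field_Units)
    have "c \<odot>\<^bsub>V\<^esub> e = \<zero>\<^bsub>V\<^esub>" using c by (simp add: \<rho>_smult \<rho>_one)
    then have "e = inv\<^bsub>K\<^esub> c \<odot>\<^bsub>V\<^esub> \<zero>\<^bsub>V\<^esub>" using V.smult_assoc1[of "inv\<^bsub>K\<^esub> c" c e] u c(1) by simp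
    then show False using assms(2) u by simp
  qed
  show "faithful_on (generate_ring A scalars)" unfolding gen faithful_on_def by (auto dest!: 0)
  have "inj_on (\<lambda>c. c \<odot>\<^bsub>A\<^esub> \<one>\<^bsub>A\<^esub>) (carrier K)"
  proof (rule inj_onI)
    fix c d assume cd: "c \<in> carrier K" "d \<in> carrier K" "c \<odot>\<^bsub>A\<^esub> \<one>\<^bsub>A\<^esub> = d \<odot>\<^bsub>A\<^esub> \<one>\<^bsub>A\<^esub>"
    have "(c \<ominus>\<^bsub>K\<^esub> d) \<odot>\<^bsub>A\<^esub> \<one>\<^bsub>A\<^esub> = \<zero>\<^bsub>A\<^esub>"
      unfolding a_minus_def using cd by (simp add: smult_l_distr smult_l_minus M.r_neg)
    then have "c \<ominus>\<^bsub>K\<^esub> d = \<zero>\<^bsub>K\<^esub>" using 0[of "c \<ominus>\<^bsub>K\<^esub> d"] cd by (simp add: \<rho>_zero)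
    then show "c = d" using cd by simp
  qed
  then show "iterated_skew_sub K A (generate_ring A scalars)" unfolding gen by (rule iterated_skew_sub.base)
qed

end

section \<open>Actions of the free algebra and its quotients\<close>

text \<open>A choice of one linear operator for each generator makes \<open>V\<close> a module over the free algebra,
  through the linear extension \<open>eval\<close> of the action of words.\<close>

locale word_action = module K V
  for K :: "('k, 'm) ring_scheme" (structure) and V :: "('k, 'v, 'o) module_scheme" (structure) +
  fixes act :: "'g \<Rightarrow> 'v \<Rightarrow> 'v"
  assumes act: "linear_endo K V (act g)"
begin

definition act_word :: "'g list \<Rightarrow> 'v \<Rightarrow> 'v" where
  "act_word w v = foldr act w v"

definition eval :: "('g list \<Rightarrow> 'k) \<Rightarrow> 'v \<Rightarrow> 'v" where
  "eval f v = (\<Oplus>\<^bsub>V\<^esub>w\<in>{w. f w \<noteq> \<zero>\<^bsub>K\<^esub>}. f w \<odot>\<^bsub>V\<^esub> act_word w v)"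

abbreviation F :: "('k, 'g list \<Rightarrow> 'k) module" where "F \<equiv> free_algebra K"

lemma act_word_simps [simp]: "act_word [] v = v" "act_word (g # w) v = act g (act_word w v)"
  by (simp_all add: act_word_def)

lemma act_word_linear: "linear_endo K V (act_word w)"
proof (induction w)
  case (Cons g w)
  then show ?case using act[of g] by (auto simp: linear_endo_def Pi_iff)
qed (simp add: linear_endo_def)

lemma act_word_closed [simp]: "v \<in> carrier V \<Longrightarrow> act_word w v \<in> carrier V"
  by (rule linear_endoD(1)[OF act_word_linear])

lemma eval_superset:
  assumes f: "f \<in> carrier F" and W: "finite W" "\<And>w. w \<notin> W \<Longrightarrow> f w = \<zero>\<^bsub>K\<^esub>" and v: "v \<in> carrier V"
  shows "eval f v = (\<Oplus>\<^bsub>V\<^esub>w\<in>W. f w \<odot>\<^bsub>V\<^esub> act_word w v)"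
  unfolding eval_def
proof (rule M.add.finprod_mono_neutral_cong_left[OF W(1)])
  show "{w. f w \<noteq> \<zero>\<^bsub>K\<^esub>} \<subseteq> W" using W(2) by blast
qed (use R.free_algebra_carrierD(1)[OF f] v in auto)

lemma eval_closed [simp]: "\<lbrakk>f \<in> carrier F; v \<in> carrier V\<rbrakk> \<Longrightarrow> eval f v \<in> carrier V"
  unfolding eval_def using R.free_algebra_carrierD(1)[of f] by (intro M.finsum_closed) simp

lemma eval_add:
  assumes f: "f \<in> carrier F" and g: "g \<in> carrier F" and v: "v \<in> carrier V"
  shows "eval (f \<oplus>\<^bsub>F\<^esub> g) v = eval f v \<oplus>\<^bsub>V\<^esub> eval g v"
proof -
  note f' = R.free_algebra_carrierD[OF f] and g' = R.free_algebra_carrierD[OF g]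
  let ?W = "{w. f w \<noteq> \<zero>\<^bsub>K\<^esub>} \<union> {w. g w \<noteq> \<zero>\<^bsub>K\<^esub>}"
  have fin: "finite ?W" using f' g' by simp
  have fg: "f \<oplus>\<^bsub>F\<^esub> g \<in> carrier F"
    using f g abelian_monoid.a_closed[OF abelian_group.axioms(1)[OF R.abelian_group_free_algebra]] by blast
  have "eval (f \<oplus>\<^bsub>F\<^esub> g) v = (\<Oplus>\<^bsub>V\<^esub>w\<in>?W. (f \<oplus>\<^bsub>F\<^esub> g) w \<odot>\<^bsub>V\<^esub> act_word w v)"
    by (rule eval_superset[OF fg fin _ v]) (auto simp: free_algebra_simps)
  also have "\<dots> = (\<Oplus>\<^bsub>V\<^esub>w\<in>?W. f w \<odot>\<^bsub>V\<^esub> act_word w v \<oplus>\<^bsub>V\<^esub> g w \<odot>\<^bsub>V\<^esub> act_word w v)"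
    by (rule M.finsum_cong') (use f' g' v in \<open>auto simp: free_algebra_simps smult_l_distr\<close>)
  also have "\<dots> = (\<Oplus>\<^bsub>V\<^esub>w\<in>?W. f w \<odot>\<^bsub>V\<^esub> act_word w v) \<oplus>\<^bsub>V\<^esub> (\<Oplus>\<^bsub>V\<^esub>w\<in>?W. g w \<odot>\<^bsub>V\<^esub> act_word w v)"
    using f' g' v by (intro M.finsum_addf) auto
  finally show ?thesis
    using eval_superset[OF f fin _ v] eval_superset[OF g fin _ v] by simp
qed

lemma eval_smult:
  assumes c: "c \<in> carrier K" and f: "f \<in> carrier F" and v: "v \<in> carrier V"
  shows "eval (c \<odot>\<^bsub>F\<^esub> f) v = c \<odot>\<^bsub>V\<^esub> eval f v"
proof -
  note f' = R.free_algebra_carrierD[OF f]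
  have cf: "c \<odot>\<^bsub>F\<^esub> f \<in> carrier F"
    using c f R.assoc_algebra_free_algebra by (meson assoc_algebra.axioms(1) module.smult_closed)
  have "eval (c \<odot>\<^bsub>F\<^esub> f) v = (\<Oplus>\<^bsub>V\<^esub>w\<in>{w. f w \<noteq> \<zero>\<^bsub>K\<^esub>}. (c \<odot>\<^bsub>F\<^esub> f) w \<odot>\<^bsub>V\<^esub> act_word w v)"
    by (rule eval_superset[OF cf f'(3) _ v]) (auto simp: free_algebra_simps c)
  also have "\<dots> = (\<Oplus>\<^bsub>V\<^esub>w\<in>{w. f w \<noteq> \<zero>\<^bsub>K\<^esub>}. c \<odot>\<^bsub>V\<^esub> (f w \<odot>\<^bsub>V\<^esub> act_word w v))"
    by (rule M.finsum_cong') (use f' v c in \<open>auto simp: free_algebra_simps smult_assoc1\<close>)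
  also have "\<dots> = c \<odot>\<^bsub>V\<^esub> eval f v"
    unfolding eval_def using f' v c by (intro finsum_smult_ldistr[symmetric]) auto
  finally show ?thesis .
qed

lemma eval_linear:
  assumes f: "f \<in> carrier F"
  shows "linear_endo K V (eval f)"
proof -
  note f' = R.free_algebra_carrierD[OF f]
  note lin = linear_endoD[OF act_word_linear]
  have "eval f (v \<oplus>\<^bsub>V\<^esub> w) = eval f v \<oplus>\<^bsub>V\<^esub> eval f w" if "v \<in> carrier V" "w \<in> carrier V" for v w
    unfolding eval_def using that f' by (simp add: lin smult_r_distr M.finsum_addf Pi_iff)
  moreover have "eval f (c \<odot>\<^bsub>V\<^esub> v) = c \<odot>\<^bsub>V\<^esub> eval f v" if "v \<in> carrier V" "c \<in> carrier K" for v c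
  proof -
    have "f w \<odot>\<^bsub>V\<^esub> act_word w (c \<odot>\<^bsub>V\<^esub> v) = c \<odot>\<^bsub>V\<^esub> (f w \<odot>\<^bsub>V\<^esub> act_word w v)" for w
      using that f' by (simp add: lin smult_assoc1[symmetric] R.m_comm)
    then show ?thesis
      unfolding eval_def using that f' by (simp add: finsum_smult_ldistr Pi_iff)
  qed
  ultimately show ?thesis using f by (simp add: linear_endo_def)
qed

lemma eval_one: "v \<in> carrier V \<Longrightarrow> eval \<one>\<^bsub>F\<^esub> v = v"
proof -
  assume v: "v \<in> carrier V"
  have "\<one>\<^bsub>F\<^esub> \<in> carrier F" using ring.ring_simprules(6)[OF R.ring_free_algebra] .
  then have "eval \<one>\<^bsub>F\<^esub> v = (\<Oplus>\<^bsub>V\<^esub>w\<in>{[]}. \<one>\<^bsub>F\<^esub> w \<odot>\<^bsub>V\<^esub> act_word w v)"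
    by (rule eval_superset) (auto simp: v free_algebra_simps)
  also have "\<dots> = \<one>\<^bsub>F\<^esub> [] \<odot>\<^bsub>V\<^esub> act_word [] v"
    using v by (subst M.finsum_insert) (auto simp: free_algebra_simps)
  finally show ?thesis using v by (simp add: free_algebra_simps)
qed

text \<open>Multiplication by a generator on the left just prepends it to each word of the support.\<close>

lemma eval_gen_mult:
  assumes f: "f \<in> carrier F" and v: "v \<in> carrier V"
  shows "eval (free_gen K g \<otimes>\<^bsub>F\<^esub> f) v = act g (eval f v)"
proof -
  note f' = R.free_algebra_carrierD[OF f]
  have gf: "free_gen K g \<otimes>\<^bsub>F\<^esub> f \<in> carrier F"
    using monoid.m_closed[OF ring.is_monoid[OF R.ring_free_algebra] R.free_gen_closed f] .
  have coeff: "(free_gen K g \<otimes>\<^bsub>F\<^esub> f) w = (case w of [] \<Rightarrow> \<zero>\<^bsub>K\<^esub> | a # u \<Rightarrow> if a = g then f u else \<zero>\<^bsub>K\<^esub>)" for w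
    using R.word_conv_gen_left[OF f'(2)] by (simp add: R.free_algebra_mult)
  let ?W = "{w. f w \<noteq> \<zero>\<^bsub>K\<^esub>}"
  have "eval (free_gen K g \<otimes>\<^bsub>F\<^esub> f) v =
      (\<Oplus>\<^bsub>V\<^esub>w\<in>(#) g ` ?W. (free_gen K g \<otimes>\<^bsub>F\<^esub> f) w \<odot>\<^bsub>V\<^esub> act_word w v)"
    by (rule eval_superset[OF gf _ _ v]) (use f' in \<open>auto simp: coeff split: list.splits\<close>)
  also have "\<dots> = (\<Oplus>\<^bsub>V\<^esub>w\<in>?W. (free_gen K g \<otimes>\<^bsub>F\<^esub> f) (g # w) \<odot>\<^bsub>V\<^esub> act_word (g # w) v)"
    using gf v linear_endoD(1)[OF act] R.free_algebra_carrierD(1)[OF gf]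
    by (intro M.finsum_reindex) auto
  also have "\<dots> = (\<Oplus>\<^bsub>V\<^esub>w\<in>?W. act g (f w \<odot>\<^bsub>V\<^esub> act_word w v))"
    by (rule M.finsum_cong') (use f' v in \<open>auto simp: coeff linear_endoD[OF act]\<close>)
  also have "\<dots> = act g (eval f v)"
    unfolding eval_def using f' v by (intro linear_endo_finsum[OF act, symmetric]) auto
  finally show ?thesis .
qed

lemma eval_gen: "v \<in> carrier V \<Longrightarrow> eval (free_gen K g) v = act g v"
  using eval_gen_mult[of "\<one>\<^bsub>F\<^esub>" v g] ring.ring_simprules(6,13)[OF R.ring_free_algebra]
  by (simp add: eval_one monoid.r_one[OF ring.is_monoid[OF R.ring_free_algebra]])

lemma eval_mult:
  assumes f: "f \<in> carrier F" and h: "h \<in> carrier F" and v: "v \<in> carrier V"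
  shows "eval (f \<otimes>\<^bsub>F\<^esub> h) v = eval f (eval h v)"
proof -
  interpret F: assoc_algebra K F by (rule R.assoc_algebra_free_algebra)
  show ?thesis
    using f
  proof (induction rule: R.free_algebra_induct)
    case one
    then show ?case using h v by (simp add: eval_one)
  next
    case (add f g)
    then show ?case using h v by (simp add: F.A.l_distr eval_add)
  next
    case (smult c f)
    then show ?case using h v by (simp add: F.smult_mult_left[symmetric] eval_smult)
  next
    case (gen g f)
    then show ?case using h v by (simp add: F.A.m_assoc eval_gen_mult)
  qed
qed

lemma annihilator_ideal: "ideal {f \<in> carrier F. \<forall>v \<in> carrier V. eval f v = \<zero>\<^bsub>V\<^esub>} F"
proof -
  interpret F: assoc_algebra K F by (rule R.assoc_algebra_free_algebra)
  have zero: "eval \<zero>\<^bsub>F\<^esub> v = \<zero>\<^bsub>V\<^esub>" if "v \<in> carrier V" for v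
    using eval_smult[of "\<zero>\<^bsub>K\<^esub>" "\<one>\<^bsub>F\<^esub>" v] that by simp
  have minus: "eval (\<ominus>\<^bsub>F\<^esub> f) v = \<ominus>\<^bsub>V\<^esub> eval f v" if "f \<in> carrier F" "v \<in> carrier V" for f v
    using eval_smult[of "\<ominus>\<^bsub>K\<^esub> \<one>\<^bsub>K\<^esub>" f v] F.smult_l_minus[of "\<one>\<^bsub>K\<^esub>" f] smult_l_minus[of "\<one>\<^bsub>K\<^esub>" "eval f v"] that
    by simp
  show ?thesis
  proof (rule idealI[OF F.A.ring_axioms])
    show "subgroup {f \<in> carrier F. \<forall>v \<in> carrier V. eval f v = \<zero>\<^bsub>V\<^esub>} (add_monoid F)"
      by (rule F.M.add.subgroupI) (auto simp: zero minus eval_add intro!: exI[of _ "\<zero>\<^bsub>F\<^esub>"])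
  qed (auto simp: eval_mult linear_endo_zero[OF eval_linear])
qed

context
  fixes I assumes I: "ideal I F" and ann: "\<And>f v. \<lbrakk>f \<in> I; v \<in> carrier V\<rbrakk> \<Longrightarrow> eval f v = \<zero>\<^bsub>V\<^esub>"
begin

text \<open>An ideal that annihilates \<open>V\<close> lets the action descend; which representative of a coset is picked is
  immaterial by \<open>quot_eval_proj\<close>.\<close>

definition quot_eval :: "('g list \<Rightarrow> 'k) set \<Rightarrow> 'v \<Rightarrow> 'v" where
  "quot_eval C = eval (SOME f. f \<in> C)"

lemma quot_eval_proj:
  assumes f: "f \<in> carrier F" and v: "v \<in> carrier V"
  shows "quot_eval (I +>\<^bsub>F\<^esub> f) v = eval f v"
proof -
  interpret I: ideal I F by (rule I)
  have "(SOME g. g \<in> I +>\<^bsub>F\<^esub> f) \<in> I +>\<^bsub>F\<^esub> f"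
    using someI[of "\<lambda>g. g \<in> I +>\<^bsub>F\<^esub> f", OF I.a_rcos_self[OF f]] .
  then obtain i where i: "i \<in> I" "(SOME g. g \<in> I +>\<^bsub>F\<^esub> f) = i \<oplus>\<^bsub>F\<^esub> f"
    by (auto simp: a_r_coset_def r_coset_def)
  then show ?thesis using f v I.Icarr[OF i(1)] by (simp add: quot_eval_def eval_add ann)
qed

lemma algebra_action_quot:
  assumes e: "e \<in> carrier V"
  shows "algebra_action K (quot_algebra F I) V quot_eval e"
proof -
  interpret F: assoc_algebra K F by (rule R.assoc_algebra_free_algebra)
  interpret I: ideal I F by (rule I)
  interpret Q: quotient_algebra K F I by unfold_locales
  note simps = quot_eval_proj Q.proj_smult Q.proj_add[symmetric] Q.proj_mult[symmetric] Q.proj_one[symmetric]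
  show ?thesis
  proof (intro algebra_action.intro algebra_action_axioms.intro Q.assoc_algebra_quot e)
    show "module K V" by (rule module_axioms)
    fix C D c v assume C: "C \<in> carrier Q.Q"
    obtain f where f: "f \<in> carrier F" "C = Q.proj f" using C by (rule Q.quot_cases)
    show "linear_endo K V (quot_eval C)"
      using eval_linear[OF f(1)] unfolding linear_endo_def f(2) by (simp add: simps f(1) Pi_iff)
    assume v: "v \<in> carrier V"
    show "c \<in> carrier K \<Longrightarrow> quot_eval (c \<odot>\<^bsub>Q.Q\<^esub> C) v = c \<odot>\<^bsub>V\<^esub> quot_eval C v"
      using f v by (simp add: simps eval_smult)
    assume D: "D \<in> carrier Q.Q"
    obtain g where g: "g \<in> carrier F" "D = Q.proj g" using D by (rule Q.quot_cases)
    show "quot_eval (C \<oplus>\<^bsub>Q.Q\<^esub> D) v = quot_eval C v \<oplus>\<^bsub>V\<^esub> quot_eval D v"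
      using f g v by (simp add: simps eval_add)
    show "quot_eval (C \<otimes>\<^bsub>Q.Q\<^esub> D) v = quot_eval C (quot_eval D v)"
      using f g v by (simp add: simps eval_mult)
  next
    fix v assume "v \<in> carrier V"
    then show "quot_eval \<one>\<^bsub>Q.Q\<^esub> v = v" by (simp add: simps eval_one)
  qed
qed

end

end

section \<open>The representation on functions on three indices\<close>

text \<open>All functions are admitted as vectors, so that membership and the module laws can be checked at each
  index separately.\<close>

definition fun_module :: "('k, 'm) ring_scheme \<Rightarrow> ('k, 'i \<Rightarrow> 'k) module" where
  "fun_module K =
     \<lparr>carrier = UNIV \<rightarrow> carrier K, monoid.mult = (\<lambda>v w i. v i \<otimes>\<^bsub>K\<^esub> w i), one = (\<lambda>_. \<one>\<^bsub>K\<^esub>),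
      ring.zero = (\<lambda>_. \<zero>\<^bsub>K\<^esub>), add = (\<lambda>v w i. v i \<oplus>\<^bsub>K\<^esub> w i), smult = (\<lambda>c v i. c \<otimes>\<^bsub>K\<^esub> v i)\<rparr>"

lemma fun_module_simps [simp]:
  "carrier (fun_module K) = UNIV \<rightarrow> carrier K"
  "\<zero>\<^bsub>fun_module K\<^esub> = (\<lambda>_. \<zero>\<^bsub>K\<^esub>)"
  "v \<oplus>\<^bsub>fun_module K\<^esub> w = (\<lambda>i. v i \<oplus>\<^bsub>K\<^esub> w i)"
  "c \<odot>\<^bsub>fun_module K\<^esub> v = (\<lambda>i. c \<otimes>\<^bsub>K\<^esub> v i)"
  by (simp_all add: fun_module_def)

lemma (in cring) module_fun_module: "module R (fun_module R)"
proof (rule moduleI[OF is_cring])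
  show "abelian_group (fun_module R)"
  proof (rule abelian_groupI)
    fix v :: "'i \<Rightarrow> 'a" assume v: "v \<in> carrier (fun_module R)"
    then have "(\<lambda>i. \<ominus> v i) \<oplus>\<^bsub>fun_module R\<^esub> v = \<zero>\<^bsub>fun_module R\<^esub>" by (auto simp: l_neg Pi_iff)
    moreover have "(\<lambda>i. \<ominus> v i) \<in> carrier (fun_module R)" using v by auto
    ultimately show "\<exists>w\<in>carrier (fun_module R). w \<oplus>\<^bsub>fun_module R\<^esub> v = \<zero>\<^bsub>fun_module R\<^esub>" by blast
  qed (auto simp: Pi_iff a_ac)
qed (auto simp: Pi_iff l_distr r_distr m_assoc)

locale heisenberg_parameters = field K for K :: "('k, 'm) ring_scheme" (structure) +
  fixes p q :: 'k
  assumes p: "p \<in> carrier K - {\<zero>}" and q: "q \<in> carrier K - {\<zero>}"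
begin

lemma pq_closed [simp]: "p \<in> carrier K" "q \<in> carrier K" "p \<in> Units K" "q \<in> Units K"
  "inv p \<in> carrier K" "inv q \<in> carrier K"
  using p q by (auto simp: field_Units)

lemma inv_cancel [simp]: "p \<otimes> inv p = \<one>" "q \<otimes> inv q = \<one>" "inv p \<otimes> p = \<one>" "inv q \<otimes> q = \<one>"
  by auto

text \<open>The scalar \<open>c\<^sub>i\<close> in \<open>yx\<^sup>i = q\<^sup>ix\<^sup>iy + c\<^sub>ix\<^sup>i\<^sup>-\<^sup>1z\<close>. Multiplying \<open>yx = qxy + z\<close> by \<open>x\<^sup>i\<close> on the right and using
  \<open>zx\<^sup>i = p\<^sup>-\<^sup>ix\<^sup>iz\<close> gives the recursion.\<close>

primrec lowering_coeff :: "nat \<Rightarrow> 'k" where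
  "lowering_coeff 0 = \<zero>"
| "lowering_coeff (Suc n) = q \<otimes> lowering_coeff n \<oplus> (inv p) [^] n"

lemma lowering_coeff_closed [simp]: "lowering_coeff n \<in> carrier K"
  by (induction n) auto

text \<open>Left multiplication by the generators, with the basis vector \<open>e(i, j, k)\<close> in place of the monomial
  \<open>x\<^sup>iz\<^sup>jy\<^sup>k\<close>: \<open>x e(i, j, k) = e(i+1, j, k)\<close>, \<open>z e(i, j, k) = p\<^sup>-\<^sup>i e(i, j+1, k)\<close> and
  \<open>y e(i, j, k) = q\<^sup>ip\<^sup>-\<^sup>j e(i, j, k+1) + c\<^sub>i e(i-1, j+1, k)\<close>. The equations below are the transposed form: they
  give the coefficient of the result at \<open>(i, j, k)\<close>, hence the index \<open>i + 1\<close> of \<open>c\<close> in the last one.\<close>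

fun gen_op :: "gen \<Rightarrow> (nat \<times> nat \<times> nat \<Rightarrow> 'k) \<Rightarrow> nat \<times> nat \<times> nat \<Rightarrow> 'k" where
  "gen_op GenX v (i, j, k) = (case i of 0 \<Rightarrow> \<zero> | Suc i' \<Rightarrow> v (i', j, k))"
| "gen_op GenZ v (i, j, k) = (case j of 0 \<Rightarrow> \<zero> | Suc j' \<Rightarrow> (inv p) [^] i \<otimes> v (i, j', k))"
| "gen_op GenY v (i, j, k) =
     (case k of 0 \<Rightarrow> \<zero> | Suc k' \<Rightarrow> q [^] i \<otimes> (inv p) [^] j \<otimes> v (i, j, k')) \<oplus>
     (case j of 0 \<Rightarrow> \<zero> | Suc j' \<Rightarrow> lowering_coeff (Suc i) \<otimes> v (Suc i, j', k))"

abbreviation V :: "('k, nat \<times> nat \<times> nat \<Rightarrow> 'k) module" where "V \<equiv> fun_module K"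

lemma gen_op_linear: "linear_endo K V (gen_op g)"
proof -
  have "gen_op g v t \<in> carrier K" if "v \<in> carrier V" for v t
    using that by (cases t; cases g) (auto split: nat.split simp: Pi_iff simp del: lowering_coeff.simps)
  moreover have "gen_op g (\<lambda>i. v i \<oplus> w i) t = gen_op g v t \<oplus> gen_op g w t"
    if "v \<in> carrier V" "w \<in> carrier V" for v w t
    using that by (cases t; cases g) (auto split: nat.split simp: Pi_iff r_distr a_ac simp del: lowering_coeff.simps)
  moreover have "gen_op g (\<lambda>i. c \<otimes> v i) t = c \<otimes> gen_op g v t"
    if "v \<in> carrier V" "c \<in> carrier K" for v c t
    using that by (cases t; cases g) (auto split: nat.split simp: Pi_iff r_distr m_ac simp del: lowering_coeff.simps)
  ultimately show ?thesis by (auto simp: linear_endo_def Pi_iff fun_eq_iff)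
qed

lemma gen_op_closed [simp]: "v \<in> UNIV \<rightarrow> carrier K \<Longrightarrow> gen_op g v \<in> UNIV \<rightarrow> carrier K"
  using linear_endoD(1)[OF gen_op_linear, of v g] by simp

text \<open>The third relation is the recursion for \<open>c\<^sub>i\<close>; the second holds because both terms of \<open>y\<close> gain one
  factor \<open>p\<^sup>-\<^sup>1\<close> when \<open>z\<close> is applied first.\<close>

lemma gen_op_relations:
  assumes v: "v \<in> carrier V"
  shows "gen_op GenZ (gen_op GenX v) = inv p \<odot>\<^bsub>V\<^esub> gen_op GenX (gen_op GenZ v)"
    and "gen_op GenZ (gen_op GenY v) = p \<odot>\<^bsub>V\<^esub> gen_op GenY (gen_op GenZ v)"
    and "gen_op GenY (gen_op GenX v) = q \<odot>\<^bsub>V\<^esub> gen_op GenX (gen_op GenY v) \<oplus>\<^bsub>V\<^esub> gen_op GenZ v"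
proof -
  have vc [simp]: "v t \<in> carrier K" for t using v by auto
  have pp: "p \<otimes> (inv p \<otimes> c) = c" if "c \<in> carrier K" for c
    using that by (simp add: m_assoc[symmetric])
  show "gen_op GenZ (gen_op GenX v) = inv p \<odot>\<^bsub>V\<^esub> gen_op GenX (gen_op GenZ v)"
    by (rule ext, rename_tac t, case_tac t) (auto split: nat.split simp: m_ac)
  show "gen_op GenZ (gen_op GenY v) = p \<odot>\<^bsub>V\<^esub> gen_op GenY (gen_op GenZ v)"
    by (rule ext, rename_tac t, case_tac t)
       (auto split: nat.split simp: m_ac r_distr pp simp del: lowering_coeff.simps)
  show "gen_op GenY (gen_op GenX v) = q \<odot>\<^bsub>V\<^esub> gen_op GenX (gen_op GenY v) \<oplus>\<^bsub>V\<^esub> gen_op GenZ v"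
    by (rule ext, rename_tac t, case_tac t)
       (auto split: nat.split simp: m_ac a_ac l_distr r_distr)
qed

definition basis :: "nat \<times> nat \<times> nat \<Rightarrow> nat \<times> nat \<times> nat \<Rightarrow> 'k" where
  "basis s t = (if t = s then \<one> else \<zero>)"

lemma basis_closed [simp]: "basis s \<in> UNIV \<rightarrow> carrier K" "basis s t \<in> carrier K"
  by (auto simp: basis_def)

lemma gen_op_basis:
  "gen_op GenX (basis (i, j, k)) = basis (Suc i, j, k)"
  "gen_op GenZ (basis (0, j, k)) = basis (0, Suc j, k)"
  "gen_op GenY (basis (0, 0, k)) = basis (0, 0, Suc k)"
  by (rule ext, rename_tac t, case_tac t, auto split: nat.split simp: basis_def)+

text \<open>Extracts the part of a vector that lies \<open>n\<close> steps away from the vacuum in the direction of a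
  generator.\<close>

fun slice :: "gen \<Rightarrow> nat \<Rightarrow> (nat \<times> nat \<times> nat \<Rightarrow> 'k) \<Rightarrow> nat \<times> nat \<times> nat \<Rightarrow> 'k" where
  "slice GenX n v (i, j, k) = (if i = 0 then v (n, j, k) else \<zero>)"
| "slice GenZ n v (i, j, k) = (if j = 0 then v (i, n, k) else \<zero>)"
| "slice GenY n v (i, j, k) = (if k = 0 then v (i, j, n) else \<zero>)"

lemma slice_linear: "linear_endo K V (slice g n)"
proof -
  have "slice g n v t \<in> carrier K" if "v \<in> carrier V" for v t
    using that by (cases t; cases g) auto
  moreover have "slice g n (\<lambda>i. v i \<oplus> w i) t = slice g n v t \<oplus> slice g n w t" for v w t
    by (cases t; cases g) auto
  moreover have "slice g n (\<lambda>i. c \<otimes> v i) t = c \<otimes> slice g n v t" if "c \<in> carrier K" for v c t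
    using that by (cases t; cases g) auto
  ultimately show ?thesis by (auto simp: linear_endo_def Pi_iff fun_eq_iff)
qed

text \<open>Along the tower \<open>x, z, y\<close>, earlier generators neither look at nor change the index of a later one.\<close>

lemma slice_gen_op:
  assumes v: "v \<in> carrier V"
  shows "slice GenZ n (gen_op GenX v) = gen_op GenX (slice GenZ n v)"
    and "slice GenY n (gen_op GenX v) = gen_op GenX (slice GenY n v)"
    and "slice GenY n (gen_op GenZ v) = gen_op GenZ (slice GenY n v)"
  by (rule ext, rename_tac t, case_tac t, auto split: nat.split)+

lemma slice_basis:
  "slice GenX k (basis (n, 0, 0)) = (if k = n then basis (0, 0, 0) else \<zero>\<^bsub>V\<^esub>)"
  "slice GenZ k (basis (0, n, 0)) = (if k = n then basis (0, 0, 0) else \<zero>\<^bsub>V\<^esub>)"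
  "slice GenY k (basis (0, 0, n)) = (if k = n then basis (0, 0, 0) else \<zero>\<^bsub>V\<^esub>)"
  by (rule ext, rename_tac t, case_tac t, auto simp: basis_def)+

end

section \<open>The tower of skew polynomial rings\<close>

lemma (in assoc_algebra) smult_mult_smult:
  assumes "c \<in> carrier K" "d \<in> carrier K" "a \<in> carrier A" "b \<in> carrier A"
  shows "(c \<odot>\<^bsub>A\<^esub> a) \<otimes>\<^bsub>A\<^esub> (d \<odot>\<^bsub>A\<^esub> b) = (c \<otimes>\<^bsub>K\<^esub> d) \<odot>\<^bsub>A\<^esub> (a \<otimes>\<^bsub>A\<^esub> b)"
  using assms smult_mult_left[of c a "d \<odot>\<^bsub>A\<^esub> b"] smult_mult_right[of d a b] smult_assoc1[of c d "a \<otimes>\<^bsub>A\<^esub> b"]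
  by simp

lemma (in assoc_algebra) smult_diff:
  assumes "c \<in> carrier K" "a \<in> carrier A" "b \<in> carrier A"
  shows "c \<odot>\<^bsub>A\<^esub> (a \<ominus>\<^bsub>A\<^esub> b) = c \<odot>\<^bsub>A\<^esub> a \<ominus>\<^bsub>A\<^esub> c \<odot>\<^bsub>A\<^esub> b"
  using assms by (simp add: a_minus_def smult_r_distr smult_r_minus)

lemma (in word_action) eval_diff_eq_zero:
  assumes f: "f \<in> carrier F" and g: "g \<in> carrier F" and v: "v \<in> carrier V" and eq: "eval f v = eval g v"
  shows "eval (f \<ominus>\<^bsub>F\<^esub> g) v = \<zero>\<^bsub>V\<^esub>"
proof -
  interpret F: assoc_algebra K F by (rule R.assoc_algebra_free_algebra)
  have "eval (f \<ominus>\<^bsub>F\<^esub> g) v \<oplus>\<^bsub>V\<^esub> eval g v = eval ((f \<ominus>\<^bsub>F\<^esub> g) \<oplus>\<^bsub>F\<^esub> g) v"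
    using f g v by (intro eval_add[symmetric]) auto
  also have "(f \<ominus>\<^bsub>F\<^esub> g) \<oplus>\<^bsub>F\<^esub> g = f" using f g by (simp add: a_minus_def F.M.a_assoc F.M.l_neg)
  finally show ?thesis
    using f g v eq M.add.r_cancel_one[of "eval g v" "eval (f \<ominus>\<^bsub>F\<^esub> g) v"] by simp
qed

context heisenberg_parameters
begin

abbreviation F :: "('k, gen list \<Rightarrow> 'k) module" where "F \<equiv> free_algebra K"
abbreviation rels :: "(gen list \<Rightarrow> 'k) set" where "rels \<equiv> H_relations K p q"
abbreviation I :: "(gen list \<Rightarrow> 'k) set" where "I \<equiv> Idl\<^bsub>F\<^esub> rels"
abbreviation H :: "('k, (gen list \<Rightarrow> 'k) set) module" where "H \<equiv> H_alg K p q"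

sublocale F: assoc_algebra K F by (rule assoc_algebra_free_algebra)

sublocale V: word_action K V gen_op
  by (intro word_action.intro word_action_axioms.intro module_fun_module gen_op_linear)

abbreviation xF :: "gen list \<Rightarrow> 'k" where "xF \<equiv> free_gen K GenX"
abbreviation yF :: "gen list \<Rightarrow> 'k" where "yF \<equiv> free_gen K GenY"
abbreviation zF :: "gen list \<Rightarrow> 'k" where "zF \<equiv> free_gen K GenZ"

lemma rels_eq:
  "rels = {zF \<otimes>\<^bsub>F\<^esub> xF \<ominus>\<^bsub>F\<^esub> inv p \<odot>\<^bsub>F\<^esub> (xF \<otimes>\<^bsub>F\<^esub> zF),
           zF \<otimes>\<^bsub>F\<^esub> yF \<ominus>\<^bsub>F\<^esub> p \<odot>\<^bsub>F\<^esub> (yF \<otimes>\<^bsub>F\<^esub> zF),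
           yF \<otimes>\<^bsub>F\<^esub> xF \<ominus>\<^bsub>F\<^esub> q \<odot>\<^bsub>F\<^esub> (xF \<otimes>\<^bsub>F\<^esub> yF) \<ominus>\<^bsub>F\<^esub> zF}"
  by (simp add: H_relations_def Let_def)

lemma rels_closed: "rels \<subseteq> carrier F"
  unfolding rels_eq by simp

sublocale ideal_I: ideal I F by (rule F.A.genideal_ideal[OF rels_closed])

sublocale Q: quotient_algebra K F I by unfold_locales

lemma H_eq: "H = quot_algebra F I"
  by (simp add: H_alg_def)

text \<open>The annihilator of the representation is an ideal that contains the defining relations.\<close>

lemma eval_ideal:
  assumes f: "f \<in> I" and v: "v \<in> carrier V"
  shows "V.eval f v = \<zero>\<^bsub>V\<^esub>"
proof -
  let ?J = "{f \<in> carrier F. \<forall>v \<in> carrier V. V.eval f v = \<zero>\<^bsub>V\<^esub>}"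
  have "V.eval r v = \<zero>\<^bsub>V\<^esub>" if r: "r \<in> rels" and v: "v \<in> carrier V" for r v
  proof -
    note simps = V.eval_mult V.eval_gen V.eval_smult gen_op_relations
    have gc: "gen_op g w \<in> carrier V" if "w \<in> carrier V" for g w using that by simp
    consider "r = zF \<otimes>\<^bsub>F\<^esub> xF \<ominus>\<^bsub>F\<^esub> inv p \<odot>\<^bsub>F\<^esub> (xF \<otimes>\<^bsub>F\<^esub> zF)"
      | "r = zF \<otimes>\<^bsub>F\<^esub> yF \<ominus>\<^bsub>F\<^esub> p \<odot>\<^bsub>F\<^esub> (yF \<otimes>\<^bsub>F\<^esub> zF)"
      | "r = yF \<otimes>\<^bsub>F\<^esub> xF \<ominus>\<^bsub>F\<^esub> q \<odot>\<^bsub>F\<^esub> (xF \<otimes>\<^bsub>F\<^esub> yF) \<ominus>\<^bsub>F\<^esub> zF"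
      using r unfolding rels_eq by blast
    then show ?thesis
    proof cases
      case 1
      then show ?thesis
        using v gc by (simp only:, intro V.eval_diff_eq_zero) (simp_all add: simps del: fun_module_simps)
    next
      case 2
      then show ?thesis
        using v gc by (simp only:, intro V.eval_diff_eq_zero) (simp_all add: simps del: fun_module_simps)
    next
      case 3
      have "yF \<otimes>\<^bsub>F\<^esub> xF \<ominus>\<^bsub>F\<^esub> q \<odot>\<^bsub>F\<^esub> (xF \<otimes>\<^bsub>F\<^esub> yF) \<ominus>\<^bsub>F\<^esub> zF =
          yF \<otimes>\<^bsub>F\<^esub> xF \<ominus>\<^bsub>F\<^esub> (q \<odot>\<^bsub>F\<^esub> (xF \<otimes>\<^bsub>F\<^esub> yF) \<oplus>\<^bsub>F\<^esub> zF)"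
        by (simp add: a_minus_def F.M.minus_add F.M.a_assoc)
      then show ?thesis unfolding 3
        using v gc by (simp only:, intro V.eval_diff_eq_zero) (simp_all add: simps V.eval_add del: fun_module_simps)
    qed
  qed
  then have "rels \<subseteq> ?J" using rels_closed by blast
  then have "I \<subseteq> ?J" by (rule F.A.genideal_minimal[OF V.annihilator_ideal])
  then show ?thesis using f v by blast
qed

definition \<rho> :: "(gen list \<Rightarrow> 'k) set \<Rightarrow> (nat \<times> nat \<times> nat \<Rightarrow> 'k) \<Rightarrow> nat \<times> nat \<times> nat \<Rightarrow> 'k" where
  "\<rho> = V.quot_eval"

sublocale act: algebra_action K H V \<rho> "basis (0, 0, 0)"
  unfolding H_eq \<rho>_def by (rule V.algebra_action_quot[OF ideal_I.is_ideal eval_ideal]) auto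

abbreviation gH :: "gen \<Rightarrow> (gen list \<Rightarrow> 'k) set" where "gH g \<equiv> I +>\<^bsub>F\<^esub> free_gen K g"

lemma gH_closed [simp]: "gH g \<in> carrier H"
  unfolding H_eq by (rule Q.proj_closed) simp

lemma \<rho>_gH: "v \<in> carrier V \<Longrightarrow> \<rho> (gH g) v = gen_op g v"
  unfolding \<rho>_def using V.quot_eval_proj[OF ideal_I.is_ideal eval_ideal, of "free_gen K g" v] V.eval_gen[of v g]
  by simp

lemma proj_eqI:
  assumes "f \<in> carrier F" "g \<in> carrier F" "f \<ominus>\<^bsub>F\<^esub> g \<in> I"
  shows "I +>\<^bsub>F\<^esub> f = I +>\<^bsub>F\<^esub> g"
proof -
  have "f = (f \<ominus>\<^bsub>F\<^esub> g) \<oplus>\<^bsub>F\<^esub> g" using assms(1,2) by (simp add: a_minus_def F.M.a_assoc F.M.l_neg)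
  then have "f \<in> I +>\<^bsub>F\<^esub> g" using assms(3) by (auto simp: a_r_coset_def r_coset_def)
  then show ?thesis using assms(2) by (intro ideal_I.a_repr_independence'[symmetric]) auto
qed

lemma H_commutation:
  "gH GenZ \<otimes>\<^bsub>H\<^esub> gH GenX = inv p \<odot>\<^bsub>H\<^esub> (gH GenX \<otimes>\<^bsub>H\<^esub> gH GenZ)"
  "gH GenZ \<otimes>\<^bsub>H\<^esub> gH GenY = p \<odot>\<^bsub>H\<^esub> (gH GenY \<otimes>\<^bsub>H\<^esub> gH GenZ)"
  "gH GenY \<otimes>\<^bsub>H\<^esub> gH GenX = q \<odot>\<^bsub>H\<^esub> (gH GenX \<otimes>\<^bsub>H\<^esub> gH GenY) \<oplus>\<^bsub>H\<^esub> gH GenZ"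
proof -
  note sub = F.A.genideal_self[OF rels_closed, THEN subsetD]
  have r: "zF \<otimes>\<^bsub>F\<^esub> xF \<ominus>\<^bsub>F\<^esub> inv p \<odot>\<^bsub>F\<^esub> (xF \<otimes>\<^bsub>F\<^esub> zF) \<in> rels"
    "zF \<otimes>\<^bsub>F\<^esub> yF \<ominus>\<^bsub>F\<^esub> p \<odot>\<^bsub>F\<^esub> (yF \<otimes>\<^bsub>F\<^esub> zF) \<in> rels"
    "yF \<otimes>\<^bsub>F\<^esub> xF \<ominus>\<^bsub>F\<^esub> q \<odot>\<^bsub>F\<^esub> (xF \<otimes>\<^bsub>F\<^esub> yF) \<ominus>\<^bsub>F\<^esub> zF \<in> rels"
    unfolding rels_eq by simp_all
  have "I +>\<^bsub>F\<^esub> (zF \<otimes>\<^bsub>F\<^esub> xF) = I +>\<^bsub>F\<^esub> (inv p \<odot>\<^bsub>F\<^esub> (xF \<otimes>\<^bsub>F\<^esub> zF))"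
    by (rule proj_eqI[OF _ _ sub[OF r(1)]]) auto
  then show "gH GenZ \<otimes>\<^bsub>H\<^esub> gH GenX = inv p \<odot>\<^bsub>H\<^esub> (gH GenX \<otimes>\<^bsub>H\<^esub> gH GenZ)"
    unfolding H_eq by (simp add: Q.proj_mult Q.proj_smult[symmetric])
  have "I +>\<^bsub>F\<^esub> (zF \<otimes>\<^bsub>F\<^esub> yF) = I +>\<^bsub>F\<^esub> (p \<odot>\<^bsub>F\<^esub> (yF \<otimes>\<^bsub>F\<^esub> zF))"
    by (rule proj_eqI[OF _ _ sub[OF r(2)]]) auto
  then show "gH GenZ \<otimes>\<^bsub>H\<^esub> gH GenY = p \<odot>\<^bsub>H\<^esub> (gH GenY \<otimes>\<^bsub>H\<^esub> gH GenZ)"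
    unfolding H_eq by (simp add: Q.proj_mult Q.proj_smult[symmetric])
  have "yF \<otimes>\<^bsub>F\<^esub> xF \<ominus>\<^bsub>F\<^esub> (q \<odot>\<^bsub>F\<^esub> (xF \<otimes>\<^bsub>F\<^esub> yF) \<oplus>\<^bsub>F\<^esub> zF) =
      yF \<otimes>\<^bsub>F\<^esub> xF \<ominus>\<^bsub>F\<^esub> q \<odot>\<^bsub>F\<^esub> (xF \<otimes>\<^bsub>F\<^esub> yF) \<ominus>\<^bsub>F\<^esub> zF"
    by (simp add: a_minus_def F.M.minus_add F.M.a_assoc)
  then have "I +>\<^bsub>F\<^esub> (yF \<otimes>\<^bsub>F\<^esub> xF) = I +>\<^bsub>F\<^esub> (q \<odot>\<^bsub>F\<^esub> (xF \<otimes>\<^bsub>F\<^esub> yF) \<oplus>\<^bsub>F\<^esub> zF)"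
    using sub[OF r(3)] by (intro proj_eqI) auto
  then show "gH GenY \<otimes>\<^bsub>H\<^esub> gH GenX = q \<odot>\<^bsub>H\<^esub> (gH GenX \<otimes>\<^bsub>H\<^esub> gH GenY) \<oplus>\<^bsub>H\<^esub> gH GenZ"
    unfolding H_eq by (simp add: Q.proj_mult Q.proj_add Q.proj_smult[symmetric])
qed

text \<open>Each relation is homogeneous once the factor of \<open>z\<close> is the product of those of \<open>x\<close> and \<open>y\<close>, as
  \<open>yx - qxy - z\<close> demands.\<close>

lemma rels_homogeneous:
  assumes u: "range u \<subseteq> carrier K" and v: "range v \<subseteq> carrier K" "\<And>g. u g \<otimes> v g = \<one>"
    and z: "u GenZ = u GenX \<otimes> u GenY" and r: "r \<in> rels"
  shows "\<exists>c \<in> carrier K. rescale u r = c \<odot>\<^bsub>F\<^esub> r"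
proof -
  interpret h: ring_hom_ring F F "rescale u"
    using rescale_iso[OF u v] by (intro ring_hom_ringI2 F.A.ring_axioms) (simp add: ring_iso_def)
  have uc [simp]: "u g \<in> carrier K" for g using u by auto
  have diff: "rescale u (f \<ominus>\<^bsub>F\<^esub> g) = rescale u f \<ominus>\<^bsub>F\<^esub> rescale u g" if "f \<in> carrier F" "g \<in> carrier F" for f g
    using that by (simp add: a_minus_def)
  have rc: "rescale u f \<in> carrier F" if "f \<in> carrier F" for f using rescale_closed[OF u that] .
  note simps = diff rescale_smult[OF u] rescale_free_gen[OF u] F.smult_mult_smult F.smult_diff
    F.smult_assoc1[symmetric]
  consider "r = zF \<otimes>\<^bsub>F\<^esub> xF \<ominus>\<^bsub>F\<^esub> inv p \<odot>\<^bsub>F\<^esub> (xF \<otimes>\<^bsub>F\<^esub> zF)"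
    | "r = zF \<otimes>\<^bsub>F\<^esub> yF \<ominus>\<^bsub>F\<^esub> p \<odot>\<^bsub>F\<^esub> (yF \<otimes>\<^bsub>F\<^esub> zF)"
    | "r = yF \<otimes>\<^bsub>F\<^esub> xF \<ominus>\<^bsub>F\<^esub> q \<odot>\<^bsub>F\<^esub> (xF \<otimes>\<^bsub>F\<^esub> yF) \<ominus>\<^bsub>F\<^esub> zF"
    using r unfolding rels_eq by blast
  then show ?thesis
  proof cases
    case 1
    show ?thesis unfolding 1
      by (rule bexI[of _ "u GenZ \<otimes> u GenX"]) (simp_all add: simps m_ac)
  next
    case 2
    show ?thesis unfolding 2
      by (rule bexI[of _ "u GenZ \<otimes> u GenY"]) (simp_all add: simps m_ac)
  next
    case 3
    show ?thesis unfolding 3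
      by (rule bexI[of _ "u GenX \<otimes> u GenY"]) (simp_all add: simps z m_ac)
  qed
qed

lemma torus_automorphism:
  assumes a: "a \<in> Units K" and b: "b \<in> Units K"
  obtains \<alpha> where "\<alpha> \<in> ring_iso H H"
    "\<And>c C. \<lbrakk>c \<in> carrier K; C \<in> carrier H\<rbrakk> \<Longrightarrow> \<alpha> (c \<odot>\<^bsub>H\<^esub> C) = c \<odot>\<^bsub>H\<^esub> \<alpha> C"
    "\<alpha> (gH GenX) = a \<odot>\<^bsub>H\<^esub> gH GenX" "\<alpha> (gH GenY) = b \<odot>\<^bsub>H\<^esub> gH GenY"
    "\<alpha> (gH GenZ) = (a \<otimes> b) \<odot>\<^bsub>H\<^esub> gH GenZ"
proof
  have [simp]: "a \<in> carrier K" "b \<in> carrier K" "inv a \<in> carrier K" "inv b \<in> carrier K" using a b by auto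
  define u where "u g = (case g of GenX \<Rightarrow> a | GenY \<Rightarrow> b | GenZ \<Rightarrow> a \<otimes> b)" for g
  define v where "v g = (case g of GenX \<Rightarrow> inv a | GenY \<Rightarrow> inv b | GenZ \<Rightarrow> inv a \<otimes> inv b)" for g
  have u: "range u \<subseteq> carrier K" and v: "range v \<subseteq> carrier K" by (auto simp: u_def v_def split: gen.split)
  have "(a \<otimes> b) \<otimes> (inv a \<otimes> inv b) = (a \<otimes> inv a) \<otimes> (b \<otimes> inv b)" by (simp add: m_ac)
  then have uv: "u g \<otimes> v g = \<one>" for g using a b by (cases g) (simp_all add: u_def v_def)
  then have vu: "v g \<otimes> u g = \<one>" for g using u v m_comm[of "v g" "u g"] by (auto simp: image_subset_iff)
  note iso = rescale_iso[OF u v uv] 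
  have stable: "rescale u ` I = I"
    by (rule rescale_genideal[OF u v uv rels_closed rels_homogeneous[OF u v uv] rels_homogeneous[OF v u vu]])
       (simp_all add: u_def v_def)
  note aut = Q.automorphism_quot[OF iso stable rescale_smult[OF u]]
  show "image (rescale u) \<in> ring_iso H H" unfolding H_eq by (rule aut(1))
  show "\<And>c C. \<lbrakk>c \<in> carrier K; C \<in> carrier H\<rbrakk> \<Longrightarrow> rescale u ` (c \<odot>\<^bsub>H\<^esub> C) = c \<odot>\<^bsub>H\<^esub> (rescale u ` C)"
    unfolding H_eq by (rule aut(3))
  have "rescale u ` gH g = u g \<odot>\<^bsub>H\<^esub> gH g" for g
    unfolding H_eq using u by (simp add: aut(2) rescale_free_gen Q.proj_smult image_subset_iff)
  then show "rescale u ` gH GenX = a \<odot>\<^bsub>H\<^esub> gH GenX" "rescale u ` gH GenY = b \<odot>\<^bsub>H\<^esub> gH GenY"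
    "rescale u ` gH GenZ = (a \<otimes> b) \<odot>\<^bsub>H\<^esub> gH GenZ"
    by (simp_all add: u_def)
qed

lemma H_generated: "generate_ring H (act.scalars \<union> range gH) = carrier H"
proof
  let ?G = "act.scalars \<union> range gH"
  have G: "?G \<subseteq> carrier H" by auto
  show "generate_ring H ?G \<subseteq> carrier H" by (rule act.A.generate_ring_incl[OF G])
  have "I +>\<^bsub>F\<^esub> f \<in> generate_ring H ?G" if "f \<in> carrier F" for f
    using that
  proof (induction rule: free_algebra_induct)
    case one
    then show ?case using generate_ring.one[of H ?G] by (simp only: Q.proj_one H_eq)
  next
    case (add f g)
    then show ?case using generate_ring.eng_add[OF add(3,4)] by (simp add: Q.proj_add H_eq)
  next
    case (smult c f)
    have "c \<odot>\<^bsub>H\<^esub> (I +>\<^bsub>F\<^esub> f) = (c \<odot>\<^bsub>H\<^esub> \<one>\<^bsub>H\<^esub>) \<otimes>\<^bsub>H\<^esub> (I +>\<^bsub>F\<^esub> f)"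
      using smult by (intro act.smult_as_mult) (simp_all add: H_eq)
    moreover have "(c \<odot>\<^bsub>H\<^esub> \<one>\<^bsub>H\<^esub>) \<in> generate_ring H ?G" using smult by (auto intro: generate_ring.incl)
    ultimately show ?case
      using generate_ring.eng_mult[OF _ smult(3)] smult by (simp add: Q.proj_smult[symmetric] H_eq)
  next
    case (gen g f)
    have "gH g \<in> generate_ring H ?G" by (auto intro: generate_ring.incl)
    from generate_ring.eng_mult[OF this gen(2)] show ?case using gen by (simp add: Q.proj_mult H_eq)
  qed
  then show "carrier H \<subseteq> generate_ring H ?G" unfolding H_eq by (auto elim!: Q.quot_cases)
qed

lemma scalar_commutes:
  assumes "C \<in> carrier H" "D \<in> act.scalars"
  shows "C \<otimes>\<^bsub>H\<^esub> D = D \<otimes>\<^bsub>H\<^esub> C"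
proof -
  obtain c where "c \<in> carrier K" "D = c \<odot>\<^bsub>H\<^esub> \<one>\<^bsub>H\<^esub>" using assms(2) by blast
  then show ?thesis using act.smult_as_mult[of c C] assms(1) by simp
qed

lemma \<rho>_scalar: "\<lbrakk>D \<in> act.scalars; linear_endo K V \<phi>; v \<in> carrier V\<rbrakk> \<Longrightarrow> \<phi> (\<rho> D v) = \<rho> D (\<phi> v)"
  by (elim imageE) (simp add: act.\<rho>_smult act.\<rho>_one linear_endoD del: fun_module_simps)

lemma \<rho>_power:
  assumes "\<And>n. gen_op g (basis (s n)) = basis (s (Suc n))" "s 0 = (0, 0, 0)"
  shows "\<rho> (gH g [^]\<^bsub>H\<^esub> (n::nat)) (basis (0, 0, 0)) = basis (s n)"
proof (induction n)
  case 0
  then show ?case using act.\<rho>_one[OF act.e_closed] assms(2) by simp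
next
  case (Suc n)
  then show ?case
    unfolding act.A.nat_pow_Suc2[OF gH_closed]
    by (simp add: act.\<rho>_mult \<rho>_gH assms(1))
qed

text \<open>The three storeys adjoin \<open>x\<close> with the identity twist, \<open>z\<close> with the torus element \<open>(p\<^sup>-\<^sup>1, 1)\<close>, and \<open>y\<close>
  with the torus element \<open>(q, q\<^sup>-\<^sup>1p\<^sup>-\<^sup>1)\<close>. The second component of the last one is chosen so that \<open>z\<close>
  is scaled by \<open>p\<^sup>-\<^sup>1\<close>.\<close>

lemma iterated_skew_H: "iterated_skew_sub K H (carrier H)"
proof -
  let ?x = "gH GenX" and ?y = "gH GenY" and ?z = "gH GenZ"
  let ?G1 = "insert ?x act.scalars" let ?G2 = "insert ?z ?G1"
  have sc: "act.scalars \<subseteq> carrier H" by auto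
  have "basis (0, 0, 0) \<noteq> \<zero>\<^bsub>V\<^esub>" by (auto simp: basis_def fun_eq_iff)
  note base = act.scalars_base[OF field_axioms this]
  have zeroR: "\<zero>\<^bsub>H\<^esub> \<in> generate_ring H G" for G by (rule act.A.zero_in_generate)
  have one_eigen: "\<exists>c \<in> Units K. D = c \<odot>\<^bsub>H\<^esub> D" if "D \<in> carrier H" for D
    using that by (intro bexI[of _ \<one>]) auto
  have fix_scalars: "\<alpha> D = D" if iso: "\<alpha> \<in> ring_iso H H" and
    lin: "\<And>c C. \<lbrakk>c \<in> carrier K; C \<in> carrier H\<rbrakk> \<Longrightarrow> \<alpha> (c \<odot>\<^bsub>H\<^esub> C) = c \<odot>\<^bsub>H\<^esub> \<alpha> C"
    and D: "D \<in> act.scalars" for \<alpha> D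
  proof -
    have "\<alpha> \<one>\<^bsub>H\<^esub> = \<one>\<^bsub>H\<^esub>" using iso ring_hom_one by (auto simp: ring_iso_def)
    then show ?thesis using D lin by auto
  qed
  have commute_zero: "C \<otimes>\<^bsub>H\<^esub> D \<ominus>\<^bsub>H\<^esub> D \<otimes>\<^bsub>H\<^esub> C = \<zero>\<^bsub>H\<^esub>" if "C \<in> carrier H" "D \<in> act.scalars" for C D
  proof -
    have "D \<otimes>\<^bsub>H\<^esub> C \<in> carrier H" using that sc by blast
    then show ?thesis unfolding scalar_commutes[OF that] by (simp add: a_minus_def act.M.r_neg)
  qed
  have id: "(\<lambda>C. C) \<in> ring_iso H H" by (auto simp: ring_iso_def ring_hom_def bij_betw_def)
  have 1: "iterated_skew_sub K H (generate_ring H ?G1) \<and> act.faithful_on (generate_ring H ?G1)"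
  proof (rule act.ore_step[where \<alpha> = "\<lambda>C. C" and \<pi> = "slice GenX"])
    fix k n :: nat
    show "slice GenX k (\<rho> (?x [^]\<^bsub>H\<^esub> n) (basis (0, 0, 0))) = (if k = n then basis (0, 0, 0) else \<zero>\<^bsub>V\<^esub>)"
      using \<rho>_power[of GenX "\<lambda>n. (n, 0, 0)" n] slice_basis(1) gen_op_basis(1) by simp
  next
    fix C assume "C \<in> act.scalars"
    then show "?x \<otimes>\<^bsub>H\<^esub> C \<ominus>\<^bsub>H\<^esub> C \<otimes>\<^bsub>H\<^esub> ?x \<in> generate_ring H act.scalars"
      using commute_zero[OF gH_closed] zeroR by simp
  next
    fix k C v assume "C \<in> act.scalars" "v \<in> carrier V"
    then show "slice GenX k (\<rho> C v) = \<rho> C (slice GenX k v)" by (intro \<rho>_scalar slice_linear)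
  qed (use sc base id one_eigen slice_linear in auto)

  have G1: "?G1 \<subseteq> carrier H" using sc by simp
  obtain \<beta> where \<beta>: "\<beta> \<in> ring_iso H H"
    "\<And>c C. \<lbrakk>c \<in> carrier K; C \<in> carrier H\<rbrakk> \<Longrightarrow> \<beta> (c \<odot>\<^bsub>H\<^esub> C) = c \<odot>\<^bsub>H\<^esub> \<beta> C"
    "\<beta> ?x = inv p \<odot>\<^bsub>H\<^esub> ?x"
    by (rule torus_automorphism[OF Units_inv_Units[OF pq_closed(3)] Units_one_closed]) (rule that)
  have 2: "iterated_skew_sub K H (generate_ring H ?G2) \<and> act.faithful_on (generate_ring H ?G2)"
  proof (rule act.ore_step[where \<alpha> = \<beta> and \<pi> = "slice GenZ"])
    fix k n :: nat
    show "slice GenZ k (\<rho> (?z [^]\<^bsub>H\<^esub> n) (basis (0, 0, 0))) = (if k = n then basis (0, 0, 0) else \<zero>\<^bsub>V\<^esub>)"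
      using \<rho>_power[of GenZ "\<lambda>n. (0, n, 0)" n] slice_basis(2) gen_op_basis(2) by simp
  next
    fix C assume C: "C \<in> ?G1"
    show "\<exists>c\<in>Units K. \<beta> C = c \<odot>\<^bsub>H\<^esub> C"
    proof (cases "C = ?x")
      case True
      then show ?thesis using \<beta>(3) by (intro bexI[of _ "inv p"]) simp_all
    next
      case False
      then have D: "C \<in> act.scalars" using C by blast
      show ?thesis using one_eigen[OF subsetD[OF sc D]] fix_scalars[OF \<beta>(1,2) D] by simp
    qed
    show "?z \<otimes>\<^bsub>H\<^esub> C \<ominus>\<^bsub>H\<^esub> \<beta> C \<otimes>\<^bsub>H\<^esub> ?z \<in> generate_ring H ?G1"
    proof (cases "C = ?x")
      case True
      have "?z \<otimes>\<^bsub>H\<^esub> ?x = \<beta> ?x \<otimes>\<^bsub>H\<^esub> ?z"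
        unfolding \<beta>(3) H_commutation(1) by (simp add: act.smult_mult_left)
      moreover have "?z \<otimes>\<^bsub>H\<^esub> ?x \<in> carrier H" by simp
      ultimately show ?thesis using True zeroR by (simp add: a_minus_def act.M.r_neg)
    next
      case False
      then have "C \<in> act.scalars" using C by blast
      then show ?thesis using fix_scalars[OF \<beta>(1,2)] commute_zero[OF gH_closed] zeroR by simp
    qed
  next
    fix k C v assume C: "C \<in> ?G1" and v: "v \<in> carrier V"
    have sv: "slice GenZ k v \<in> carrier V" by (rule linear_endoD(1)[OF slice_linear v])
    show "slice GenZ k (\<rho> C v) = \<rho> C (slice GenZ k v)"
    proof (cases "C = ?x")
      case True
      then show ?thesis using slice_gen_op(1)[OF v] \<rho>_gH[OF v] \<rho>_gH[OF sv] by simp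
    next
      case False
      then have "C \<in> act.scalars" using C by blast
      then show ?thesis by (rule \<rho>_scalar[OF _ slice_linear v])
    qed
  next
    show "act.scalars \<subseteq> ?G1" by blast
  qed (use 1 G1 \<beta> slice_linear in auto)

  have G2: "?G2 \<subseteq> carrier H" using G1 by simp
  obtain \<gamma> where \<gamma>: "\<gamma> \<in> ring_iso H H"
    "\<And>c C. \<lbrakk>c \<in> carrier K; C \<in> carrier H\<rbrakk> \<Longrightarrow> \<gamma> (c \<odot>\<^bsub>H\<^esub> C) = c \<odot>\<^bsub>H\<^esub> \<gamma> C"
    "\<gamma> ?x = q \<odot>\<^bsub>H\<^esub> ?x" "\<gamma> ?z = (q \<otimes> (inv q \<otimes> inv p)) \<odot>\<^bsub>H\<^esub> ?z"
    by (rule torus_automorphism[OF pq_closed(4)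
          Units_m_closed[OF Units_inv_Units[OF pq_closed(4)] Units_inv_Units[OF pq_closed(3)]]])
      (rule that)
  have "q \<otimes> (inv q \<otimes> inv p) = inv p" by (simp add: m_assoc[symmetric])
  note \<gamma>z = \<gamma>(4)[unfolded this]
  have 3: "iterated_skew_sub K H (generate_ring H (insert ?y ?G2)) \<and>
    act.faithful_on (generate_ring H (insert ?y ?G2))"
  proof (rule act.ore_step[where \<alpha> = \<gamma> and \<pi> = "slice GenY"])
    fix k n :: nat
    show "slice GenY k (\<rho> (?y [^]\<^bsub>H\<^esub> n) (basis (0, 0, 0))) = (if k = n then basis (0, 0, 0) else \<zero>\<^bsub>V\<^esub>)"
      using \<rho>_power[of GenY "\<lambda>n. (0, 0, n)" n] slice_basis(3) gen_op_basis(3) by simp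
  next
    fix C assume C: "C \<in> ?G2"
    show "\<exists>c\<in>Units K. \<gamma> C = c \<odot>\<^bsub>H\<^esub> C"
    proof (cases "C = ?x \<or> C = ?z")
      case True
      then show ?thesis using \<gamma>(3) \<gamma>z pq_closed(3,4) Units_inv_Units by metis
    next
      case False
      then have D: "C \<in> act.scalars" using C by blast
      show ?thesis using one_eigen[OF subsetD[OF sc D]] fix_scalars[OF \<gamma>(1,2) D] by simp
    qed
    consider "C = ?x" | "C = ?z" | "C \<in> act.scalars" using C by blast
    then show "?y \<otimes>\<^bsub>H\<^esub> C \<ominus>\<^bsub>H\<^esub> \<gamma> C \<otimes>\<^bsub>H\<^esub> ?y \<in> generate_ring H ?G2"
    proof cases
      case 1
      have "?y \<otimes>\<^bsub>H\<^esub> ?x = ?z \<oplus>\<^bsub>H\<^esub> \<gamma> ?x \<otimes>\<^bsub>H\<^esub> ?y"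
        unfolding \<gamma>(3) H_commutation(3) by (simp add: act.smult_mult_left act.M.a_comm)
      moreover have "\<gamma> ?x \<otimes>\<^bsub>H\<^esub> ?y \<in> carrier H" by (simp add: \<gamma>(3))
      ultimately have "?y \<otimes>\<^bsub>H\<^esub> ?x \<ominus>\<^bsub>H\<^esub> \<gamma> ?x \<otimes>\<^bsub>H\<^esub> ?y = ?z"
        by (simp add: a_minus_def act.M.a_assoc act.M.r_neg)
      then show ?thesis using 1 generate_ring.incl[of ?z ?G2 H] by simp
    next
      case 2
      have "\<gamma> ?z \<otimes>\<^bsub>H\<^esub> ?y = inv p \<odot>\<^bsub>H\<^esub> (p \<odot>\<^bsub>H\<^esub> (?y \<otimes>\<^bsub>H\<^esub> ?z))"
        unfolding \<gamma>z by (simp add: act.smult_mult_left[symmetric] H_commutation(2))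
      also have "\<dots> = ?y \<otimes>\<^bsub>H\<^esub> ?z" by (simp add: act.smult_assoc1[symmetric])
      finally have "?y \<otimes>\<^bsub>H\<^esub> ?z \<ominus>\<^bsub>H\<^esub> \<gamma> ?z \<otimes>\<^bsub>H\<^esub> ?y = \<zero>\<^bsub>H\<^esub>" by (simp add: a_minus_def act.M.r_neg)
      then show ?thesis using 2 zeroR by simp
    next
      case 3
      then show ?thesis using fix_scalars[OF \<gamma>(1,2)] commute_zero[OF gH_closed] zeroR by simp
    qed
  next
    fix k C v assume C: "C \<in> ?G2" and v: "v \<in> carrier V"
    have sv: "slice GenY k v \<in> carrier V" by (rule linear_endoD(1)[OF slice_linear v])
    consider "C = ?x" | "C = ?z" | "C \<in> act.scalars" using C by blast
    then show "slice GenY k (\<rho> C v) = \<rho> C (slice GenY k v)"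
    proof cases
      case 3
      then show ?thesis by (rule \<rho>_scalar[OF _ slice_linear v])
    qed (use slice_gen_op(2,3)[OF v] \<rho>_gH[OF v] \<rho>_gH[OF sv] in simp_all)
  next
    show "act.scalars \<subseteq> ?G2" by blast
  qed (use 2 G2 \<gamma>(1,2) slice_linear in auto)

  have "range gH = {?x, ?y, ?z}"
  proof (intro equalityI subsetI)
    fix C assume "C \<in> range gH"
    then obtain g where "C = gH g" by blast
    then show "C \<in> {?x, ?y, ?z}" by (cases g) auto
  qed auto
  then have "insert ?y ?G2 = act.scalars \<union> range gH" by auto
  then show ?thesis using 3 H_generated by simp
qed

end

theorem proposition3p3:
  fixes K :: "('k, 'm) ring_scheme" and p q :: 'k
  assumes "algebraically_closed K"
    and "char_zero K"
    and "uncountable (carrier K)"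
    and "p \<in> carrier K - {\<zero>\<^bsub>K\<^esub>}"
    and "q \<in> carrier K - {\<zero>\<^bsub>K\<^esub>}"
  shows "iterated_skew_polynomial_ring K (H_alg K p q) \<and>
    prime_ring (H_alg K p q) \<and> noetherian (H_alg K p q) \<and> nc_domain (H_alg K p q)"
proof -
  have "field K" using assms(1) by (rule algebraically_closed.axioms(1))
  then interpret heisenberg_parameters K p q
    by (intro heisenberg_parameters.intro heisenberg_parameters_axioms.intro assms)
  have "(H_alg K p q)\<lparr>carrier := carrier (H_alg K p q)\<rparr> = H_alg K p q" by simp
  then show ?thesis
    using act.iterated_skew_sub_properties[OF field_axioms iterated_skew_H] iterated_skew_H
      act.assoc_algebra_axioms nc_domain_imp_prime_ring[of "H_alg K p q"]
    by (simp add: iterated_skew_polynomial_ring_def noetherian_def)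
qed

end
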